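(* Let $(X,\Sigma,\nu)$ be a $\sigma$-finite measure space whose measure $\nu$ is nonseparable. Then there exists an $(\omega_1,\omega_1)$ Souslin gap in the Boolean algebra $(L^0(\nu)/\mathrm{Fin},\subseteq^*_{\mathrm{a.e.}})$.
   Context: $\nu$ is nonseparable if the measure algebra $\Sigma/\mathcal N_\nu$ ($\mathcal N_\nu$ the null sets), with metric $d(a,b)=\nu(a\triangle b)$, is nonseparable. A random variable on $X$ with codomain $\mathcal P(\mathbb N)$ (with the Cantor topology) is a function defined on a conegligible set and measurable for the completion of $\nu$. $L^0(\nu)/\mathrm{Fin}$ is the set of equivalence classes of such random variables modulo the relation "$f(x)\triangle g(x)$ is finite for almost every $x$", ordered by $[f]\subseteq^*_{\mathrm{a.e.}}[g]$ iff $f(x)\setminus g(x)$ is finite for almost every $x$; this is a Boolean algebra. A pregap in a Boolean algebra is a pair $(A,B)$ of subsets with $a\wedge b=0$ for all $a\in A,b\in B$; it is a gap if there is no $c$ with $a<c$ for all $a\in A$ and $b<-c$ for all $b\in B$; an $(\omega_1,\omega_1)$ (pre)gap is one where $A$ and $B$ are each linearly ordered of order type $\omega_1$. A pregap $(A,B)$ in $L^0(\nu)/\mathrm{Fin}$ is Souslin if there is an enumeration $(\dot a_\alpha,\dot b_\alpha:\alpha<\omega_1)$ of representatives (so $A=\{[\dot a_\alpha]\}$, $B=\{[\dot b_\alpha]\}$) such that for every $k\in\mathbb N$ and every sequence $(E_\xi,\Gamma_\xi:\xi<\omega_1)$ with $E_\xi\in\Sigma$ of positive finite measure and $\Gamma_\xi\subseteq\omega_1$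 finite, satisfying: for almost every $x\in E_\xi$, $\bigcup_{\alpha,\beta\in\Gamma_\xi}\dot a_\alpha(x)\cap\dot b_\beta(x)\setminus k=\emptyset$ (for each $\xi$), there exist $\xi\neq\eta$ with $\nu(E_\xi\cap E_\eta)\neq 0$ and such that the set of $x\in E_\xi\cap E_\eta$ with $\bigcup_{\alpha\in\Gamma_\xi}\bigcup_{\beta\in\Gamma_\eta}(\dot a_\alpha(x)\cap\dot b_\beta(x)\setminus k)\cup(\dot a_\beta(x)\cap\dot b_\alpha(x)\setminus k)=\emptyset$ has positive measure. (Here $k=\{0,\dots,k-1\}$.) *)

theory Defs
  imports "HOL-Analysis.Analysis" "HOL-Algebra.Lattice"
begin

section \<open>Nonseparable measures\<close>

definition null_diff_rel :: "'a measure \<Rightarrow> ('a set \<times> 'a set) set"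
  where "null_diff_rel M =
    {(s, t). s \<in> sets M \<and> t \<in> sets M \<and> sym_diff s t \<in> null_sets M}"

definition measure_algebra :: "'a measure \<Rightarrow> 'a set set set"
  where "measure_algebra M = sets M // null_diff_rel M"

text \<open>
  When the measure is infinite, \<open>d(a, b) = \<nu>(a \<triangle> b)\<close> is a (finite) metric only on the elements of
  finite measure, and it is this metric space whose separability is meant. On the whole measure
  algebra, \<open>d\<close> would be an extended metric for which no measure with infinitely many disjoint
  sets of measure at least 1, for example Lebesgue measure on the real line, is separable.
  For a finite measure nothing is removed.
\<close>

definition finite_elements :: "'a measure \<Rightarrow> 'a set set set"
  where "finite_elements M = {a \<in> measure_algebra M. \<forall>s\<in>a. emeasure M s < \<infinity>}"

definition ma_dist :: "'a measure \<Rightarrow> 'a set set \<Rightarrow> 'a set set \<Rightarrow> real"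
  where "ma_dist M a b = measure M (sym_diff (SOME s. s \<in> a) (SOME t. t \<in> b))"

definition nonseparable :: "'a measure \<Rightarrow> bool"
  where "nonseparable M \<longleftrightarrow>
    \<not> separable_space (Metric_space.mtopology (finite_elements M) (ma_dist M))"


section \<open>The Boolean algebra of random sets modulo finite\<close>

text \<open>
  A random variable defined on a conegligible set \<open>D\<close> is given by a total function whose values
  outside \<open>D\<close> are irrelevant. Sets of natural numbers carry the Borel structure of the Cantor
  space \<open>nat \<Rightarrow> bool\<close> (product topology) through their characteristic functions.
\<close>

definition random_sets :: "'a measure \<Rightarrow> ('a \<Rightarrow> nat set) set"
  where "random_sets M = {f. \<exists>D \<subseteq> space M. space M - D \<in> null_sets (completion M) \<and>
    (\<lambda>x n. n \<in> f x) \<in> restrict_space (completion M) D \<rightarrow>\<^sub>M (borel :: (nat \<Rightarrow> bool) measure)}"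

definition eq_fin_rel :: "'a measure \<Rightarrow> (('a \<Rightarrow> nat set) \<times> ('a \<Rightarrow> nat set)) set"
  where "eq_fin_rel M = {(f, g). f \<in> random_sets M \<and> g \<in> random_sets M \<and>
    (AE x in M. finite (sym_diff (f x) (g x)))}"

definition fin_class :: "'a measure \<Rightarrow> ('a \<Rightarrow> nat set) \<Rightarrow> ('a \<Rightarrow> nat set) set"
  where "fin_class M f = eq_fin_rel M `` {f}"

definition L0_Fin :: "'a measure \<Rightarrow> ('a \<Rightarrow> nat set) set gorder"
  where "L0_Fin M = \<lparr>carrier = random_sets M // eq_fin_rel M, eq = (=),
    le = (\<lambda>a b. \<exists>f\<in>a. \<exists>g\<in>b. AE x in M. finite (f x - g x))\<rparr>"


section \<open>Gaps in Boolean algebras\<close>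

text \<open>Boolean algebras are given by their order; \<open>L\<close> is meant to be a complemented
  distributive lattice, in which complements are unique.\<close>

definition compl :: "('a, 'b) gorder_scheme \<Rightarrow> 'a \<Rightarrow> 'a"
  where "compl L a =
    (THE b. b \<in> carrier L \<and> a \<sqinter>\<^bsub>L\<^esub> b = \<bottom>\<^bsub>L\<^esub> \<and> a \<squnion>\<^bsub>L\<^esub> b = \<top>\<^bsub>L\<^esub>)"

definition pregap :: "('a, 'b) gorder_scheme \<Rightarrow> 'a set \<Rightarrow> 'a set \<Rightarrow> bool"
  where "pregap L A B \<longleftrightarrow> A \<subseteq> carrier L \<and> B \<subseteq> carrier L \<and>
    (\<forall>a\<in>A. \<forall>b\<in>B. a \<sqinter>\<^bsub>L\<^esub> b = \<bottom>\<^bsub>L\<^esub>)"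

definition gap :: "('a, 'b) gorder_scheme \<Rightarrow> 'a set \<Rightarrow> 'a set \<Rightarrow> bool"
  where "gap L A B \<longleftrightarrow> pregap L A B \<and>
    \<not> (\<exists>c\<in>carrier L. (\<forall>a\<in>A. a \<sqsubset>\<^bsub>L\<^esub> c) \<and> (\<forall>b\<in>B. b \<sqsubset>\<^bsub>L\<^esub> compl L c))"

text \<open>The first uncountable ordinal, as a well-order relation on a set of type \<^typ>\<open>nat set set\<close>;
  the countable ordinals are the elements of its field.\<close>

abbreviation omega1 :: "nat set rel"
  where "omega1 \<equiv> cardSuc natLeq"

definition order_type_omega1 :: "('a, 'b) gorder_scheme \<Rightarrow> 'a set \<Rightarrow> bool"
  where "order_type_omega1 L A \<longleftrightarrow> ({(a, b). a \<in> A \<and> b \<in> A \<and> a \<sqsubseteq>\<^bsub>L\<^esub> b}, omega1) \<in> ordIso"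

definition omega1_gap :: "('a, 'b) gorder_scheme \<Rightarrow> 'a set \<Rightarrow> 'a set \<Rightarrow> bool"
  where "omega1_gap L A B \<longleftrightarrow> gap L A B \<and> order_type_omega1 L A \<and> order_type_omega1 L B"


section \<open>Souslin pregaps\<close>

definition souslin_enum ::
    "'a measure \<Rightarrow> (nat set \<Rightarrow> 'a \<Rightarrow> nat set) \<Rightarrow> (nat set \<Rightarrow> 'a \<Rightarrow> nat set) \<Rightarrow> bool"
  where "souslin_enum M a b \<longleftrightarrow>
    (\<forall>(k::nat) (E :: nat set \<Rightarrow> 'a set) (\<Gamma> :: nat set \<Rightarrow> nat set set).
      (\<forall>\<xi>\<in>Field omega1. E \<xi> \<in> sets M \<and> 0 < emeasure M (E \<xi>) \<and> emeasure M (E \<xi>) < \<infinity> \<and>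
         finite (\<Gamma> \<xi>) \<and> \<Gamma> \<xi> \<subseteq> Field omega1 \<and>
         (AE x in M. x \<in> E \<xi> \<longrightarrow>
           (\<Union>\<alpha>\<in>\<Gamma> \<xi>. \<Union>\<beta>\<in>\<Gamma> \<xi>. (a \<alpha> x \<inter> b \<beta> x) - {..<k}) = {})) \<longrightarrow>
      (\<exists>\<xi>\<in>Field omega1. \<exists>\<eta>\<in>Field omega1. \<xi> \<noteq> \<eta> \<and> emeasure M (E \<xi> \<inter> E \<eta>) \<noteq> 0 \<and>
         0 < emeasure (completion M)
           {x \<in> E \<xi> \<inter> E \<eta>.
             (\<Union>\<alpha>\<in>\<Gamma> \<xi>. \<Union>\<beta>\<in>\<Gamma> \<eta>.
               ((a \<alpha> x \<inter> b \<beta> x) - {..<k}) \<union> ((a \<beta> x \<inter> b \<alpha> x) - {..<k})) = {}}))"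

definition souslin_pregap ::
    "'a measure \<Rightarrow> ('a \<Rightarrow> nat set) set set \<Rightarrow> ('a \<Rightarrow> nat set) set set \<Rightarrow> bool"
  where "souslin_pregap M A B \<longleftrightarrow> pregap (L0_Fin M) A B \<and>
    (\<exists>a b. (\<forall>\<alpha>\<in>Field omega1. a \<alpha> \<in> random_sets M \<and> b \<alpha> \<in> random_sets M) \<and>
      A = (\<lambda>\<alpha>. fin_class M (a \<alpha>)) ` Field omega1 \<and>
      B = (\<lambda>\<alpha>. fin_class M (b \<alpha>)) ` Field omega1 \<and>
      souslin_enum M a b)"


section \<open>Consistency of the definitions\<close>

lemma equiv_null_diff_rel: "equiv (sets M) (null_diff_rel M)"
proof (rule equivI)
  show "null_diff_rel M \<subseteq> sets M \<times> sets M" by (auto simp: null_diff_rel_def)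
  show "refl_on (sets M) (null_diff_rel M)" by (auto simp: null_diff_rel_def refl_on_def)
  show "sym (null_diff_rel M)" by (auto simp: null_diff_rel_def sym_def Un_commute)
  show "trans (null_diff_rel M)"
  proof (rule transI)
    fix s t u assume a: "(s, t) \<in> null_diff_rel M" "(t, u) \<in> null_diff_rel M"
    then have "sym_diff s t \<union> sym_diff t u \<in> null_sets M"
      by (auto simp: null_diff_rel_def)
    moreover have "sym_diff s u \<in> sets M" using a by (auto simp: null_diff_rel_def)
    ultimately have "sym_diff s u \<in> null_sets M"
      by (rule null_sets_subset) auto
    then show "(s, u) \<in> null_diff_rel M" using a by (auto simp: null_diff_rel_def)
  qed
qed

lemma finite_elements_rep:
  assumes "a \<in> finite_elements M"
  shows "(SOME s. s \<in> a) \<in> fmeasurable M" "a = null_diff_rel M `` {SOME s. s \<in> a}"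
proof -
  from assms obtain s where s: "s \<in> sets M" "a = null_diff_rel M `` {s}"
    by (auto simp: finite_elements_def measure_algebra_def elim: quotientE)
  have sa: "s \<in> a" using s equiv_null_diff_rel[of M] by (auto simp: equiv_def refl_on_def)
  then have m: "(SOME s. s \<in> a) \<in> a" by (rule someI)
  then have r: "(s, SOME s. s \<in> a) \<in> null_diff_rel M" using s by blast
  then show "a = null_diff_rel M `` {SOME s. s \<in> a}"
    using s equiv_class_eq[OF equiv_null_diff_rel] by blast
  show "(SOME s. s \<in> a) \<in> fmeasurable M"
    using m r assms unfolding fmeasurable_def null_diff_rel_def finite_elements_def by blast
qed

lemma Metric_space_finite_elements: "Metric_space (finite_elements M) (ma_dist M)"
proof
  fix a b c
  show "0 \<le> ma_dist M a b" by (simp add: ma_dist_def)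
  show "ma_dist M a b = ma_dist M b a" by (simp add: ma_dist_def Un_commute)
  assume ab: "a \<in> finite_elements M" "b \<in> finite_elements M"
  note ra = finite_elements_rep[OF ab(1)] and rb = finite_elements_rep[OF ab(2)]
  define s t where "s = (SOME s. s \<in> a)" and "t = (SOME s. s \<in> b)"
  have st: "sym_diff s t \<in> fmeasurable M" "s \<in> sets M" "t \<in> sets M"
    using ra(1) rb(1) by (auto simp: s_def t_def)
  have "ma_dist M a b = 0 \<longleftrightarrow> sym_diff s t \<in> null_sets M"
    using st by (simp add: ma_dist_def s_def[symmetric] t_def[symmetric] measure_def
        null_sets_def fmeasurable_def enn2real_eq_0_iff) (metis less_irrefl)
  also have "\<dots> \<longleftrightarrow> (s, t) \<in> null_diff_rel M" using st by (simp add: null_diff_rel_def)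
  also have "\<dots> \<longleftrightarrow> a = b"
    using eq_equiv_class_iff[OF equiv_null_diff_rel st(2,3)] ra(2) rb(2)
    by (simp add: s_def t_def)
  finally show "ma_dist M a b = 0 \<longleftrightarrow> a = b" .
  assume c: "c \<in> finite_elements M"
  define u where "u = (SOME s. s \<in> c)"
  have u: "u \<in> fmeasurable M" "s \<in> fmeasurable M" "t \<in> fmeasurable M"
    using finite_elements_rep(1)[OF c] ra(1) rb(1) by (auto simp: u_def s_def t_def)
  have "measure M (sym_diff s u) \<le> measure M (sym_diff s t \<union> sym_diff t u)"
    using u by (intro measure_mono_fmeasurable) auto
  also have "\<dots> \<le> measure M (sym_diff s t) + measure M (sym_diff t u)"
    using u by (intro measure_Un_le) auto
  finally show "ma_dist M a c \<le> ma_dist M a b + ma_dist M b c"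
    by (simp add: ma_dist_def s_def t_def u_def)
qed

instance bool :: second_countable_topology
proof
  show "\<exists>B::bool set set. countable B \<and> open = generate_topology B"
    by (rule exI[of _ UNIV])
      (auto simp: fun_eq_iff open_discrete intro: generate_topology.Basis countable_finite)
qed

lemma random_sets_iff:
  "f \<in> random_sets M \<longleftrightarrow> (\<forall>n. {x \<in> space M. n \<in> f x} \<in> sets (completion M))"
proof
  assume "f \<in> random_sets M"
  then obtain D where D: "D \<subseteq> space M" "space M - D \<in> null_sets (completion M)"
    and f: "(\<lambda>x n. n \<in> f x) \<in> restrict_space (completion M) D \<rightarrow>\<^sub>M (borel :: (nat \<Rightarrow> bool) measure)"
    by (auto simp: random_sets_def)
  have Ds: "D \<in> sets (completion M)"
    using D by (metis Diff_Diff_Int inf.absorb_iff2 null_setsD2 sets.compl_sets space_completion)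
  show "\<forall>n. {x \<in> space M. n \<in> f x} \<in> sets (completion M)"
  proof
    fix n
    have "open ((\<lambda>h::nat \<Rightarrow> bool. h n) -` {True})"
      by (intro open_vimage open_discrete continuous_on_product_coordinates)
    then have "(\<lambda>x n. n \<in> f x) -` ((\<lambda>h. h n) -` {True}) \<inter> space (restrict_space (completion M) D)
        \<in> sets (restrict_space (completion M) D)"
      by (intro measurable_sets[OF f] borel_open)
    moreover have "(\<lambda>x n. n \<in> f x) -` ((\<lambda>h. h n) -` {True}) \<inter>
        space (restrict_space (completion M) D) = {x \<in> D. n \<in> f x}"
      using D by (auto simp: space_restrict_space)
    ultimately have 1: "{x \<in> D. n \<in> f x} \<in> sets (completion M)"
      using sets_restrict_space_subset[OF Ds] by auto
    have "{x \<in> space M - D. n \<in> f x} \<in> sets (completion M)"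
      using D(2) by (auto simp: null_sets_completion_iff2 intro: null_sets_completion)
    with 1 have "{x \<in> D. n \<in> f x} \<union> {x \<in> space M - D. n \<in> f x} \<in> sets (completion M)" by blast
    also have "{x \<in> D. n \<in> f x} \<union> {x \<in> space M - D. n \<in> f x} = {x \<in> space M. n \<in> f x}"
      using D by auto
    finally show "{x \<in> space M. n \<in> f x} \<in> sets (completion M)" .
  qed
next
  assume *: "\<forall>n. {x \<in> space M. n \<in> f x} \<in> sets (completion M)"
  have "(\<lambda>x n. n \<in> f x) \<in> completion M \<rightarrow>\<^sub>M (borel :: (nat \<Rightarrow> bool) measure)"
  proof (rule measurable_coordinatewise_then_product)
    fix n
    show "(\<lambda>x. n \<in> f x) \<in> borel_measurable (completion M)"
    proof (rule measurableI)
      fix S :: "bool set"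
      have "(\<lambda>x. n \<in> f x) \<in> completion M \<rightarrow>\<^sub>M count_space UNIV"
        using * by (simp add: pred_def)
      then show "(\<lambda>x. n \<in> f x) -` S \<inter> space (completion M) \<in> sets (completion M)"
        by (rule measurable_sets) simp
    qed simp
  qed
  then show "f \<in> random_sets M"
    by (auto simp: random_sets_def intro!: exI[of _ "space M"] measurable_restrict_space1)
qed

lemma equiv_eq_fin_rel: "equiv (random_sets M) (eq_fin_rel M)"
proof (rule equivI)
  show "eq_fin_rel M \<subseteq> random_sets M \<times> random_sets M" by (auto simp: eq_fin_rel_def)
  show "refl_on (random_sets M) (eq_fin_rel M)" by (auto simp: eq_fin_rel_def refl_on_def)
  show "sym (eq_fin_rel M)" by (auto simp: eq_fin_rel_def sym_def Un_commute)
  show "trans (eq_fin_rel M)"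
  proof (rule transI)
    fix f g h assume a: "(f, g) \<in> eq_fin_rel M" "(g, h) \<in> eq_fin_rel M"
    then have "AE x in M. finite (sym_diff (f x) (g x))" "AE x in M. finite (sym_diff (g x) (h x))"
      by (auto simp: eq_fin_rel_def)
    then have "AE x in M. finite (sym_diff (f x) (h x))"
    proof eventually_elim
      case (elim x)
      then have "finite (sym_diff (f x) (g x) \<union> sym_diff (g x) (h x))" by blast
      then show ?case by (rule rev_finite_subset) blast
    qed
    then show "(f, h) \<in> eq_fin_rel M" using a by (auto simp: eq_fin_rel_def)
  qed
qed

lemma carrier_L0_Fin: "carrier (L0_Fin M) = fin_class M ` random_sets M"
  by (auto simp: L0_Fin_def quotient_def fin_class_def)

lemma eq_L0_Fin [simp]: "eq (L0_Fin M) = (=)"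
  by (simp add: L0_Fin_def)

lemma le_L0_Fin:
  assumes "f \<in> random_sets M" "g \<in> random_sets M"
  shows "fin_class M f \<sqsubseteq>\<^bsub>L0_Fin M\<^esub> fin_class M g \<longleftrightarrow> (AE x in M. finite (f x - g x))"
proof
  assume "fin_class M f \<sqsubseteq>\<^bsub>L0_Fin M\<^esub> fin_class M g"
  then obtain f' g' where "(f, f') \<in> eq_fin_rel M" "(g, g') \<in> eq_fin_rel M"
    and fg: "AE x in M. finite (f' x - g' x)"
    by (auto simp: L0_Fin_def fin_class_def)
  then have "AE x in M. finite (sym_diff (f x) (f' x))" "AE x in M. finite (sym_diff (g x) (g' x))"
    by (auto simp: eq_fin_rel_def)
  with fg show "AE x in M. finite (f x - g x)"
  proof eventually_elim
    case (elim x)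
    then have "finite (sym_diff (f x) (f' x) \<union> (f' x - g' x) \<union> sym_diff (g x) (g' x))" by blast
    then show ?case by (rule rev_finite_subset) blast
  qed
next
  assume "AE x in M. finite (f x - g x)"
  moreover have "f \<in> fin_class M f" "g \<in> fin_class M g"
    using assms by (auto simp: fin_class_def eq_fin_rel_def)
  ultimately show "fin_class M f \<sqsubseteq>\<^bsub>L0_Fin M\<^esub> fin_class M g" by (auto simp: L0_Fin_def)
qed

lemma fin_class_eq_iff:
  assumes "f \<in> random_sets M" "g \<in> random_sets M"
  shows "fin_class M f = fin_class M g \<longleftrightarrow> (AE x in M. finite (sym_diff (f x) (g x)))"
  unfolding fin_class_def eq_equiv_class_iff[OF equiv_eq_fin_rel assms]
  using assms by (simp add: eq_fin_rel_def)

lemma random_sets_ops: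
  assumes f: "f \<in> random_sets M" and g: "g \<in> random_sets M"
  shows "(\<lambda>x. f x \<inter> g x) \<in> random_sets M" "(\<lambda>x. f x \<union> g x) \<in> random_sets M"
    "(\<lambda>x. - f x) \<in> random_sets M" "(\<lambda>x. {}) \<in> random_sets M" "(\<lambda>x. UNIV) \<in> random_sets M"
proof -
  have fg: "{x \<in> space M. n \<in> f x} \<in> sets (completion M)"
    "{x \<in> space M. n \<in> g x} \<in> sets (completion M)" for n
    using f g by (auto simp: random_sets_iff)
  show "(\<lambda>x. f x \<inter> g x) \<in> random_sets M" "(\<lambda>x. f x \<union> g x) \<in> random_sets M"
    "(\<lambda>x. - f x) \<in> random_sets M"
    using sets.Int[OF fg] sets.Un[OF fg] sets.compl_sets[OF fg(1)]
    by (auto simp: random_sets_iff set_diff_eq Int_def Un_def conj_disj_distribL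
        conj_ac cong: conj_cong)
  show "(\<lambda>x. {}) \<in> random_sets M" "(\<lambda>x. UNIV) \<in> random_sets M"
    by (auto simp: random_sets_iff)
qed

lemma partial_order_L0_Fin: "partial_order (L0_Fin M)"
proof
  fix a b c assume abc: "a \<in> carrier (L0_Fin M)" "b \<in> carrier (L0_Fin M)" "c \<in> carrier (L0_Fin M)"
  then obtain f g h where r: "f \<in> random_sets M" "g \<in> random_sets M" "h \<in> random_sets M"
    and e: "a = fin_class M f" "b = fin_class M g" "c = fin_class M h"
    by (auto simp: carrier_L0_Fin)
  show "a \<sqsubseteq>\<^bsub>L0_Fin M\<^esub> c" if "a \<sqsubseteq>\<^bsub>L0_Fin M\<^esub> b" "b \<sqsubseteq>\<^bsub>L0_Fin M\<^esub> c"
  proof -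
    have "AE x in M. finite (f x - g x)" "AE x in M. finite (g x - h x)"
      using that by (auto simp: e le_L0_Fin r)
    then have "AE x in M. finite (f x - h x)"
    proof eventually_elim
      case (elim x)
      then have "finite ((f x - g x) \<union> (g x - h x))" by blast
      then show ?case by (rule rev_finite_subset) blast
    qed
    then show ?thesis by (simp add: e le_L0_Fin r)
  qed
next
  fix a b assume ab: "a \<in> carrier (L0_Fin M)" "b \<in> carrier (L0_Fin M)"
  then obtain f g where r: "f \<in> random_sets M" "g \<in> random_sets M"
    and e: "a = fin_class M f" "b = fin_class M g"
    by (auto simp: carrier_L0_Fin)
  show "a \<sqsubseteq>\<^bsub>L0_Fin M\<^esub> a" by (simp add: e le_L0_Fin r)
  assume "a \<sqsubseteq>\<^bsub>L0_Fin M\<^esub> b" "b \<sqsubseteq>\<^bsub>L0_Fin M\<^esub> a"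
  then show "a .=\<^bsub>L0_Fin M\<^esub> b"
    by (simp add: e le_L0_Fin fin_class_eq_iff r)
qed (auto)

lemma L0_Fin_bounds:
  assumes f: "f \<in> random_sets M" and g: "g \<in> random_sets M"
  shows "greatest (L0_Fin M) (fin_class M (\<lambda>x. f x \<inter> g x))
      (Lower (L0_Fin M) {fin_class M f, fin_class M g})" (is ?inf)
    and "least (L0_Fin M) (fin_class M (\<lambda>x. f x \<union> g x))
      (Upper (L0_Fin M) {fin_class M f, fin_class M g})" (is ?sup)
proof -
  note ops = random_sets_ops[OF f g]
  have c: "fin_class M h \<in> carrier (L0_Fin M)" if "h \<in> random_sets M" for h
    using that by (auto simp: carrier_L0_Fin)
  have [simp]: "A \<inter> B - A = {}" "A \<inter> B - B = {}" "A - (A \<union> B) = {}" "B - (A \<union> B) = {}"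
    for A B :: "nat set" by auto
  show ?inf
    unfolding greatest_def Lower_def
  proof (intro conjI ballI)
    fix y assume "y \<in> {l. \<forall>x. x \<in> {fin_class M f, fin_class M g} \<inter> carrier (L0_Fin M) \<longrightarrow>
        l \<sqsubseteq>\<^bsub>L0_Fin M\<^esub> x} \<inter> carrier (L0_Fin M)"
    then obtain h where h: "h \<in> random_sets M" "y = fin_class M h"
      "AE x in M. finite (h x - f x)" "AE x in M. finite (h x - g x)"
      using f g by (auto simp: carrier_L0_Fin le_L0_Fin)
    from h(3,4) have "AE x in M. finite (h x - f x \<inter> g x)"
      by eventually_elim (simp add: Diff_Int)
    then show "y \<sqsubseteq>\<^bsub>L0_Fin M\<^esub> fin_class M (\<lambda>x. f x \<inter> g x)"
      using h ops by (simp add: le_L0_Fin)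
  qed (use c f g ops in \<open>auto simp: le_L0_Fin\<close>)
  show ?sup
    unfolding least_def Upper_def
  proof (intro conjI ballI)
    fix y assume "y \<in> {u. \<forall>x. x \<in> {fin_class M f, fin_class M g} \<inter> carrier (L0_Fin M) \<longrightarrow>
        x \<sqsubseteq>\<^bsub>L0_Fin M\<^esub> u} \<inter> carrier (L0_Fin M)"
    then obtain h where h: "h \<in> random_sets M" "y = fin_class M h"
      "AE x in M. finite (f x - h x)" "AE x in M. finite (g x - h x)"
      using f g by (auto simp: carrier_L0_Fin le_L0_Fin)
    from h(3,4) have "AE x in M. finite ((f x \<union> g x) - h x)"
      by eventually_elim (simp add: Un_Diff)
    then show "fin_class M (\<lambda>x. f x \<union> g x) \<sqsubseteq>\<^bsub>L0_Fin M\<^esub> y"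
      using h ops by (simp add: le_L0_Fin)
  qed (use c f g ops in \<open>auto simp: le_L0_Fin\<close>)
qed

lemma L0_Fin_extremes:
  "least (L0_Fin M) (fin_class M (\<lambda>x. {})) (carrier (L0_Fin M))"
  "greatest (L0_Fin M) (fin_class M (\<lambda>x. UNIV)) (carrier (L0_Fin M))"
  using random_sets_ops(4,5)[of "\<lambda>x. {}" M] random_sets_ops(4,5)
  by (auto simp: least_def greatest_def carrier_L0_Fin le_L0_Fin random_sets_iff)

lemma bounded_lattice_L0_Fin: "bounded_lattice (L0_Fin M)"
proof -
  interpret partial_order "L0_Fin M" by (rule partial_order_L0_Fin)
  show ?thesis
    by unfold_locales
      (use L0_Fin_bounds L0_Fin_extremes in \<open>auto simp: carrier_L0_Fin; blast\<close>)+
qed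

lemma L0_Fin_ops:
  assumes f: "f \<in> random_sets M" and g: "g \<in> random_sets M"
  shows "fin_class M f \<sqinter>\<^bsub>L0_Fin M\<^esub> fin_class M g = fin_class M (\<lambda>x. f x \<inter> g x)"
    and "fin_class M f \<squnion>\<^bsub>L0_Fin M\<^esub> fin_class M g = fin_class M (\<lambda>x. f x \<union> g x)"
    and "\<bottom>\<^bsub>L0_Fin M\<^esub> = fin_class M (\<lambda>x. {})"
    and "\<top>\<^bsub>L0_Fin M\<^esub> = fin_class M (\<lambda>x. UNIV)"
proof -
  interpret partial_order "L0_Fin M" by (rule partial_order_L0_Fin)
  show "fin_class M f \<sqinter>\<^bsub>L0_Fin M\<^esub> fin_class M g = fin_class M (\<lambda>x. f x \<inter> g x)"
    unfolding meet_def inf_def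
    by (rule some_equality, rule L0_Fin_bounds(1)[OF f g], erule greatest_unique, rule L0_Fin_bounds(1)[OF f g])
  show "fin_class M f \<squnion>\<^bsub>L0_Fin M\<^esub> fin_class M g = fin_class M (\<lambda>x. f x \<union> g x)"
    unfolding join_def sup_def
    by (rule some_equality, rule L0_Fin_bounds(2)[OF f g], erule least_unique, rule L0_Fin_bounds(2)[OF f g])
  show "\<bottom>\<^bsub>L0_Fin M\<^esub> = fin_class M (\<lambda>x. {})"
    unfolding bottom_def
    by (rule some_equality, rule L0_Fin_extremes(1), erule least_unique, rule L0_Fin_extremes(1))
  show "\<top>\<^bsub>L0_Fin M\<^esub> = fin_class M (\<lambda>x. UNIV)"
    unfolding top_def
    by (rule some_equality, rule L0_Fin_extremes(2), erule greatest_unique, rule L0_Fin_extremes(2))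
qed

lemma compl_L0_Fin:
  assumes f: "f \<in> random_sets M"
  shows "compl (L0_Fin M) (fin_class M f) = fin_class M (\<lambda>x. - f x)"
  unfolding compl_def
proof (rule the_equality)
  note ops = random_sets_ops[OF f f]
  show "fin_class M (\<lambda>x. - f x) \<in> carrier (L0_Fin M) \<and>
    fin_class M f \<sqinter>\<^bsub>L0_Fin M\<^esub> fin_class M (\<lambda>x. - f x) = \<bottom>\<^bsub>L0_Fin M\<^esub> \<and>
    fin_class M f \<squnion>\<^bsub>L0_Fin M\<^esub> fin_class M (\<lambda>x. - f x) = \<top>\<^bsub>L0_Fin M\<^esub>"
    using ops by (simp add: L0_Fin_ops[OF f ops(3)] carrier_L0_Fin)
next
  fix b assume b: "b \<in> carrier (L0_Fin M) \<and> fin_class M f \<sqinter>\<^bsub>L0_Fin M\<^esub> b = \<bottom>\<^bsub>L0_Fin M\<^esub> \<and>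
    fin_class M f \<squnion>\<^bsub>L0_Fin M\<^esub> b = \<top>\<^bsub>L0_Fin M\<^esub>"
  then obtain g where g: "g \<in> random_sets M" and bg: "b = fin_class M g"
    by (auto simp: carrier_L0_Fin)
  note ops = random_sets_ops[OF f g]
  have "AE x in M. finite (f x \<inter> g x)" "AE x in M. finite (UNIV - (f x \<union> g x))"
    using b by (auto simp: bg L0_Fin_ops[OF f g] fin_class_eq_iff ops)
  then have "AE x in M. finite (sym_diff (g x) (- f x))"
  proof eventually_elim
    case (elim x)
    then have "finite ((f x \<inter> g x) \<union> (UNIV - (f x \<union> g x)))" by blast
    then show ?case by (rule rev_finite_subset) blast
  qed
  then show "b = fin_class M (\<lambda>x. - f x)"
    using g ops by (simp add: bg fin_class_eq_iff)
qed

end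

theory Submission
  imports Defs "HOL-Probability.Probability" "HOL-Library.Countable_Set_Type" "HOL-Real_Asymp.Real_Asymp"
begin

text \<open>
  On some set of positive finite measure no positive part is countably generated, so Maharam's lemma
  provides mutually independent events \<open>W (\<xi>, b, n)\<close>, for \<open>\<xi>\<close> a countable ordinal, \<open>b\<close> a truth value
  and \<open>n\<close> a natural number, of probability \<open>t n = 1 / (n + 2)\<close>. The random sets
  \<open>J \<xi> b = {n. x \<in> W (\<xi>, b, n)}\<close> are infinite because \<open>\<Sum> t n = \<infinity>\<close>, and almost disjoint with a uniform
  bound on the tails because \<open>\<Sum> (t n)\<^sup>2 < \<infinity>\<close>. The towers are almost unions of the \<open>J \<xi> b\<close> over
  \<open>\<xi> < \<alpha>\<close>: a set \<open>S \<alpha>\<close> of pairs \<open>(\<xi>, n)\<close> tells from which \<open>\<xi>\<close> position \<open>n\<close> is taken. The sections of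
  \<open>S \<alpha>\<close> grow slower than \<open>h n = (n + 2) powr (1/4)\<close>, and such sets form a P-ideal, so the \<open>S \<alpha>\<close> can be
  chosen almost increasing; the uniform bound survives because \<open>\<Sum> (h n)\<^sup>2 (t n)\<^sup>2 < \<infinity>\<close>.

  A random set separating the towers would be nearly independent of most of the \<open>J \<xi> b\<close>; but whether
  or not it contains \<open>n\<close>, one of \<open>J \<xi> True\<close> and \<open>J \<xi> False\<close> must then avoid \<open>n\<close>, and almost surely this
  does not happen for all large \<open>n\<close>. For the Souslin property, condition on the coins before a
  late time \<open>N\<close>: by the sunflower lemma and Cauchy--Schwarz, two of the conditions meet in a set that
  is larger than the probability of a collision after \<open>N\<close>.
\<close>

section \<open>Maharam's lemma\<close>

text \<open>The Souslin property meets two obstacles. \<open>N\<close> is fixed from \<epsilon> and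
  the tail of the series alone, before any cylinder of early flips is chosen, and the probabilities
  of such cylinders shrink as \<open>N\<close> grows. So nothing is estimated absolutely: the common
  part of two conditions and their late collisions are both compared with the probability of the
  joint cylinder, which cancels. The bound by \<open>h\<close>, the same for all \<alpha>, gives one
  tail for all conditions. Early collisions, on the other hand, are not improbable. They are
  excluded by selecting conditions that, inside their cylinders, show heads at the same times before
  \<open>N\<close>; an early collision of \<xi> with \<eta> is then one of \<xi> with itself, which
  the hypothesis on a single condition controls.

  A separating random set may depend on all the coins, so its near independence of most of them is
  an estimate on average over many \<xi>. It comes from a variance bound, applied to each of the
  finitely many traces of the set on a block of times.\<close>

lemma exists_maximal_set:
  assumes X: "X \<in> fmeasurable M" and \<G>: "\<G> \<subseteq> sets M" "\<G> \<subseteq> Pow X" "\<G> \<noteq> {}"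
    and UN: "\<And>A::nat \<Rightarrow> 'a set. incseq A \<Longrightarrow> range A \<subseteq> \<G> \<Longrightarrow> (\<Union>i. A i) \<in> \<G>"
  obtains G where "G \<in> \<G>" "\<And>H. H \<in> \<G> \<Longrightarrow> G \<subseteq> H \<Longrightarrow> measure M H = measure M G"
proof -
  have mono: "measure M G \<le> measure M H" if "G \<in> \<G>" "H \<in> \<G>" "G \<subseteq> H" for G H
    using that \<G> by (intro measure_mono_fmeasurable fmeasurableI2[OF X]) auto
  have step: "\<exists>y. y \<in> \<G> \<and> x \<subseteq> y \<and> (\<forall>H\<in>\<G>. y \<subseteq> H \<longrightarrow> measure M H \<le> measure M y + (1/2)^n)"
    if x: "x \<in> \<G>" for x and n :: nat
  proof -
    \<comment> \<open>The supremum runs over the members above \<open>x\<close>, so that almost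
      maximal sets can be chosen along an increasing chain; no member above their union exceeds it
      by more than (1/2)^n, for any n.\<close>
    let ?S = "measure M ` {H \<in> \<G>. x \<subseteq> H}"
    have bdd: "bdd_above ?S"
      using \<G> by (intro bdd_aboveI[of _ "measure M X"]) (auto intro!: measure_mono_fmeasurable[OF _ _ X])
    have "Sup ?S - (1/2)^n < Sup ?S" by simp
    then obtain y where y: "y \<in> \<G>" "x \<subseteq> y" "Sup ?S - (1/2)^n < measure M y"
      using x less_cSupD[of ?S "Sup ?S - (1/2)^n"] by auto
    have "measure M H \<le> measure M y + (1/2)^n" if "H \<in> \<G>" "y \<subseteq> H" for H
    proof -
      have "measure M H \<le> Sup ?S" using that y by (intro cSup_upper bdd) auto
      then show ?thesis using y(3) by linarith
    qed
    then show ?thesis using y by blast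
  qed
  obtain G where G: "\<And>n. G n \<in> \<G>" "\<And>n. G n \<subseteq> G (Suc n)"
    "\<And>n H. H \<in> \<G> \<Longrightarrow> G (Suc n) \<subseteq> H \<Longrightarrow> measure M H \<le> measure M (G (Suc n)) + (1/2)^n"
    using dependent_nat_choice[of "\<lambda>n x. x \<in> \<G>" "\<lambda>n x y. x \<subseteq> y \<and>
      (\<forall>H\<in>\<G>. y \<subseteq> H \<longrightarrow> measure M H \<le> measure M y + (1/2)^n)"] step \<G>(3) by (metis all_not_in_conv)
  have inc: "incseq G" using G(2) by (rule incseq_SucI)
  have U: "(\<Union>i. G i) \<in> \<G>" using UN[OF inc] G(1) by blast
  show ?thesis
  proof (rule that[OF U])
    fix H assume H: "H \<in> \<G>" "(\<Union>i. G i) \<subseteq> H"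
    have "measure M H \<le> measure M (\<Union>i. G i) + (1/2)^n" for n
    proof -
      have "measure M H \<le> measure M (G (Suc n)) + (1/2)^n" using H by (intro G(3)) auto
      also have "measure M (G (Suc n)) \<le> measure M (\<Union>i. G i)"
        using U G(1) by (intro mono) auto
      finally show ?thesis by simp
    qed
    moreover have "(\<lambda>n. measure M (\<Union>i. G i) + (1/2)^n) \<longlonglongrightarrow> measure M (\<Union>i. G i) + 0"
      by (intro tendsto_intros LIMSEQ_power_zero) auto
    ultimately have "measure M H \<le> measure M (\<Union>i. G i) + 0"
      by (intro LIMSEQ_le_const) auto
    moreover have "measure M (\<Union>i. G i) \<le> measure M H"
      using H U by (intro mono)
    ultimately show "measure M H = measure M (\<Union>i. G i)" by simp
  qed
qed

text \<open>\<open>Y\<close> is where the conditional probability of \<open>A\<close> given \<C> is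
  at most \<open>c\<close> times that of \<open>B\<close>. No conditional expectation is formed:
  both measures are pushed to \<C>, and the Hahn decomposition there yields a set in \<C>.\<close>

lemma (in finite_measure) Hahn_decomposition_subalgebra:
  assumes \<C>: "sigma_algebra (space M) \<C>" "\<C> \<subseteq> sets M"
    and AB: "A \<in> sets M" "B \<in> sets M" and c: "0 \<le> c"
  obtains Y where "Y \<in> \<C>"
    "\<And>C. C \<in> \<C> \<Longrightarrow> C \<subseteq> Y \<Longrightarrow> measure M (A \<inter> C) \<le> c * measure M (B \<inter> C)"
    "\<And>C. C \<in> \<C> \<Longrightarrow> C \<inter> Y = {} \<Longrightarrow> c * measure M (B \<inter> C) \<le> measure M (A \<inter> C)"
proof -
  interpret \<C>: sigma_algebra "space M" \<C> by fact
  define N where "N c D = distr (density M (\<lambda>x. ennreal c * indicator D x)) (sigma (space M) \<C>) (\<lambda>x. x)"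
    for c D
  have sets_N: "sets (N c D) = \<C>" for c D
    by (simp add: N_def \<C>.space_closed)
  have meas: "(\<lambda>x. x) \<in> density M (\<lambda>x. ennreal c * indicator D x) \<rightarrow>\<^sub>M sigma (space M) \<C>" for c D
    using \<C>(2) by (auto simp: measurable_def \<C>.space_closed Int_absorb2 dest: \<C>.sets_into_space)
  have N: "emeasure (N c D) C = ennreal (c * measure M (D \<inter> C))"
    if "0 \<le> c" "D \<in> sets M" "C \<in> \<C>" for c D C
  proof -
    have C: "C \<in> sets M" "C \<subseteq> space M" using that \<C>(2) sets.sets_into_space by blast+
    have "emeasure (N c D) C = emeasure (density M (\<lambda>x. ennreal c * indicator D x)) C"
      unfolding N_def using that C
      by (subst emeasure_distr[OF meas]) (auto simp: \<C>.space_closed Int_absorb2)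
    also have "\<dots> = (\<integral>\<^sup>+x. ennreal c * indicator D x * indicator C x \<partial>M)"
      using that C by (subst emeasure_density) auto
    also have "\<dots> = (\<integral>\<^sup>+x. ennreal c * indicator (D \<inter> C) x \<partial>M)"
      by (intro nn_integral_cong) (auto simp: indicator_def)
    also have "\<dots> = ennreal c * emeasure M (D \<inter> C)"
      using that C by (intro nn_integral_cmult_indicator) auto
    finally show ?thesis
      using that by (simp add: emeasure_eq_measure ennreal_mult)
  qed
  have fin: "finite_measure (N c D)" if "0 \<le> c" "D \<in> sets M" for c D
    using N[OF that \<C>.top] by (intro finite_measureI) (simp add: N_def)
  obtain Y where Y: "Y \<in> \<C>"
    "\<And>X. X \<in> \<C> \<Longrightarrow> X \<subseteq> Y \<Longrightarrow> emeasure (N 1 A) X \<le> emeasure (N c B) X"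
    "\<And>X. X \<in> \<C> \<Longrightarrow> X \<inter> Y = {} \<Longrightarrow> emeasure (N c B) X \<le> emeasure (N 1 A) X"
    using finite_unsigned_Hahn_decomposition[OF fin[OF c AB(2)] fin[OF zero_le_one AB(1)]]
    by (auto simp: sets_N)
  show ?thesis
    using Y c AB by (intro that[of Y]) (auto simp: N)
qed

text \<open>In Maharam's terms, the measure algebra below \<open>F\<close> has countable type.
  Failure on every positive set leaves room for a new independent event above every countably
  generated subalgebra.\<close>

definition countably_generated_on :: "'a measure \<Rightarrow> 'a set \<Rightarrow> bool"
  where "countably_generated_on M F \<longleftrightarrow> (\<exists>\<D>. countable \<D> \<and> \<D> \<subseteq> sets M \<and>
    (\<forall>A\<in>sets M. A \<subseteq> F \<longrightarrow> (\<exists>C\<in>sigma_sets (space M) \<D>. sym_diff A (F \<inter> C) \<in> null_sets M)))"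

locale nowhere_countably_generated = finite_measure +
  assumes not_countably_generated_on:
    "\<And>F. F \<in> sets M \<Longrightarrow> 0 < measure M F \<Longrightarrow> \<not> countably_generated_on M F"
begin

text \<open>Take a subset \<open>A\<close> of \<open>F\<close> that is not generated, and let
  \<open>F'\<close> be the minority side relative to the subalgebra: \<open>A\<close> where it has
  at most half of \<open>F\<close>, and \<open>F - A\<close> elsewhere. If \<open>F'\<close> were
  null, \<open>A\<close> would agree with \<open>F\<close> cut down to a set of the subalgebra,
  contrary to its choice.\<close>

lemma halving:
  assumes \<D>: "countable \<D>" "\<D> \<subseteq> sets M" and F: "F \<in> sets M" "0 < measure M F"
  shows "\<exists>F'\<in>sets M. F' \<subseteq> F \<and> 0 < measure M F' \<and>
    (\<forall>C\<in>sigma_sets (space M) \<D>. measure M (F' \<inter> C) \<le> measure M (F \<inter> C) / 2)"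
proof -
  let ?\<C> = "sigma_sets (space M) \<D>"
  have sub: "?\<C> \<subseteq> sets M" using \<D>(2) by (rule sets.sigma_sets_subset)
  have alg: "sigma_algebra (space M) ?\<C>"
    using \<D>(2) sets.space_closed by (intro sigma_algebra_sigma_sets) blast
  interpret \<C>: sigma_algebra "space M" ?\<C> by (rule alg)
  have "\<not> (\<forall>A\<in>sets M. A \<subseteq> F \<longrightarrow> (\<exists>C\<in>?\<C>. sym_diff A (F \<inter> C) \<in> null_sets M))"
    using not_countably_generated_on[OF F] \<D> by (metis countably_generated_on_def)
  then obtain A where A: "A \<in> sets M" "A \<subseteq> F"
    "\<And>C. C \<in> ?\<C> \<Longrightarrow> sym_diff A (F \<inter> C) \<notin> null_sets M"
    by auto
  obtain Y where Y: "Y \<in> ?\<C>"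
    and Y1: "\<And>C. C \<in> ?\<C> \<Longrightarrow> C \<subseteq> Y \<Longrightarrow> measure M (A \<inter> C) \<le> 1 * measure M ((F - A) \<inter> C)"
    and Y2: "\<And>C. C \<in> ?\<C> \<Longrightarrow> C \<inter> Y = {} \<Longrightarrow> 1 * measure M ((F - A) \<inter> C) \<le> measure M (A \<inter> C)"
    using Hahn_decomposition_subalgebra[OF alg sub A(1) sets.Diff[OF F(1) A(1)] zero_le_one] by blast
  have Ys: "Y \<in> sets M" using Y sub by blast
  define F' where "F' = (A \<inter> Y) \<union> ((F - A) - Y)"
  have F': "F' \<in> sets M" "F' \<subseteq> F" using A F Ys by (auto simp: F'_def)
  have "sym_diff A (F \<inter> (space M - Y)) = F'"
    using A(2) sets.sets_into_space[OF F(1)] by (auto simp: F'_def)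
  then have "F' \<notin> null_sets M" using A(3)[of "space M - Y"] \<C>.compl_sets[OF Y] by simp
  then have pos: "0 < measure M F'"
    using F'(1) by (simp add: null_sets_def emeasure_eq_measure less_le)
  have "measure M (F' \<inter> C) \<le> measure M (F \<inter> C) / 2" if C: "C \<in> ?\<C>" for C
  proof -
    have Cs: "C \<in> sets M" using C sub by blast
    have "measure M (A \<inter> (C \<inter> Y)) \<le> 1 * measure M ((F - A) \<inter> (C \<inter> Y))"
      using C Y by (intro Y1 \<C>.Int) auto
    moreover have "1 * measure M ((F - A) \<inter> (C - Y)) \<le> measure M (A \<inter> (C - Y))"
      using C Y by (intro Y2 \<C>.Diff) auto
    moreover have "measure M (F' \<inter> C) = measure M (A \<inter> (C \<inter> Y)) + measure M ((F - A) \<inter> (C - Y))"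
      using A F Ys Cs by (subst finite_measure_Union[symmetric]) (auto simp: F'_def intro!: arg_cong[where f="measure M"])
    moreover have "measure M (F \<inter> C) = measure M (F \<inter> C \<inter> Y) + measure M (F \<inter> C - Y)"
      using F Ys Cs by (subst finite_measure_Union[symmetric]) (auto intro!: arg_cong[where f="measure M"])
    moreover have "measure M (F \<inter> C \<inter> Y) = measure M (A \<inter> (C \<inter> Y)) + measure M ((F - A) \<inter> (C \<inter> Y))"
      using A F Ys Cs by (subst finite_measure_Union[symmetric]) (auto intro!: arg_cong[where f="measure M"])
    moreover have "measure M (F \<inter> C - Y) = measure M (A \<inter> (C - Y)) + measure M ((F - A) \<inter> (C - Y))"
      using A F Ys Cs by (subst finite_measure_Union[symmetric]) (auto intro!: arg_cong[where f="measure M"])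
    ultimately show ?thesis by simp
  qed
  then show ?thesis using F' pos by blast
qed

lemma small_subset:
  assumes \<D>: "countable \<D>" "\<D> \<subseteq> sets M" and F: "F \<in> sets M" "0 < measure M F"
  shows "\<exists>F'\<in>sets M. F' \<subseteq> F \<and> 0 < measure M F' \<and>
    (\<forall>C\<in>sigma_sets (space M) \<D>. measure M (F' \<inter> C) \<le> (1/2)^n * measure M (F \<inter> C))"
proof (induction n)
  case 0
  then show ?case using F by (intro bexI[of _ F]) auto
next
  case (Suc n)
  then obtain F' where F': "F' \<in> sets M" "F' \<subseteq> F" "0 < measure M F'"
    "\<And>C. C\<in>sigma_sets (space M) \<D> \<Longrightarrow> measure M (F' \<inter> C) \<le> (1/2)^n * measure M (F \<inter> C)" by blast
  obtain F'' where "F'' \<in> sets M" "F'' \<subseteq> F'" "0 < measure M F''"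
    "\<And>C. C\<in>sigma_sets (space M) \<D> \<Longrightarrow> measure M (F'' \<inter> C) \<le> measure M (F' \<inter> C) / 2"
    using halving[OF \<D> F'(1,3)] by blast
  note F'' = this
  have "measure M (F'' \<inter> C) \<le> (1/2)^Suc n * measure M (F \<inter> C)" if "C\<in>sigma_sets (space M) \<D>" for C
    using F'(4)[OF that] F''(4)[OF that] by simp
  then show ?case using F' F'' by (intro bexI[of _ F'']) auto
qed

text \<open>Maharam's lemma. A set \<open>G\<close> maximal with conditional probability at most \<open>t\<close> over the
  countably generated subalgebra has conditional probability exactly \<open>t\<close>: where it is smaller, a
  piece of the complement with small conditional probability could be added.\<close>

lemma independent_set:
  assumes \<D>: "countable \<D>" "\<D> \<subseteq> sets M" and t: "0 \<le> t" "t \<le> 1"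
  shows "\<exists>G\<in>sets M. \<forall>C\<in>sigma_sets (space M) \<D>. measure M (G \<inter> C) = t * measure M C"
proof -
  let ?\<C> = "sigma_sets (space M) \<D>"
  have sub: "?\<C> \<subseteq> sets M" using \<D>(2) by (rule sets.sigma_sets_subset)
  have alg: "sigma_algebra (space M) ?\<C>"
    using \<D>(2) sets.space_closed by (intro sigma_algebra_sigma_sets) blast
  interpret \<C>: sigma_algebra "space M" ?\<C> by (rule alg)
  define \<G> where "\<G> = {G \<in> sets M. \<forall>C\<in>?\<C>. measure M (G \<inter> C) \<le> t * measure M C}"
  have "(\<Union>i. A i) \<in> \<G>" if A: "incseq A" "range A \<subseteq> \<G>" for A :: "nat \<Rightarrow> 'a set"
  proof -
    have "measure M ((\<Union>i. A i) \<inter> C) \<le> t * measure M C" if C: "C \<in> ?\<C>" for C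
    proof -
      have "A i \<inter> C \<in> sets M" for i using A(2) C sub by (auto simp: \<G>_def)
      then have "range (\<lambda>i. A i \<inter> C) \<subseteq> sets M" by blast
      moreover have "incseq (\<lambda>i. A i \<inter> C)" using A(1) unfolding incseq_def by blast
      ultimately have "(\<lambda>i. measure M (A i \<inter> C)) \<longlonglongrightarrow> measure M (\<Union>i. A i \<inter> C)"
        by (rule finite_Lim_measure_incseq)
      then have "measure M (\<Union>i. A i \<inter> C) \<le> t * measure M C"
        by (rule LIMSEQ_le_const2) (use A C in \<open>auto simp: \<G>_def\<close>)
      then show ?thesis by (simp add: Int_UN_distrib2)
    qed
    then show ?thesis using A by (auto simp: \<G>_def)
  qed
  moreover have "\<G> \<subseteq> sets M" "\<G> \<subseteq> Pow (space M)" "\<G> \<noteq> {}"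
    using t by (auto dest: sets.sets_into_space simp: \<G>_def intro!: exI[of _ "{}"])
  ultimately obtain G where G: "G \<in> \<G>" and max: "\<And>H. H \<in> \<G> \<Longrightarrow> G \<subseteq> H \<Longrightarrow> measure M H = measure M G"
    using exists_maximal_set[of "space M" M \<G>] fmeasurable_eq_sets by (metis sets.top)
  have Gs: "G \<in> sets M" and Gt: "\<And>C. C \<in> ?\<C> \<Longrightarrow> measure M (G \<inter> C) \<le> t * measure M C"
    using G by (auto simp: \<G>_def)
  \<comment> \<open>The slack (1/2)^n is what \<open>small_subset\<close> uses up: where
    \<open>G\<close> has conditional probability at most t - (1/2)^n, a set of conditional
    probability at most (1/2)^n can be added without exceeding \<open>t\<close>. Letting
    \<open>n\<close> grow determines the total mass of \<open>G\<close>.\<close>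
  have ge: "(t - (1/2)^n) * measure M (space M) \<le> measure M G" for n :: nat
  proof (cases "t < (1/2)^n")
    case True
    then show ?thesis by (smt (verit) measure_nonneg mult_nonneg_nonneg mult_minus_left)
  next
    case False
    then have t': "0 \<le> t - (1/2)^n" by simp
    obtain Y where Y: "Y \<in> ?\<C>"
      and Y1: "\<And>C. C \<in> ?\<C> \<Longrightarrow> C \<subseteq> Y \<Longrightarrow> measure M (G \<inter> C) \<le> (t - (1/2)^n) * measure M (space M \<inter> C)"
      and Y2: "\<And>C. C \<in> ?\<C> \<Longrightarrow> C \<inter> Y = {} \<Longrightarrow> (t - (1/2)^n) * measure M (space M \<inter> C) \<le> measure M (G \<inter> C)"
      using Hahn_decomposition_subalgebra[OF alg sub Gs sets.top t'] by blast
    have Ys: "Y \<in> sets M" using Y sub by blast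
    have Y0: "measure M Y = 0"
    proof (rule ccontr)
      assume "measure M Y \<noteq> 0"
      then have Ypos: "0 < measure M Y" by (simp add: less_le)
      have "measure M (G \<inter> Y) \<le> (t - (1/2)^n) * measure M Y"
        using Y1[OF Y] sets.sets_into_space[OF Ys] by (simp add: Int_absorb1)
      also have "\<dots> < 1 * measure M Y" using Ypos t by (intro mult_strict_right_mono) (auto intro: le_less_trans[of _ "1 - (1/2)^n"])
      finally have "0 < measure M (Y - G)"
        using Gs Ys by (simp add: finite_measure_Diff' Int_commute)
      from small_subset[OF \<D> _ this, of n] obtain F where F: "F \<in> sets M" "F \<subseteq> Y - G" "0 < measure M F"
        "\<And>C. C\<in>?\<C> \<Longrightarrow> measure M (F \<inter> C) \<le> (1/2)^n * measure M ((Y - G) \<inter> C)"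
        using Gs Ys by (metis sets.Diff)
      have "G \<union> F \<in> \<G>"
        unfolding \<G>_def
      proof (intro CollectI conjI ballI)
        show "G \<union> F \<in> sets M" using Gs F by auto
        fix C assume C: "C \<in> ?\<C>"
        then have Cs: "C \<in> sets M" using sub by blast
        have "measure M ((G \<union> F) \<inter> C) = measure M (G \<inter> (C - Y)) + measure M (G \<inter> (C \<inter> Y)) + measure M (F \<inter> (C \<inter> Y))"
          using F Gs Cs Ys by (subst finite_measure_Union[symmetric], auto, subst finite_measure_Union[symmetric],
              auto intro!: arg_cong[where f="measure M"])
        also have "measure M (G \<inter> (C - Y)) \<le> t * measure M (C - Y)"
          using C Y by (intro Gt \<C>.Diff) auto
        also have "measure M (G \<inter> (C \<inter> Y)) \<le> (t - (1/2)^n) * measure M (space M \<inter> (C \<inter> Y))"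
          using C Y by (intro Y1 \<C>.Int) auto
        also have "space M \<inter> (C \<inter> Y) = C \<inter> Y" using sets.sets_into_space[OF Ys] by auto
        also have "measure M (F \<inter> (C \<inter> Y)) \<le> (1/2)^n * measure M ((Y - G) \<inter> (C \<inter> Y))"
          using C Y by (intro F(4) \<C>.Int) auto
        also have "measure M ((Y - G) \<inter> (C \<inter> Y)) \<le> measure M (C \<inter> Y)"
          using Cs Ys by (intro finite_measure_mono) auto
        finally have "measure M ((G \<union> F) \<inter> C) \<le> t * (measure M (C - Y) + measure M (C \<inter> Y))"
          by (simp add: algebra_simps)
        also have "measure M (C - Y) + measure M (C \<inter> Y) = measure M C"
          using Cs Ys by (simp add: finite_measure_Diff')
        finally show "measure M ((G \<union> F) \<inter> C) \<le> t * measure M C" .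
      qed
      then have "measure M (G \<union> F) = measure M G" by (intro max) auto
      moreover have "measure M (G \<union> F) = measure M G + measure M F"
        using F Gs by (intro finite_measure_Union) auto
      ultimately show False using F by simp
    qed
    have "(t - (1/2)^n) * measure M (space M \<inter> (space M - Y)) \<le> measure M (G \<inter> (space M - Y))"
      using Y by (intro Y2) auto
    moreover have "measure M (space M \<inter> (space M - Y)) = measure M (space M)"
      using Ys Y0 by (simp add: finite_measure_compl Int_absorb1)
    moreover have "measure M (G \<inter> (space M - Y)) \<le> measure M G"
      using Gs by (intro finite_measure_mono) auto
    ultimately show ?thesis by (metis order_trans)
  qed
  have "(\<lambda>n. (t - (1/2)^n) * measure M (space M)) \<longlonglongrightarrow> (t - 0) * measure M (space M)"
    by (intro tendsto_intros LIMSEQ_power_zero) auto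
  then have le: "t * measure M (space M) \<le> measure M G"
    using LIMSEQ_le_const2[of "\<lambda>n. (t - (1/2)^n) * measure M (space M)"] ge by fastforce
  \<comment> \<open>The lower bound on \<open>C\<close> comes from the upper bound on its
    complement, subtracted from the total mass in \<open>le\<close>.\<close>
  show ?thesis
  proof (intro bexI ballI, rule antisym)
    fix C assume C: "C \<in> ?\<C>"
    then have Cs: "C \<in> sets M" using sub by blast
    show "measure M (G \<inter> C) \<le> t * measure M C" using Gt[OF C] .
    have "measure M (G \<inter> (space M - C)) \<le> t * measure M (space M - C)"
      using C by (intro Gt \<C>.compl_sets)
    moreover have "G \<inter> (space M - C) = G - C" using sets.sets_into_space[OF Gs] by auto
    moreover have "measure M (G - C) = measure M G - measure M (G \<inter> C)"
      using Gs Cs by (simp add: finite_measure_Diff')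
    ultimately show "t * measure M C \<le> measure M (G \<inter> C)"
      using le Cs by (simp add: finite_measure_compl algebra_simps)
  qed (rule Gs)
qed

end

section \<open>Countably generated parts of a measure\<close>

lemma countably_generated_on_UN:
  fixes F :: "nat \<Rightarrow> 'a set"
  assumes F: "\<And>i. F i \<in> sets M" and gen: "\<And>i. countably_generated_on M (F i)"
  shows "countably_generated_on M (\<Union>i. F i)"
proof -
  obtain \<D> where \<D>: "\<And>i. countable (\<D> i)" "\<And>i. \<D> i \<subseteq> sets M"
    "\<And>i A. A \<in> sets M \<Longrightarrow> A \<subseteq> F i \<Longrightarrow> \<exists>C\<in>sigma_sets (space M) (\<D> i). sym_diff A (F i \<inter> C) \<in> null_sets M"
    using gen unfolding countably_generated_on_def by metis
  \<comment> \<open>The \<open>F i\<close> join the generators because the sets found on different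
    pieces have to be cut down to their pieces before they are united.\<close>
  let ?\<D> = "(\<Union>i. \<D> i) \<union> range F"
  have sub: "?\<D> \<subseteq> sets M" using \<D>(2) F by blast
  show ?thesis
    unfolding countably_generated_on_def
  proof (intro exI[of _ ?\<D>] conjI ballI impI)
    show "countable ?\<D>" using \<D>(1) by auto
    show "?\<D> \<subseteq> sets M" by (rule sub)
    fix A assume A: "A \<in> sets M" "A \<subseteq> (\<Union>i. F i)"
    have "\<exists>C\<in>sigma_sets (space M) (\<D> i). sym_diff (A \<inter> F i) (F i \<inter> C) \<in> null_sets M" for i
      using A F by (intro \<D>(3)) auto
    then obtain C where C: "\<And>i. C i \<in> sigma_sets (space M) (\<D> i)"
      "\<And>i. sym_diff (A \<inter> F i) (F i \<inter> C i) \<in> null_sets M" by metis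
    have alg: "sigma_algebra (space M) (sigma_sets (space M) ?\<D>)"
      using sub sets.space_closed by (intro sigma_algebra_sigma_sets) blast
    interpret S: sigma_algebra "space M" "sigma_sets (space M) ?\<D>" by (rule alg)
    have "C i \<in> sigma_sets (space M) ?\<D>" for i
      using C(1)[of i] sigma_sets_mono''[of "\<D> i" ?\<D>] sigma_sets_subseteq[of "\<D> i" ?\<D> "space M"] by blast
    moreover have "F i \<in> sigma_sets (space M) ?\<D>" for i by (rule sigma_sets.Basic) auto
    ultimately have mem: "(\<Union>i. F i \<inter> C i) \<in> sigma_sets (space M) ?\<D>" by blast
    have "(\<Union>i. sym_diff (A \<inter> F i) (F i \<inter> C i)) \<in> null_sets M"
      using C(2) by (intro null_sets_UN)
    then have "sym_diff A ((\<Union>i. F i) \<inter> (\<Union>i. F i \<inter> C i)) \<in> null_sets M"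
    proof (rule null_sets_subset)
      have "(\<Union>i. F i \<inter> C i) \<in> sets M" using mem sets.sigma_sets_subset[OF sub] by blast
      then show "sym_diff A ((\<Union>i. F i) \<inter> (\<Union>i. F i \<inter> C i)) \<in> sets M"
        using A F by auto
      show "sym_diff A ((\<Union>i. F i) \<inter> (\<Union>i. F i \<inter> C i)) \<subseteq> (\<Union>i. sym_diff (A \<inter> F i) (F i \<inter> C i))"
        using A(2) by blast
    qed
    then show "\<exists>C\<in>sigma_sets (space M) ?\<D>. sym_diff A ((\<Union>i. F i) \<inter> C) \<in> null_sets M"
      using mem by blast
  qed
qed

lemma countably_generated_on_Un:
  assumes "F \<in> sets M" "G \<in> sets M" "countably_generated_on M F" "countably_generated_on M G"
  shows "countably_generated_on M (F \<union> G)"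
proof -
  have "countably_generated_on M (\<Union>i::nat. if i = 0 then F else G)"
    using assms by (intro countably_generated_on_UN) auto
  moreover have "(\<Union>i::nat. if i = 0 then F else G) = F \<union> G" by (auto split: if_splits)
  ultimately show ?thesis by simp
qed

lemma countably_generated_on_null_set:
  assumes "F \<in> null_sets M"
  shows "countably_generated_on M F"
  unfolding countably_generated_on_def
  using assms by (intro exI[of _ "{}"]) (auto intro: null_sets_subset sigma_sets.Empty)

text \<open>Exhaustion: in a set of finite measure, a countably generated part of maximal measure
  leaves only a null set, since any positive remainder contains a further part. By
  \<sigma>-finiteness the space is a countable union of such sets.\<close>

lemma countably_generated_on_space:
  assumes "sigma_finite_measure M"
    and ex: "\<And>E. E \<in> fmeasurable M \<Longrightarrow> 0 < measure M E \<Longrightarrow>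
      \<exists>F\<in>sets M. F \<subseteq> E \<and> 0 < measure M F \<and> countably_generated_on M F"
  shows "countably_generated_on M (space M)"
proof -
  interpret sigma_finite_measure M by fact
  have fin: "countably_generated_on M X" if X: "X \<in> fmeasurable M" for X
  proof -
    let ?\<G> = "{F \<in> sets M. F \<subseteq> X \<and> countably_generated_on M F}"
    have UN: "(\<Union>i. A i) \<in> ?\<G>" if "range A \<subseteq> ?\<G>" for A :: "nat \<Rightarrow> 'a set"
      using that by (auto intro!: countably_generated_on_UN simp: image_subset_iff)
    have "{} \<in> ?\<G>" by (auto intro: countably_generated_on_null_set)
    then have "?\<G> \<noteq> {}" by blast
    then obtain G where G: "G \<in> ?\<G>" and max: "\<And>H. H \<in> ?\<G> \<Longrightarrow> G \<subseteq> H \<Longrightarrow> measure M H = measure M G"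
      using exists_maximal_set[OF X _ _ _ UN] by (metis (no_types, lifting) Pow_iff mem_Collect_eq subsetI)
    have Gf: "G \<in> fmeasurable M" using G by (intro fmeasurableI2[OF X]) auto
    have XG: "X - G \<in> fmeasurable M" using X Gf by auto
    have "measure M (X - G) = 0"
    proof (rule ccontr)
      assume "measure M (X - G) \<noteq> 0"
      then obtain F where F: "F \<in> sets M" "F \<subseteq> X - G" "0 < measure M F" "countably_generated_on M F"
        using ex[OF XG] by (auto simp: less_le)
      then have "measure M (G \<union> F) = measure M G"
        using G by (intro max) (auto intro!: countably_generated_on_Un)
      moreover have "measure M (G \<union> F) = measure M G + measure M F"
        using F(1,2) G Gf fmeasurableI2[OF XG F(2,1)]
        by (intro measure_Union) (auto simp: fmeasurable_def)
      ultimately show False using F by simp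
    qed
    then have "X - G \<in> null_sets M"
      using XG by (intro null_setsI) (auto simp: fmeasurable_def emeasure_eq_ennreal_measure)
    then have "countably_generated_on M (X - G)" by (rule countably_generated_on_null_set)
    then have "countably_generated_on M (G \<union> (X - G))"
      using G XG by (intro countably_generated_on_Un) auto
    moreover have "G \<union> (X - G) = X" using G by blast
    ultimately show ?thesis by simp
  qed
  obtain X :: "nat \<Rightarrow> 'a set" where X: "range X \<subseteq> sets M" "\<Union>(range X) = space M"
    "\<And>i. emeasure M (X i) \<noteq> \<infinity>" "incseq X" using sigma_finite_incseq by blast
  have "X i \<in> fmeasurable M" for i using X by (auto simp: fmeasurable_def top.not_eq_extremum)
  then have "countably_generated_on M (\<Union>i. X i)" by (intro countably_generated_on_UN fin) auto
  then show ?thesis using X(2) by simp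
qed

text \<open>The sets \<open>initial_algebra \<Omega> d n \<T>\<close> are the elements of the finite algebra generated by \<open>d 0, \<dots>, d (n - 1)\<close>.\<close>

definition initial_algebra :: "'a set \<Rightarrow> (nat \<Rightarrow> 'a set) \<Rightarrow> nat \<Rightarrow> nat set set \<Rightarrow> 'a set"
  where "initial_algebra \<Omega> d n \<T> = {x \<in> \<Omega>. {i. i < n \<and> x \<in> d i} \<in> \<T>}"

lemma initial_algebra_extend:
  assumes "n \<le> m"
  shows "initial_algebra \<Omega> d n \<T> = initial_algebra \<Omega> d m {s \<in> Pow {..<m}. s \<inter> {..<n} \<in> \<T>}"
proof -
  have "{i. i < n \<and> x \<in> d i} = {i. i < m \<and> x \<in> d i} \<inter> {..<n}" for x using assms by auto
  then show ?thesis by (auto simp: initial_algebra_def)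
qed

lemma initial_algebra_UN:
  fixes k :: nat
  assumes "\<And>i. i < k \<Longrightarrow> \<exists>n. \<exists>\<T>\<subseteq>Pow {..<n}. A i = initial_algebra \<Omega> d n \<T>"
  shows "\<exists>n. \<exists>\<T>\<subseteq>Pow {..<n}. (\<Union>i<k. A i) = initial_algebra \<Omega> d n \<T>"
  using assms
proof (induction k)
  case 0
  show ?case by (intro exI[of _ 0] exI[of _ "{}"]) (auto simp: initial_algebra_def)
next
  case (Suc k)
  then obtain n \<T> where 1: "(\<Union>i<k. A i) = initial_algebra \<Omega> d n \<T>" by (meson less_SucI)
  obtain m \<U> where 2: "A k = initial_algebra \<Omega> d m \<U>" using Suc.prems by blast
  let ?l = "max n m"
  let ?V = "\<lambda>n \<T>. {s \<in> Pow {..<?l}. s \<inter> {..<n} \<in> \<T>}"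
  have "(\<Union>i<Suc k. A i) = (\<Union>i<k. A i) \<union> A k" by (auto simp: less_Suc_eq)
  also have "\<dots> = initial_algebra \<Omega> d ?l (?V n \<T>) \<union> initial_algebra \<Omega> d ?l (?V m \<U>)"
    using initial_algebra_extend[of n ?l \<Omega> d \<T>] initial_algebra_extend[of m ?l \<Omega> d \<U>] 1 2 by simp
  also have "\<dots> = initial_algebra \<Omega> d ?l (?V n \<T> \<union> ?V m \<U>)"
    by (auto simp: initial_algebra_def)
  finally show ?case by (intro exI[of _ ?l] exI[of _ "?V n \<T> \<union> ?V m \<U>"]) auto
qed

lemma initial_algebra_sets:
  assumes "\<And>i. d i \<in> sets M" and \<T>: "\<T> \<subseteq> Pow {..<n}"
  shows "initial_algebra (space M) d n \<T> \<in> sets M"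
proof -
  have "{i. i < n \<and> x \<in> d i} = s \<longleftrightarrow> (\<forall>i\<in>{..<n}. x \<in> d i \<longleftrightarrow> i \<in> s)" if "s \<in> \<T>" for s x
    using \<T> that by auto
  then have "(\<Union>s\<in>\<T>. {x \<in> space M. {i. i < n \<and> x \<in> d i} = s}) =
      (\<Union>s\<in>\<T>. {x \<in> space M. \<forall>i\<in>{..<n}. x \<in> d i \<longleftrightarrow> i \<in> s})"
    by (intro SUP_cong) simp_all
  moreover have "initial_algebra (space M) d n \<T> =
      (\<Union>s\<in>\<T>. {x \<in> space M. {i. i < n \<and> x \<in> d i} = s})"
    by (auto simp: initial_algebra_def)
  moreover have "finite \<T>" using finite_subset[OF \<T>] by simp
  moreover have "{x \<in> space M. \<forall>i\<in>{..<n}. x \<in> d i \<longleftrightarrow> i \<in> s} \<in> sets M" for s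
    using assms(1) by measurable
  ultimately show ?thesis by auto
qed

lemma sigma_sets_approx:
  assumes X: "X \<in> fmeasurable M" and d: "\<And>i. d i \<in> sets M"
    and C: "C \<in> sigma_sets (space M) (range d)" and e: "0 < e"
  shows "\<exists>n. \<exists>\<T>\<subseteq>Pow {..<n}. measure M (X \<inter> sym_diff C (initial_algebra (space M) d n \<T>)) < e"
  using C e
proof (induction arbitrary: e rule: sigma_sets.induct)
  case (Basic a)
  then obtain i where a: "a = d i" by auto
  have "{j. j < Suc i \<and> x \<in> d j} \<subseteq> {..<Suc i}" for x by auto
  then have "initial_algebra (space M) d (Suc i) {s \<in> Pow {..<Suc i}. i \<in> s} = d i"
    using sets.sets_into_space[OF d[of i]] by (auto simp: initial_algebra_def)
  then show ?case using Basic.prems a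
    by (intro exI[of _ "Suc i"] exI[of _ "{s \<in> Pow {..<Suc i}. i \<in> s}"]) auto
next
  case Empty
  then show ?case by (intro exI[of _ 0] exI[of _ "{}"]) (auto simp: initial_algebra_def)
next
  case (Compl a)
  then obtain n \<T> where T: "\<T>\<subseteq>Pow {..<n}" "measure M (X \<inter> sym_diff a (initial_algebra (space M) d n \<T>)) < e" by blast
  have "a \<subseteq> space M" using Compl.hyps d
    by (metis image_subsetI sets.sets_into_space sets.sigma_sets_subset subsetD)
  then have "sym_diff (space M - a) (initial_algebra (space M) d n (Pow {..<n} - \<T>)) =
      sym_diff a (initial_algebra (space M) d n \<T>)"
    by (auto simp: initial_algebra_def)
  then show ?case using T by (intro exI[of _ n] exI[of _ "Pow {..<n} - \<T>"]) auto
next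
  case (Union a)
  have "range d \<subseteq> sets M" using d by auto
  then have as: "a i \<in> sets M" for i using Union.hyps sets.sigma_sets_subset by blast
  have e4: "0 < e/2 * (1/2)^Suc i" for i :: nat using Union.prems by simp
  have "\<exists>A. (\<exists>n. \<exists>\<T>\<subseteq>Pow {..<n}. A = initial_algebra (space M) d n \<T>) \<and> measure M (X \<inter> sym_diff (a i) A) < e/2 * (1/2)^Suc i" for i
    using Union.IH[OF e4[of i], of i] by blast
  then obtain A where A: "\<And>i. \<exists>n. \<exists>\<T>\<subseteq>Pow {..<n}. A i = initial_algebra (space M) d n \<T>"
    "\<And>i. measure M (X \<inter> sym_diff (a i) (A i)) < e/2 * (1/2)^Suc i" by metis
  have As: "A i \<in> sets M" for i using A(1)[of i] initial_algebra_sets[of d M] d by auto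
  have [measurable]: "X \<in> sets M" using X by auto
  note [measurable] = as As
  have Xf: "X \<inter> B \<in> fmeasurable M" if "B \<in> sets M" for B using X that by (auto intro: fmeasurableI2)
  have "(\<lambda>k. measure M (X \<inter> ((\<Union>i. a i) - (\<Union>i<k. a i)))) \<longlonglongrightarrow> measure M (\<Inter>k. X \<inter> ((\<Union>i. a i) - (\<Union>i<k. a i)))"
  proof (rule Lim_measure_decseq)
    show "range (\<lambda>k. X \<inter> ((\<Union>i. a i) - (\<Union>i<k. a i))) \<subseteq> sets M" by auto
    show "decseq (\<lambda>k. X \<inter> ((\<Union>i. a i) - (\<Union>i<k. a i)))" by (fastforce simp: decseq_def)
    show "emeasure M (X \<inter> ((\<Union>i. a i) - (\<Union>i<k. a i))) \<noteq> \<infinity>" for k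
      using Xf[of "(\<Union>i. a i) - (\<Union>i<k. a i)"] by (auto simp: fmeasurable_def)
  qed
  moreover have "(\<Inter>k. X \<inter> ((\<Union>i. a i) - (\<Union>i<k. a i))) = {}" by blast
  ultimately have "(\<lambda>k. measure M (X \<inter> ((\<Union>i. a i) - (\<Union>i<k. a i)))) \<longlonglongrightarrow> 0" by simp
  from order_tendstoD(2)[OF this, of "e/2"] obtain k where
    k: "measure M (X \<inter> ((\<Union>i. a i) - (\<Union>i<k. a i))) < e/2"
    using Union.prems by (auto simp: eventually_sequentially)
  obtain n \<T> where T: "\<T>\<subseteq>Pow {..<n}" "(\<Union>i<k. A i) = initial_algebra (space M) d n \<T>"
    using initial_algebra_UN[of k A "space M" d] A(1) by blast
  have "measure M (X \<inter> sym_diff (\<Union>i. a i) (\<Union>i<k. A i)) \<le>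
      measure M ((X \<inter> ((\<Union>i. a i) - (\<Union>i<k. a i))) \<union> (\<Union>i<k. X \<inter> sym_diff (a i) (A i)))"
  proof (rule measure_mono_fmeasurable)
    show "X \<inter> sym_diff (\<Union>i. a i) (\<Union>i<k. A i) \<subseteq> (X \<inter> ((\<Union>i. a i) - (\<Union>i<k. a i))) \<union> (\<Union>i<k. X \<inter> sym_diff (a i) (A i))"
      by blast
    show "(X \<inter> ((\<Union>i. a i) - (\<Union>i<k. a i))) \<union> (\<Union>i<k. X \<inter> sym_diff (a i) (A i)) \<in> fmeasurable M"
      by (intro fmeasurable.Un fmeasurable.finite_UN Xf) auto
  qed auto
  also have "\<dots> \<le> measure M (X \<inter> ((\<Union>i. a i) - (\<Union>i<k. a i))) + measure M (\<Union>i<k. X \<inter> sym_diff (a i) (A i))"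
    by (intro measure_Un_le) auto
  also have "measure M (\<Union>i<k. X \<inter> sym_diff (a i) (A i)) \<le> (\<Sum>i<k. measure M (X \<inter> sym_diff (a i) (A i)))"
    by (intro measure_UNION_le) auto
  also have "\<dots> \<le> (\<Sum>i<k. e/2 * (1/2)^Suc i)" using A(2) by (intro sum_mono less_imp_le)
  also have "\<dots> \<le> (\<Sum>i. e/2 * (1/2)^Suc i)"
    using Union.prems by (intro sum_le_suminf summable_mult) (auto intro!: summable_geometric summable_ignore_initial_segment[of _ 1, simplified])
  also have "\<dots> = e/2" using sums_mult[OF power_half_series, of "e/2"] by (simp add: sums_iff)
  finally have "measure M (X \<inter> sym_diff (\<Union>i. a i) (\<Union>i<k. A i)) < e" using k by linarith
  then show ?case using T by auto
qed

section \<open>Separability of the measure algebra\<close>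

lemma null_sets_fmeasurable: "N \<in> null_sets M \<Longrightarrow> N \<in> fmeasurable M"
  by (auto simp: fmeasurable_def null_sets_def)

lemma null_diff_class_in_finite_elements:
  assumes "s \<in> fmeasurable M"
  shows "null_diff_rel M `` {s} \<in> finite_elements M"
proof -
  have "emeasure M t < \<infinity>" if "(s, t) \<in> null_diff_rel M" for t
  proof -
    have t: "t \<in> sets M" "sym_diff s t \<in> null_sets M" using that by (auto simp: null_diff_rel_def)
    have "emeasure M t \<le> emeasure M (s \<union> sym_diff s t)"
      using assms t by (intro emeasure_mono) auto
    also have "\<dots> = emeasure M s" using assms t by (intro emeasure_Un_null_set) auto
    finally show ?thesis using assms by (simp add: fmeasurable_def order.strict_trans1)
  qed
  then show ?thesis
    using assms by (auto simp: finite_elements_def measure_algebra_def intro: quotientI)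
qed

lemma countably_generated_imp_separable:
  assumes "sigma_finite_measure M" and gen: "countably_generated_on M (space M)"
  shows "\<not> nonseparable M"
proof -
  interpret sigma_finite_measure M by fact
  obtain X :: "nat \<Rightarrow> 'a set" where X: "range X \<subseteq> sets M" "\<Union>(range X) = space M"
    "\<And>i. emeasure M (X i) \<noteq> \<infinity>" "incseq X" using sigma_finite_incseq by blast
  have Xf: "X i \<in> fmeasurable M" for i using X by (auto simp: fmeasurable_def top.not_eq_extremum)
  obtain \<D> where \<D>: "countable \<D>" "\<D> \<subseteq> sets M"
    "\<forall>A\<in>sets M. A \<subseteq> space M \<longrightarrow> (\<exists>C\<in>sigma_sets (space M) \<D>. sym_diff A (space M \<inter> C) \<in> null_sets M)"
    using gen unfolding countably_generated_on_def by (elim exE conjE)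
  \<comment> \<open>The empty set is added to have something to enumerate; as a generator it changes
    nothing.\<close>
  define d where "d = from_nat_into (insert {} \<D>)"
  have rd: "range d = insert {} \<D>" unfolding d_def using \<D>(1) by (intro range_from_nat_into) auto
  have d: "d i \<in> sets M" for i
  proof -
    have "d i \<in> insert {} \<D>" using rd by (metis rangeI)
    then show ?thesis using \<D>(2) by auto
  qed
  \<comment> \<open>Finite initial segments of the generators give countably many sets; the cut to
    \<open>X i\<close> makes their measures finite.\<close>
  define K where "K = (\<lambda>(i, n, \<T>). initial_algebra (space M) d n \<T> \<inter> X i) ` (UNIV \<times> (SIGMA n:UNIV. Pow (Pow {..<n})))"
  have cK: "countable K"
    unfolding K_def by (intro countable_image countable_SIGMA) (auto intro: countable_finite)
  have Kf: "K \<subseteq> fmeasurable M"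
  proof
    fix s assume "s \<in> K"
    then obtain i n \<T> where s: "s = initial_algebra (space M) d n \<T> \<inter> X i" "\<T> \<subseteq> Pow {..<n}"
      by (auto simp: K_def)
    have "initial_algebra (space M) d n \<T> \<in> sets M" using d s(2) by (rule initial_algebra_sets)
    then show "s \<in> fmeasurable M" using Xf[of i] s(1) by (intro fmeasurableI2[OF Xf[of i]]) auto
  qed
  interpret ms: Metric_space "finite_elements M" "ma_dist M" by (rule Metric_space_finite_elements)
  let ?S = "(\<lambda>s. null_diff_rel M `` {s}) ` K"
  have S: "?S \<subseteq> finite_elements M" using Kf null_diff_class_in_finite_elements by blast
  have "\<exists>b\<in>?S. ma_dist M a b < e" if a: "a \<in> finite_elements M" and e: "0 < e" for a e
  proof -
    define r where "r = (SOME s. s \<in> a)"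
    have r: "r \<in> fmeasurable M" using finite_elements_rep(1)[OF a] by (simp add: r_def)
    have rX: "r - X k \<in> fmeasurable M" for k using r X by (intro fmeasurable_Diff) auto
    have "(\<lambda>k. measure M (r - X k)) \<longlonglongrightarrow> measure M (\<Inter>k. r - X k)"
    proof (rule Lim_measure_decseq)
      show "range (\<lambda>k. r - X k) \<subseteq> sets M" using rX by auto
      show "decseq (\<lambda>k. r - X k)" using X(4) by (fastforce simp: decseq_def incseq_def)
      show "emeasure M (r - X k) \<noteq> \<infinity>" for k using rX[of k] by (simp add: fmeasurable_def less_top)
    qed
    moreover have "(\<Inter>k. r - X k) = {}" using r X(2) sets.sets_into_space[of r M] by fastforce
    ultimately have "(\<lambda>k. measure M (r - X k)) \<longlonglongrightarrow> 0" by (simp only: measure_empty)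
    from order_tendstoD(2)[OF this, of "e/2"] obtain k where k: "measure M (r - X k) < e/2"
      using e by (auto simp: eventually_sequentially)
    obtain C where C: "C \<in> sigma_sets (space M) \<D>" "sym_diff r (space M \<inter> C) \<in> null_sets M"
      using \<D>(3) r sets.sets_into_space[of r M] by auto
    have C': "C \<in> sigma_sets (space M) (range d)"
      using C(1) sigma_sets_subseteq[of \<D> "range d" "space M"] rd by blast
    obtain n \<T> where T: "\<T>\<subseteq>Pow {..<n}" "measure M (X k \<inter> sym_diff C (initial_algebra (space M) d n \<T>)) < e/2"
      using sigma_sets_approx[where X="X k" and d=d and M=M, OF Xf _ C', of "e/2"] d e by auto
    define A where "A = initial_algebra (space M) d n \<T>"
    define D where "D = A \<inter> X k"
    have DK: "D \<in> K" using T(1) by (auto simp: K_def D_def A_def)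
    define b where "b = null_diff_rel M `` {D}"
    define s where "s = (SOME t. t \<in> b)"
    have Df: "D \<in> fmeasurable M" using DK Kf by blast
    have "D \<in> b" using Df by (auto simp: b_def null_diff_rel_def)
    then have "s \<in> b" unfolding s_def by (rule someI)
    then have s: "s \<in> sets M" "sym_diff D s \<in> null_sets M" by (auto simp: b_def null_diff_rel_def)
    have Cs: "C \<in> sets M" using C(1) sets.sigma_sets_subset[OF \<D>(2)] by blast
    have As: "A \<in> sets M" unfolding A_def using d T(1) by (intro initial_algebra_sets) auto
    have XCA: "X k \<inter> sym_diff C A \<in> fmeasurable M"
      using Cs As fmeasurableD[OF Xf[of k]] by (intro fmeasurableI2[OF Xf[of k]]) auto
    \<comment> \<open>Four errors. Two are null: the passage from \<open>r\<close> to the generated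
      set \<open>C\<close>, and from \<open>D\<close> to the representative \<open>s\<close> that
      \<open>SOME\<close> picks in its class. The other two, the part of \<open>r\<close> outside
      \<open>X k\<close> and the approximation of \<open>C\<close> within \<open>X k\<close>, are
      each below e/2.\<close>
    have "measure M (sym_diff r s) \<le> measure M (((r - X k) \<union> (X k \<inter> sym_diff C A)) \<union> (sym_diff r (space M \<inter> C) \<union> sym_diff D s))"
    proof (rule measure_mono_fmeasurable)
      have "X k \<subseteq> space M" using X(2) by auto
      then show "sym_diff r s \<subseteq> (r - X k \<union> (X k \<inter> sym_diff C A)) \<union> (sym_diff r (space M \<inter> C) \<union> sym_diff D s)"
        unfolding D_def by blast
      show "sym_diff r s \<in> sets M" using r s by auto
      have "sym_diff r (space M \<inter> C) \<union> sym_diff D s \<in> fmeasurable M"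
        by (rule null_sets_fmeasurable[OF null_sets.Un[OF C(2) s(2)]])
      then show "(r - X k \<union> (X k \<inter> sym_diff C A)) \<union> (sym_diff r (space M \<inter> C) \<union> sym_diff D s) \<in> fmeasurable M"
        by (rule fmeasurable.Un[OF fmeasurable.Un[OF rX XCA]])
    qed
    also have "\<dots> = measure M ((r - X k) \<union> (X k \<inter> sym_diff C A))"
      by (rule measure_Un_null_set[OF fmeasurableD[OF fmeasurable.Un[OF rX XCA]] null_sets.Un[OF C(2) s(2)]])
    also have "\<dots> \<le> measure M (r - X k) + measure M (X k \<inter> sym_diff C A)"
      using rX XCA by (intro measure_Un_le) auto
    also have "\<dots> < e" using k T(2) by (simp add: A_def)
    finally have "ma_dist M a b < e" by (simp add: ma_dist_def r_def s_def)
    moreover have "b \<in> ?S" using DK by (auto simp: b_def)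
    ultimately show ?thesis by blast
  qed
  then have near: "\<And>a e. a \<in> finite_elements M \<Longrightarrow> 0 < e \<Longrightarrow> \<exists>b\<in>?S. ma_dist M a b < e" .
  have "Abstract_Topology.closure_of ms.mtopology ?S = finite_elements M"
    unfolding ms.metric_closure_of
  proof (intro equalityI subsetI CollectI conjI allI impI)
    fix a and e :: real assume a: "a \<in> finite_elements M" "0 < e"
    then obtain b where "b \<in> ?S" "ma_dist M a b < e" using near by blast
    moreover from this have "b \<in> finite_elements M" using S by (rule_tac subsetD)
    ultimately show "\<exists>b\<in>?S. b \<in> ms.mball a e" using a by (intro bexI[of _ b]) simp_all
  qed simp_all
  then have "separable_space ms.mtopology"
    unfolding separable_space_def using S cK by (intro exI[of _ ?S]) simp
  then show ?thesis by (simp add: nonseparable_def)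
qed

lemma nonseparable_imp_nowhere_countably_generated:
  assumes "sigma_finite_measure M" "nonseparable M"
  obtains E where "E \<in> fmeasurable M" "0 < measure M E"
    "\<And>F. F \<in> sets M \<Longrightarrow> F \<subseteq> E \<Longrightarrow> 0 < measure M F \<Longrightarrow> \<not> countably_generated_on M F"
  using countably_generated_on_space[OF assms(1)] countably_generated_imp_separable[OF assms(1)] assms(2)
  by blast

lemma measure_uniform_measure_eq:
  assumes "E \<in> fmeasurable M" "A \<in> sets M"
  shows "measure (uniform_measure M E) A = measure M (E \<inter> A) / measure M E"
proof (cases "measure M E = 0")
  case True
  then have "emeasure M E = 0" using assms(1) by (auto simp: fmeasurable_def emeasure_eq_ennreal_measure)
  then have "emeasure M (E \<inter> A) = 0" using assms by (meson Int_lower1 emeasure_eq_0 fmeasurableD)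
  then show ?thesis using True assms by (simp add: measure_def emeasure_uniform_measure[OF fmeasurableD])
next
  case False
  then show ?thesis using assms
    by (intro measure_uniform_measure) (auto simp: fmeasurable_def measure_def)
qed

text \<open>Generators for a part \<open>F\<close> under the normalised measure also serve
  \<open>E \<inter> F\<close> under \<open>M\<close>, because null sets of
  \<open>uniform_measure M E\<close> meet \<open>E\<close> in null sets of \<open>M\<close>.\<close>

lemma nowhere_countably_generated_uniform_measure:
  assumes E: "E \<in> fmeasurable M" "0 < measure M E"
    and gen: "\<And>F. F \<in> sets M \<Longrightarrow> F \<subseteq> E \<Longrightarrow> 0 < measure M F \<Longrightarrow> \<not> countably_generated_on M F"
  shows "nowhere_countably_generated (uniform_measure M E)"
proof -
  let ?P = "uniform_measure M E"
  have em: "emeasure M E \<noteq> 0" "emeasure M E \<noteq> \<infinity>"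
    using E by (auto simp: fmeasurable_def measure_def)
  interpret prob_space ?P using em by (rule prob_space_uniform_measure)
  have Ef: "E \<in> sets M" using E by auto
  have null: "E \<inter> N \<in> null_sets M" if "N \<in> null_sets ?P" for N
    using that em Ef by (auto simp: null_sets_def)
  show ?thesis
  proof
    fix F assume F: "F \<in> sets ?P" "0 < measure ?P F"
    have Fs: "F \<in> sets M" using F by simp
    have "0 < measure M (E \<inter> F)"
      using F(2) E(2) by (simp add: measure_uniform_measure_eq[OF E(1) Fs] zero_less_divide_iff)
    then have "\<not> countably_generated_on M (E \<inter> F)" using Ef Fs by (intro gen) auto
    moreover have "countably_generated_on M (E \<inter> F)" if "countably_generated_on ?P F"
    proof -
      obtain \<D> where \<D>: "countable \<D>" "\<D> \<subseteq> sets M"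
        "\<forall>A\<in>sets M. A \<subseteq> F \<longrightarrow> (\<exists>C\<in>sigma_sets (space M) \<D>. sym_diff A (F \<inter> C) \<in> null_sets ?P)"
        using \<open>countably_generated_on ?P F\<close>
        unfolding countably_generated_on_def sets_uniform_measure space_uniform_measure by (elim exE conjE)
      have "\<exists>C\<in>sigma_sets (space M) \<D>. sym_diff A ((E \<inter> F) \<inter> C) \<in> null_sets M"
        if A: "A \<in> sets M" "A \<subseteq> E \<inter> F" for A
      proof -
        obtain C where C: "C \<in> sigma_sets (space M) \<D>" "sym_diff A (F \<inter> C) \<in> null_sets ?P"
          using \<D>(3) A by auto
        have "E \<inter> sym_diff A (F \<inter> C) = sym_diff A ((E \<inter> F) \<inter> C)" using A by blast
        then show ?thesis using null[OF C(2)] C(1) by auto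
      qed
      with \<D>(1,2) show ?thesis unfolding countably_generated_on_def by (intro exI[of _ \<D>]) simp
    qed
    ultimately show "\<not> countably_generated_on ?P F" by blast
  qed
qed

section \<open>Independent coin flips\<close>

text \<open>Either some point lies in infinitely many of the sets, and is moved to the kernel before
  the induction hypothesis is applied, or every point lies in finitely many, and pairwise disjoint
  sets are chosen greedily. The family is indexed, so sets at different indices may
  coincide.\<close>

lemma infinite_sunflower:
  assumes "infinite I" "\<And>i. i \<in> I \<Longrightarrow> finite (Z i)" "\<And>i. i \<in> I \<Longrightarrow> card (Z i) \<le> K"
  shows "\<exists>R J. infinite J \<and> J \<subseteq> I \<and> (\<forall>i\<in>J. \<forall>j\<in>J. i \<noteq> j \<longrightarrow> Z i \<inter> Z j = R)"
  using assms
proof (induction K arbitrary: I Z)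
  case 0
  then have "Z i = {}" if "i \<in> I" for i using that by fastforce
  then show ?case using 0 by (intro exI[of _ "{}"] exI[of _ I]) auto
next
  case (Suc K)
  show ?case
  proof (cases "\<exists>z. infinite {i \<in> I. z \<in> Z i}")
    case True
    then obtain z where z: "infinite {i \<in> I. z \<in> Z i}" by blast
    have "\<exists>R J. infinite J \<and> J \<subseteq> {i \<in> I. z \<in> Z i} \<and>
        (\<forall>i\<in>J. \<forall>j\<in>J. i \<noteq> j \<longrightarrow> (Z i - {z}) \<inter> (Z j - {z}) = R)"
      using Suc.prems z by (intro Suc.IH) (auto simp: card_Diff_singleton le_diff_conv)
    then obtain R J where J: "infinite J" "J \<subseteq> {i \<in> I. z \<in> Z i}"
      and R: "\<forall>i\<in>J. \<forall>j\<in>J. i \<noteq> j \<longrightarrow> (Z i - {z}) \<inter> (Z j - {z}) = R" by (elim exE conjE)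
    have "Z i \<inter> Z j = insert z R" if "i \<in> J" "j \<in> J" "i \<noteq> j" for i j
    proof -
      have "z \<in> Z i" "z \<in> Z j" using J(2) that by auto
      moreover have "(Z i - {z}) \<inter> (Z j - {z}) = R" using R that by blast
      ultimately show ?thesis by auto
    qed
    then show ?thesis using J by (intro exI[of _ "insert z R"] exI[of _ J]) auto
  next
    case False
    then have fin: "finite {i \<in> I. z \<in> Z i}" for z by blast
    have "\<exists>f. \<forall>n::nat. f n \<in> I \<and> (\<forall>m<n. f n \<noteq> f m \<and> Z (f n) \<inter> Z (f m) = {})"
    proof (rule dependent_wf_choice[OF wf_less_than])
      fix n :: nat and f assume f: "\<And>m. (m, n) \<in> less_than \<Longrightarrow> f m \<in> I \<and> (\<forall>l<m. f m \<noteq> f l \<and> Z (f m) \<inter> Z (f l) = {})"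
      let ?B = "\<Union>m<n. insert (f m) (\<Union>z\<in>Z (f m). {i \<in> I. z \<in> Z i})"
      have "finite ?B" using f Suc.prems(2) fin by auto
      then obtain r where "r \<in> I" "r \<notin> ?B" using Suc.prems(1) by (meson finite_subset subsetI)
      then show "\<exists>r. r \<in> I \<and> (\<forall>m<n. r \<noteq> f m \<and> Z r \<inter> Z (f m) = {})" by (intro exI[of _ r]) auto
    qed auto
    then obtain f where f: "\<And>n::nat. f n \<in> I" "\<And>n m. m < n \<Longrightarrow> f n \<noteq> f m"
      "\<And>n m. m < n \<Longrightarrow> Z (f n) \<inter> Z (f m) = {}" by metis
    have "inj f" using f(2) by (metis injI linorder_neqE_nat)
    then have inf: "infinite (range f)" by (rule range_inj_infinite)
    have disj: "Z (f n) \<inter> Z (f m) = {}" if "n \<noteq> m" for n m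
      using f(3)[of n m] f(3)[of m n] that by (cases n m rule: linorder_cases) auto
    have "Z i \<inter> Z j = {}" if ij: "i \<in> range f" "j \<in> range f" "i \<noteq> j" for i j
    proof -
      obtain n m where nm: "i = f n" "j = f m" using ij(1,2) by auto
      then have "n \<noteq> m" using ij(3) by auto
      then show ?thesis unfolding nm by (rule disj)
    qed
    moreover have "range f \<subseteq> I" using f(1) by auto
    ultimately show ?thesis using inf by (intro exI[of _ "{}"] exI[of _ "range f"] conjI) auto
  qed
qed

text \<open>Expand the integral of the square of a + \<Sum> c i 1_(X i) - l 1_R, which is
  nonnegative, and take l = s / prob R. The constant \<open>a\<close> permits centring: it is 0
  where pairs are sought, and minus the mean in \<open>sum_prob_Int_tails_le\<close>.\<close>

lemma (in prob_space) Cauchy_Schwarz_events: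
  assumes I: "finite I" and X: "\<And>i. i \<in> I \<Longrightarrow> X i \<in> events" and R: "R \<in> events"
  shows "(a * prob R + (\<Sum>i\<in>I. c i * prob (X i \<inter> R)))\<^sup>2 \<le>
    prob R * (a\<^sup>2 + 2 * a * (\<Sum>i\<in>I. c i * prob (X i)) + (\<Sum>i\<in>I. \<Sum>j\<in>I. c i * c j * prob (X i \<inter> X j)))"
proof -
  define s where "s = a * prob R + (\<Sum>i\<in>I. c i * prob (X i \<inter> R))"
  define Q where "Q = a\<^sup>2 + 2 * a * (\<Sum>i\<in>I. c i * prob (X i)) + (\<Sum>i\<in>I. \<Sum>j\<in>I. c i * c j * prob (X i \<inter> X j))"
  have nonneg: "0 \<le> Q - 2 * l * s + l\<^sup>2 * prob R" for l
  proof -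
    let ?S = "\<lambda>x. \<Sum>i\<in>I. c i * indicator (X i) x :: real"
    have eq: "(a + ?S x - l * indicator R x)\<^sup>2 =
        (a\<^sup>2 + 2 * a * ?S x + (\<Sum>i\<in>I. \<Sum>j\<in>I. c i * c j * indicator (X i \<inter> X j) x))
        - 2 * l * (a * indicator R x + (\<Sum>i\<in>I. c i * indicator (X i \<inter> R) x)) + l\<^sup>2 * indicator R x" for x
    proof -
      have "(\<Sum>i\<in>I. \<Sum>j\<in>I. c i * c j * indicator (X i \<inter> X j) x) = (?S x)\<^sup>2"
        by (simp add: power2_eq_square sum_product indicator_inter_arith algebra_simps)
      moreover have "(\<Sum>i\<in>I. c i * indicator (X i \<inter> R) x) = ?S x * indicator R x"
        by (simp add: sum_distrib_left indicator_inter_arith mult_ac)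
      moreover have "(indicator R x :: real)\<^sup>2 = indicator R x" by (simp add: indicator_def)
      ultimately show ?thesis by (simp add: power2_sum power2_diff power_mult_distrib algebra_simps)
    qed
    have "0 \<le> (\<integral>x. (a + ?S x - l * indicator R x)\<^sup>2 \<partial>M)" by (rule Bochner_Integration.integral_nonneg) simp
    also have "\<dots> = (a\<^sup>2 + 2 * a * (\<Sum>i\<in>I. c i * prob (X i)) + (\<Sum>i\<in>I. \<Sum>j\<in>I. c i * c j * prob (X i \<inter> X j)))
        - 2 * l * (a * prob R + (\<Sum>i\<in>I. c i * prob (X i \<inter> R))) + l\<^sup>2 * prob R"
    proof -
      have [simp]: "integrable M (indicator A :: 'a \<Rightarrow> real)" if "A \<in> events" for A
        using that by (simp add: integrable_real_indicator emeasure_eq_measure)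
      have [simp]: "integral\<^sup>L M (indicator A :: 'a \<Rightarrow> real) = prob A" if "A \<in> events" for A
        using that sets.sets_into_space[OF that] by (simp add: Int_absorb2)
      show ?thesis unfolding eq using X R by (simp add: prob_space)
    qed
    finally show ?thesis by (simp add: Q_def s_def)
  qed
  have "s\<^sup>2 \<le> prob R * Q"
  proof (cases "prob R = 0")
    case True
    have "prob (X i \<inter> R) = 0" if "i \<in> I" for i
      using finite_measure_mono[of "X i \<inter> R" R] R True by (simp add: measure_le_0_iff)
    then show ?thesis using True by (simp add: s_def)
  next
    case False
    then have pos: "0 < prob R" by (simp add: less_le)
    have "0 \<le> prob R * (Q - 2 * (s / prob R) * s + (s / prob R)\<^sup>2 * prob R)"
      using pos nonneg[of "s / prob R"] by (intro mult_nonneg_nonneg) auto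
    also have "\<dots> = prob R * Q - s\<^sup>2" using False by (simp add: field_simps power2_eq_square)
    finally show ?thesis by simp
  qed
  then show ?thesis by (simp add: s_def Q_def)
qed

text \<open>\<open>W (\<xi>, b, n)\<close> is the event that the coin \<open>(\<xi>, b)\<close> of bias \<open>t n\<close> shows heads at time \<open>n\<close>.\<close>

locale coin_flips = prob_space +
  fixes W :: "'i \<times> bool \<times> nat \<Rightarrow> 'a set" and D :: "'i set" and t :: "nat \<Rightarrow> real"
  assumes indep: "indep_events W (D \<times> UNIV)"
    and prob_W: "\<And>\<xi> b n. \<xi> \<in> D \<Longrightarrow> prob (W (\<xi>, b, n)) = t n"
    and t_pos: "\<And>n. 0 < t n" and t_less_1: "\<And>n. t n < 1"
begin

definition cyl :: "('i \<times> bool \<times> nat) set \<Rightarrow> ('i \<times> bool \<times> nat) set \<Rightarrow> 'a set"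
  where "cyl Z u = {x \<in> space M. \<forall>i\<in>Z. x \<in> W i \<longleftrightarrow> i \<in> u}"

text \<open>The probability that independence predicts for \<open>cyl Z u\<close>, as a formula that
  factors over disjoint index sets.\<close>

definition weight :: "('i \<times> bool \<times> nat) set \<Rightarrow> ('i \<times> bool \<times> nat) set \<Rightarrow> real"
  where "weight Z u = (\<Prod>i\<in>Z. if i \<in> u then t (snd (snd i)) else 1 - t (snd (snd i)))"

lemma W_events: "i \<in> D \<times> UNIV \<Longrightarrow> W i \<in> events"
  using indep unfolding indep_events_def by blast

lemma cyl_events:
  assumes "finite Z" "Z \<subseteq> D \<times> UNIV"
  shows "cyl Z u \<in> events"
proof -
  have "W i \<in> events" if "i \<in> Z" for i using that assms(2) W_events by blast
  then show ?thesis unfolding cyl_def using assms(1) by measurable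
qed

lemma prob_cyl:
  assumes Z: "finite Z" "Z \<subseteq> D \<times> UNIV"
  shows "prob (cyl Z u) = weight Z u"
proof (cases "Z = {}")
  case True
  then show ?thesis by (simp add: cyl_def weight_def prob_space)
next
  case False
  have "indep_sets (\<lambda>i. {W i}) (D \<times> UNIV)" using indep by (simp add: indep_events_def_alt)
  then have *: "indep_sets (\<lambda>i. sigma_sets (space M) {W i}) (D \<times> UNIV)"
    by (rule indep_sets_sigma) (simp add: Int_stable_def)
  let ?A = "\<lambda>i. if i \<in> u then W i else space M - W i"
  have "prob (\<Inter>i\<in>Z. ?A i) = (\<Prod>i\<in>Z. prob (?A i))"
    by (rule indep_setsD[OF * Z(2) False Z(1)]) (auto intro: sigma_sets.Basic sigma_sets.Compl)
  moreover have "(\<Inter>i\<in>Z. ?A i) = cyl Z u"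
  proof -
    have "x \<in> space M" if "x \<in> ?A i" "i \<in> Z" for x i
      using that W_events[of i] sets.sets_into_space[of "W i" M] Z(2) by (auto split: if_splits)
    moreover have "x \<in> ?A i \<longleftrightarrow> (x \<in> W i \<longleftrightarrow> i \<in> u)" if "x \<in> space M" for x i
      using that by simp
    ultimately show ?thesis using False unfolding cyl_def by blast
  qed
  moreover have "prob (?A i) = (if i \<in> u then t (snd (snd i)) else 1 - t (snd (snd i)))" if "i \<in> Z" for i
  proof -
    have "i \<in> D \<times> UNIV" using that Z(2) by blast
    then obtain \<xi> b n where i: "i = (\<xi>, b, n)" "\<xi> \<in> D" by (cases i) auto
    then show ?thesis using prob_compl[OF W_events[of i]] by (simp add: prob_W)
  qed
  ultimately show ?thesis unfolding weight_def by (simp cong: prod.cong)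
qed

lemma weight_pos: "0 < weight Z u"
  unfolding weight_def using t_pos t_less_1 by (intro prod_pos) (simp split: if_splits)

lemma weight_Un: "finite Z \<Longrightarrow> finite Z' \<Longrightarrow> Z \<inter> Z' = {} \<Longrightarrow> weight (Z \<union> Z') u = weight Z u * weight Z' u"
  unfolding weight_def by (rule prod.union_disjoint)

lemma weight_cong: "Z = Z' \<Longrightarrow> u \<inter> Z = v \<inter> Z \<Longrightarrow> weight Z u = weight Z' v"
  unfolding weight_def by (intro prod.cong) auto

lemma cyl_Int:
  assumes "u \<inter> (Z \<inter> Z') = v \<inter> (Z \<inter> Z')"
  shows "cyl Z u \<inter> cyl Z' v = cyl (Z \<union> Z') ((u \<inter> Z) \<union> (v \<inter> Z'))"
  using assms unfolding cyl_def by blast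

text \<open>\<open>T\<close> lists which coins are read at which times. A line
  \<open>{\<xi>} \<times> UNIV\<close> gives the random set of a single coin,
  \<open>S \<alpha>\<close> gives a tower element, and a union of sets \<open>S \<alpha>\<close> the
  union of these.\<close>

definition heads :: "bool \<Rightarrow> ('i \<times> nat) set \<Rightarrow> 'a \<Rightarrow> nat set"
  where "heads b T x = {n. \<exists>\<zeta>. (\<zeta>, n) \<in> T \<and> x \<in> W (\<zeta>, b, n)}"

lemma heads_events:
  assumes "T \<subseteq> D \<times> UNIV" "finite {\<zeta>. (\<zeta>, n) \<in> T}"
  shows "{x \<in> space M. n \<in> heads b T x} \<in> events"
proof -
  have "{x \<in> space M. n \<in> heads b T x} = (\<Union>\<zeta>\<in>{\<zeta>. (\<zeta>, n) \<in> T}. W (\<zeta>, b, n) \<inter> space M)"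
    by (auto simp: heads_def)
  moreover have "W (\<zeta>, b, n) \<in> events" if "(\<zeta>, n) \<in> T" for \<zeta>
    using that assms(1) by (intro W_events) auto
  ultimately show ?thesis using assms(2) by auto
qed

text \<open>Union bound over at most g^2 pairs of coins. By \<open>disj\<close> the two flips are
  different, so both show heads with probability (t n)^2, independently of \<open>Z\<close>, which
  contains no flip at time \<open>n\<close>.\<close>

lemma prob_cyl_heads_Int:
  assumes Z: "finite Z" "Z \<subseteq> D \<times> UNIV" "\<And>i. i \<in> Z \<Longrightarrow> snd (snd i) \<noteq> n"
    and T: "T \<subseteq> D \<times> UNIV" "T' \<subseteq> D \<times> UNIV"
    and fin: "finite {\<zeta>. (\<zeta>, n) \<in> T}" "finite {\<zeta>. (\<zeta>, n) \<in> T'}"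
    and card: "real (card {\<zeta>. (\<zeta>, n) \<in> T}) \<le> g" "real (card {\<zeta>. (\<zeta>, n) \<in> T'}) \<le> g"
    and disj: "b \<noteq> b' \<or> T \<inter> T' = {}"
  shows "prob (cyl Z u \<inter> {x \<in> space M. n \<in> heads b T x \<inter> heads b' T' x}) \<le> prob (cyl Z u) * (g\<^sup>2 * (t n)\<^sup>2)"
proof -
  let ?s = "{\<zeta>. (\<zeta>, n) \<in> T}" and ?s' = "{\<zeta>. (\<zeta>, n) \<in> T'}"
  let ?I = "\<lambda>(\<zeta>, \<zeta>'). {(\<zeta>, b, n), (\<zeta>', b', n)}"
  have fp: "finite (?s \<times> ?s')" using fin by blast
  have I: "finite (?I p)" "?I p \<subseteq> D \<times> UNIV" if "p \<in> ?s \<times> ?s'" for p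
    using that T by auto
  have C: "cyl (Z \<union> ?I p) (u \<inter> Z \<union> ?I p) \<in> events" if "p \<in> ?s \<times> ?s'" for p
    using I[OF that] Z by (intro cyl_events) auto
  have "cyl Z u \<inter> {x \<in> space M. n \<in> heads b T x \<inter> heads b' T' x} \<subseteq>
      (\<Union>p\<in>?s \<times> ?s'. cyl (Z \<union> ?I p) (u \<inter> Z \<union> ?I p))"
  proof
    fix x assume x: "x \<in> cyl Z u \<inter> {x \<in> space M. n \<in> heads b T x \<inter> heads b' T' x}"
    then obtain \<zeta> \<zeta>' where z: "(\<zeta>, n) \<in> T" "x \<in> W (\<zeta>, b, n)" "(\<zeta>', n) \<in> T'" "x \<in> W (\<zeta>', b', n)"
      by (auto simp: heads_def)
    have "x \<in> cyl (Z \<union> ?I (\<zeta>, \<zeta>')) (u \<inter> Z \<union> ?I (\<zeta>, \<zeta>'))"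
      using x z Z(3) by (auto simp: cyl_def)
    then show "x \<in> (\<Union>p\<in>?s \<times> ?s'. cyl (Z \<union> ?I p) (u \<inter> Z \<union> ?I p))" using z by blast
  qed
  then have "prob (cyl Z u \<inter> {x \<in> space M. n \<in> heads b T x \<inter> heads b' T' x}) \<le>
      prob (\<Union>p\<in>?s \<times> ?s'. cyl (Z \<union> ?I p) (u \<inter> Z \<union> ?I p))"
    using C fp by (intro finite_measure_mono sets.finite_UN) auto
  also have "\<dots> \<le> (\<Sum>p\<in>?s \<times> ?s'. prob (cyl (Z \<union> ?I p) (u \<inter> Z \<union> ?I p)))"
    using C fp by (intro finite_measure_subadditive_finite) auto
  also have "\<dots> = (\<Sum>p\<in>?s \<times> ?s'. prob (cyl Z u) * (t n)\<^sup>2)"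
  proof (rule sum.cong[OF refl])
    fix p assume p: "p \<in> ?s \<times> ?s'"
    obtain \<zeta> \<zeta>' where z: "p = (\<zeta>, \<zeta>')" "(\<zeta>, n) \<in> T" "(\<zeta>', n) \<in> T'" using p by auto
    have ne: "(\<zeta>, b, n) \<noteq> (\<zeta>', b', n)" using z disj by auto
    have dis: "Z \<inter> ?I p = {}" using Z(3) z by fastforce
    have "prob (cyl (Z \<union> ?I p) (u \<inter> Z \<union> ?I p)) = weight (Z \<union> ?I p) (u \<inter> Z \<union> ?I p)"
      using I[OF p] Z by (intro prob_cyl) auto
    also have "\<dots> = weight Z (u \<inter> Z \<union> ?I p) * weight (?I p) (u \<inter> Z \<union> ?I p)"
      using I[OF p] Z dis by (intro weight_Un) auto
    also have "weight Z (u \<inter> Z \<union> ?I p) = prob (cyl Z u)"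
      using Z dis by (subst prob_cyl) (auto intro!: weight_cong)
    also have "weight (?I p) (u \<inter> Z \<union> ?I p) = (t n)\<^sup>2"
      using ne by (simp add: z(1) weight_def power2_eq_square)
    finally show "prob (cyl (Z \<union> ?I p) (u \<inter> Z \<union> ?I p)) = prob (cyl Z u) * (t n)\<^sup>2" .
  qed
  also have "\<dots> = prob (cyl Z u) * ((real (card ?s) * real (card ?s')) * (t n)\<^sup>2)"
    by (simp add: card_cartesian_product)
  also have "\<dots> \<le> prob (cyl Z u) * (g\<^sup>2 * (t n)\<^sup>2)"
    using card unfolding power2_eq_square[of g]
    by (intro mult_left_mono mult_right_mono mult_mono) (auto intro: order_trans[OF of_nat_0_le_iff])
  finally show ?thesis .
qed

text \<open>Borel--Cantelli, with \<open>prob_cyl_heads_Int\<close> for \<open>Z = {}\<close>. The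
  case of equal truth values and disjoint \<open>T\<close>, \<open>T'\<close> serves the strictness
  of the towers.\<close>

lemma AE_finite_heads_Int:
  assumes T: "T \<subseteq> D \<times> UNIV" "T' \<subseteq> D \<times> UNIV"
    and fin: "\<And>n. finite {\<zeta>. (\<zeta>, n) \<in> T}" "\<And>n. finite {\<zeta>. (\<zeta>, n) \<in> T'}"
    and card: "\<And>n. real (card {\<zeta>. (\<zeta>, n) \<in> T}) \<le> g n" "\<And>n. real (card {\<zeta>. (\<zeta>, n) \<in> T'}) \<le> g n"
    and disj: "b \<noteq> b' \<or> T \<inter> T' = {}" and sum: "summable (\<lambda>n. (g n)\<^sup>2 * (t n)\<^sup>2)"
  shows "AE x in M. finite (heads b T x \<inter> heads b' T' x)"
proof -
  let ?A = "\<lambda>n. {x \<in> space M. n \<in> heads b T x \<inter> heads b' T' x}"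
  have ev: "?A n \<in> events" for n
    using heads_events[OF T(1) fin(1), of n b] heads_events[OF T(2) fin(2), of n b'] by (auto intro: sets.sets_Collect_conj)
  have "prob (?A n) \<le> (g n)\<^sup>2 * (t n)\<^sup>2" for n
    using prob_cyl_heads_Int[where Z="{}" and n=n, OF _ _ _ T fin card disj] sets.sets_into_space[OF ev[of n]]
    by (simp add: cyl_def prob_space Int_absorb1)
  then have "summable (\<lambda>n. prob (?A n))" by (intro summable_comparison_test'[OF sum]) simp
  then have "AE x in M. eventually (\<lambda>n. x \<in> space M - ?A n) sequentially"
    using ev by (intro borel_cantelli_AE1) (auto simp: emeasure_eq_measure)
  then show ?thesis
  proof eventually_elim
    case (elim x)
    then obtain N where N: "\<And>n. n \<ge> N \<Longrightarrow> x \<in> space M - ?A n" by (auto simp: eventually_sequentially)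
    then have "heads b T x \<inter> heads b' T' x \<subseteq> {..<N}" by (force simp: not_le[symmetric])
    then show ?case by (rule finite_subset) simp
  qed
qed

subsection \<open>Compatible pairs\<close>

lemma finite_weight_lower_bound:
  assumes "0 \<le> p" "p \<le> 1" "card Z \<le> K"
    "\<And>i. i \<in> Z \<Longrightarrow> p \<le> t (snd (snd i)) \<and> p \<le> 1 - t (snd (snd i))"
  shows "p ^ K \<le> weight Z u"
proof -
  have "p ^ K \<le> p ^ card Z" using assms by (intro power_decreasing)
  also have "\<dots> = (\<Prod>i\<in>Z. p)" by simp
  also have "\<dots> \<le> weight Z u" unfolding weight_def using assms by (intro prod_mono) auto
  finally show ?thesis .
qed

lemma prob_eq_sum_cyl:
  assumes Z: "finite Z" "Z \<subseteq> D \<times> UNIV" and A: "A \<in> events"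
  shows "prob A = (\<Sum>u\<in>Pow Z. prob (A \<inter> cyl Z u))"
proof -
  have "(\<Union>u\<in>Pow Z. A \<inter> cyl Z u) = A"
  proof (intro equalityI subsetI)
    fix x assume x: "x \<in> A"
    then have "x \<in> A \<inter> cyl Z {i \<in> Z. x \<in> W i}"
      using sets.sets_into_space[OF A] by (auto simp: cyl_def)
    moreover have "{i \<in> Z. x \<in> W i} \<in> Pow Z" by auto
    ultimately show "x \<in> (\<Union>u\<in>Pow Z. A \<inter> cyl Z u)" by (rule UN_I[rotated])
  qed auto
  moreover have "disjoint_family_on (\<lambda>u. A \<inter> cyl Z u) (Pow Z)"
    unfolding disjoint_family_on_def
  proof (intro ballI impI)
    fix u v assume uv: "u \<in> Pow Z" "v \<in> Pow Z" "u \<noteq> v"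
    then obtain i where i: "i \<in> u \<longleftrightarrow> i \<notin> v" by blast
    then have "i \<in> Z" using uv by blast
    with i show "(A \<inter> cyl Z u) \<inter> (A \<inter> cyl Z v) = {}" unfolding cyl_def by auto
  qed
  moreover have "(\<lambda>u. A \<inter> cyl Z u) ` Pow Z \<subseteq> events" using cyl_events[OF Z] A by auto
  ultimately show ?thesis using finite_measure_finite_Union[of "Pow Z" "\<lambda>u. A \<inter> cyl Z u"] Z(1) by simp
qed

text \<open>Averaging: the cylinders over \<open>Z\<close> partition the space, and if the
  proportion of \<open>A\<close> were below \<open>e\<close> in each, it would be below
  \<open>e\<close> altogether.\<close>

lemma exists_dense_cyl:
  assumes Z: "finite Z" "Z \<subseteq> D \<times> UNIV" and A: "A \<in> events" and e: "e \<le> prob A"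
  shows "\<exists>u\<subseteq>Z. e * prob (cyl Z u) \<le> prob (A \<inter> cyl Z u)"
proof (rule ccontr)
  assume "\<not> ?thesis"
  then have less: "\<And>u. u \<in> Pow Z \<Longrightarrow> prob (A \<inter> cyl Z u) < e * prob (cyl Z u)" by (meson PowD not_le)
  have "prob A < (\<Sum>u\<in>Pow Z. e * prob (cyl Z u))"
    unfolding prob_eq_sum_cyl[OF Z A] using Z(1) less by (intro sum_strict_mono) auto
  also have "\<dots> = e * (\<Sum>u\<in>Pow Z. prob (space M \<inter> cyl Z u))"
    by (simp add: sum_distrib_left cyl_def Int_def conj_ac)
  also have "\<dots> = e" using prob_eq_sum_cyl[OF Z sets.top] by (simp add: prob_space)
  finally show False using e by simp
qed

definition flips_before :: "nat \<Rightarrow> ('i \<times> nat) set \<Rightarrow> ('i \<times> bool \<times> nat) set"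
  where "flips_before N T = {(\<zeta>, b, n). n < N \<and> (\<zeta>, n) \<in> T}"

text \<open>The conditions are thinned out until they look alike before \<open>N\<close>. A
  sunflower lets two of them share only the flips in the kernel \<open>R\<close>; the pigeonhole
  principle then equalises the outcomes on \<open>R\<close> and the sets \<open>H b\<close> of times
  with heads, for which there are finitely many possibilities. As \<open>u \<xi>\<close> decides
  every flip that \<open>T \<xi>\<close> reads before \<open>N\<close>, the part of
  \<open>heads b (T \<xi>)\<close> below \<open>N\<close> is \<open>H b\<close> throughout the
  cylinder.\<close>

lemma exists_uniform_heads_cyl:
  fixes T :: "'x \<Rightarrow> ('i \<times> nat) set"
  assumes inf: "infinite \<Xi>"
    and E: "\<And>\<xi>. \<xi> \<in> \<Xi> \<Longrightarrow> E \<xi> \<in> events" "\<And>\<xi>. \<xi> \<in> \<Xi> \<Longrightarrow> \<epsilon> \<le> prob (E \<xi>)"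
    and T: "\<And>\<xi>. \<xi> \<in> \<Xi> \<Longrightarrow> T \<xi> \<subseteq> D \<times> UNIV" "\<And>\<xi> n. \<xi> \<in> \<Xi> \<Longrightarrow> finite {\<zeta>. (\<zeta>, n) \<in> T \<xi>}"
      "\<And>\<xi> n. \<xi> \<in> \<Xi> \<Longrightarrow> real (card {\<zeta>. (\<zeta>, n) \<in> T \<xi>}) \<le> g n"
  obtains J R u K H where "infinite J" "J \<subseteq> \<Xi>" "finite R"
    "\<And>\<xi>. \<xi> \<in> J \<Longrightarrow> finite (flips_before N (T \<xi>))"
    "\<And>\<xi>. \<xi> \<in> J \<Longrightarrow> card (flips_before N (T \<xi>)) \<le> K"
    "\<And>\<xi>. \<xi> \<in> J \<Longrightarrow> R \<subseteq> flips_before N (T \<xi>)"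
    "\<And>\<xi> \<eta>. \<xi> \<in> J \<Longrightarrow> \<eta> \<in> J \<Longrightarrow> \<xi> \<noteq> \<eta> \<Longrightarrow>
      flips_before N (T \<xi>) \<inter> flips_before N (T \<eta>) = R"
    "\<And>\<xi>. \<xi> \<in> J \<Longrightarrow> u \<xi> \<subseteq> flips_before N (T \<xi>)"
    "\<And>\<xi>. \<xi> \<in> J \<Longrightarrow> \<epsilon> * prob (cyl (flips_before N (T \<xi>)) (u \<xi>))
      \<le> prob (E \<xi> \<inter> cyl (flips_before N (T \<xi>)) (u \<xi>))"
    "\<And>\<xi> \<eta>. \<xi> \<in> J \<Longrightarrow> \<eta> \<in> J \<Longrightarrow> u \<xi> \<inter> R = u \<eta> \<inter> R"
    "\<And>\<xi> b. \<xi> \<in> J \<Longrightarrow> {n. \<exists>\<zeta>. (\<zeta>, b, n) \<in> u \<xi>} = H b"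
proof -
  define Z where "Z = (\<lambda>\<xi>. flips_before N (T \<xi>))"
  note Z_iff = Z_def flips_before_def
  \<comment> \<open>Rounding \<open>g\<close> down bounds the number of flips before
    \<open>N\<close>, for both truth values, independently of \<xi>, as the sunflower lemma
    requires.\<close>
  define K where "K = (\<Sum>p\<in>(UNIV::bool set) \<times> {..<N}. nat \<lfloor>g (snd p)\<rfloor>)"
  have Z_eq: "Z \<xi> = (\<lambda>((b, n), \<zeta>). (\<zeta>, b, n)) ` (SIGMA p:(UNIV::bool set) \<times> {..<N}. {\<zeta>. (\<zeta>, snd p) \<in> T \<xi>})" for \<xi>
    by (auto simp: Z_iff image_iff)
  have finS: "finite (SIGMA p:(UNIV::bool set) \<times> {..<N}. {\<zeta>. (\<zeta>, snd p) \<in> T \<xi>})" if "\<xi> \<in> \<Xi>" for \<xi>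
    using T(2)[OF that] by (intro finite_SigmaI) auto
  have Zf: "finite (Z \<xi>)" if "\<xi> \<in> \<Xi>" for \<xi>
    unfolding Z_eq using finS[OF that] by (rule finite_imageI)
  have ZK: "card (Z \<xi>) \<le> K" if x: "\<xi> \<in> \<Xi>" for \<xi>
  proof -
    have "card (Z \<xi>) \<le> card (SIGMA p:(UNIV::bool set) \<times> {..<N}. {\<zeta>. (\<zeta>, snd p) \<in> T \<xi>})"
      unfolding Z_eq using finS[OF x] by (rule card_image_le)
    also have "\<dots> = (\<Sum>p\<in>(UNIV::bool set) \<times> {..<N}. card {\<zeta>. (\<zeta>, snd p) \<in> T \<xi>})"
      using T(2)[OF x] by (intro card_SigmaI) auto
    also have "\<dots> \<le> K" unfolding K_def
    proof (rule sum_mono)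
      fix p :: "bool \<times> nat"
      have "int (card {\<zeta>. (\<zeta>, snd p) \<in> T \<xi>}) \<le> \<lfloor>g (snd p)\<rfloor>"
        using T(3)[OF x, of "snd p"] by (simp add: le_floor_iff)
      then show "card {\<zeta>. (\<zeta>, snd p) \<in> T \<xi>} \<le> nat \<lfloor>g (snd p)\<rfloor>" by simp
    qed
    finally show ?thesis .
  qed
  have ZD: "Z \<xi> \<subseteq> D \<times> UNIV" if "\<xi> \<in> \<Xi>" for \<xi> using T(1)[OF that] by (auto simp: Z_iff)
  have "\<exists>u. u \<subseteq> Z \<xi> \<and> \<epsilon> * prob (cyl (Z \<xi>) u) \<le> prob (E \<xi> \<inter> cyl (Z \<xi>) u)" if "\<xi> \<in> \<Xi>" for \<xi>
    using exists_dense_cyl[OF Zf[OF that] ZD[OF that] E(1)[OF that] E(2)[OF that]] by simp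
  then obtain u where u: "\<And>\<xi>. \<xi> \<in> \<Xi> \<Longrightarrow> u \<xi> \<subseteq> Z \<xi>"
    "\<And>\<xi>. \<xi> \<in> \<Xi> \<Longrightarrow> \<epsilon> * prob (cyl (Z \<xi>) (u \<xi>)) \<le> prob (E \<xi> \<inter> cyl (Z \<xi>) (u \<xi>))" by metis
  have "\<exists>R J. infinite J \<and> J \<subseteq> \<Xi> \<and> (\<forall>i\<in>J. \<forall>j\<in>J. i \<noteq> j \<longrightarrow> Z i \<inter> Z j = R)"
    using inf Zf ZK by (rule infinite_sunflower)
  then obtain R J where J: "infinite J" "J \<subseteq> \<Xi>" and R: "\<forall>i\<in>J. \<forall>j\<in>J. i \<noteq> j \<longrightarrow> Z i \<inter> Z j = R"
    by (elim exE conjE)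
  have RZ: "R \<subseteq> Z \<xi>" if x: "\<xi> \<in> J" for \<xi>
  proof -
    have "infinite (J - {\<xi>})" using J(1) by simp
    then obtain \<eta> where "\<eta> \<in> J - {\<xi>}" using infinite_imp_nonempty by (metis ex_in_conv)
    then have "Z \<xi> \<inter> Z \<eta> = R" using R x by auto
    then show ?thesis by auto
  qed
  obtain \<xi>1 where "\<xi>1 \<in> J" using J(1) infinite_imp_nonempty by (metis ex_in_conv)
  then have Rf: "finite R" using RZ Zf J(2) by (meson finite_subset subsetD)
  define f where "f \<xi> = (u \<xi> \<inter> R, {n. \<exists>\<zeta>. (\<zeta>, True, n) \<in> u \<xi>}, {n. \<exists>\<zeta>. (\<zeta>, False, n) \<in> u \<xi>})" for \<xi>
  have "f ` J \<subseteq> Pow R \<times> Pow {..<N} \<times> Pow {..<N}"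
  proof
    fix y assume "y \<in> f ` J"
    then obtain \<xi> where x: "\<xi> \<in> J" "y = f \<xi>" by auto
    then have "u \<xi> \<subseteq> Z \<xi>" using u(1) J(2) by auto
    then show "y \<in> Pow R \<times> Pow {..<N} \<times> Pow {..<N}" unfolding x(2) f_def Z_iff by auto
  qed
  then have "finite (f ` J)" by (rule finite_subset) (use Rf in simp)
  then obtain \<xi>0 where x0: "\<xi>0 \<in> J" "infinite {\<xi> \<in> J. f \<xi> = f \<xi>0}"
    using pigeonhole_infinite[OF J(1)] by metis
  define J' where "J' = {\<xi> \<in> J. f \<xi> = f \<xi>0}"
  have J'J: "\<And>\<xi>. \<xi> \<in> J' \<Longrightarrow> \<xi> \<in> J" and J'\<Xi>: "\<And>\<xi>. \<xi> \<in> J' \<Longrightarrow> \<xi> \<in> \<Xi>"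
    and J'f: "\<And>\<xi>. \<xi> \<in> J' \<Longrightarrow> f \<xi> = f \<xi>0" using J(2) by (auto simp: J'_def)
  show ?thesis
  proof (rule that[of J' R K u "\<lambda>b. {n. \<exists>\<zeta>. (\<zeta>, b, n) \<in> u \<xi>0}"])
    show "infinite J'" using x0(2) by (simp add: J'_def)
    show "J' \<subseteq> \<Xi>" using J'\<Xi> by (rule subsetI)
    show "finite R" by (rule Rf)
    show "\<And>\<xi>. \<xi> \<in> J' \<Longrightarrow> finite (flips_before N (T \<xi>))" using Zf[unfolded Z_def] J'\<Xi> by simp
    show "\<And>\<xi>. \<xi> \<in> J' \<Longrightarrow> card (flips_before N (T \<xi>)) \<le> K" using ZK[unfolded Z_def] J'\<Xi> by simp
    show "\<And>\<xi>. \<xi> \<in> J' \<Longrightarrow> R \<subseteq> flips_before N (T \<xi>)" using RZ[unfolded Z_def] J'J by simp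
    show "\<And>\<xi> \<eta>. \<xi> \<in> J' \<Longrightarrow> \<eta> \<in> J' \<Longrightarrow> \<xi> \<noteq> \<eta> \<Longrightarrow> flips_before N (T \<xi>) \<inter> flips_before N (T \<eta>) = R" using R[unfolded Z_def] J'J by simp
    show "\<And>\<xi>. \<xi> \<in> J' \<Longrightarrow> u \<xi> \<subseteq> flips_before N (T \<xi>)" using u[unfolded Z_def] J'\<Xi> by simp
    show "\<And>\<xi>. \<xi> \<in> J' \<Longrightarrow> \<epsilon> * prob (cyl (flips_before N (T \<xi>)) (u \<xi>)) \<le> prob (E \<xi> \<inter> cyl (flips_before N (T \<xi>)) (u \<xi>))" using u[unfolded Z_def] J'\<Xi> by simp
    show "u \<xi> \<inter> R = u \<eta> \<inter> R" if "\<xi> \<in> J'" "\<eta> \<in> J'" for \<xi> \<eta>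
      using J'f[OF that(1)] J'f[OF that(2)] by (simp add: f_def)
    show "{n. \<exists>\<zeta>. (\<zeta>, b, n) \<in> u \<xi>} = {n. \<exists>\<zeta>. (\<zeta>, b, n) \<in> u \<xi>0}" if "\<xi> \<in> J'" for \<xi> b
      using J'f[OF that] by (cases b) (simp_all add: f_def)
  qed
qed


text \<open>Cauchy--Schwarz for the sum of the indicators of the \<open>X \<xi>\<close>, scaled by \<open>1 / q \<xi>\<close>: all of them live
  on \<open>cyl R v\<close>, so the off-diagonal terms cannot all be small.\<close>

lemma exists_pair_large_Int:
  assumes J: "infinite J" and R: "finite R" "R \<subseteq> D \<times> UNIV"
    and X: "\<And>\<xi>. \<xi> \<in> J \<Longrightarrow> X \<xi> \<in> events" "\<And>\<xi>. \<xi> \<in> J \<Longrightarrow> X \<xi> \<subseteq> cyl R v"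
    and q: "0 < q0" "\<And>\<xi>. \<xi> \<in> J \<Longrightarrow> q0 \<le> q \<xi>"
    and lower: "\<And>\<xi>. \<xi> \<in> J \<Longrightarrow> \<epsilon> * (weight R v * q \<xi>) \<le> prob (X \<xi>)"
    and upper: "\<And>\<xi>. \<xi> \<in> J \<Longrightarrow> prob (X \<xi>) \<le> weight R v * q \<xi>"
    and \<epsilon>: "0 < \<epsilon>"
  shows "\<exists>\<xi>\<in>J. \<exists>\<eta>\<in>J. \<xi> \<noteq> \<eta> \<and> \<epsilon>\<^sup>2 / 2 * (weight R v * q \<xi> * q \<eta>) < prob (X \<xi> \<inter> X \<eta>)"
proof (rule ccontr)
  let ?r = "weight R v"
  assume "\<not> ?thesis"
  then have small: "\<And>\<xi> \<eta>. \<xi> \<in> J \<Longrightarrow> \<eta> \<in> J \<Longrightarrow> \<xi> \<noteq> \<eta> \<Longrightarrow>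
      prob (X \<xi> \<inter> X \<eta>) \<le> \<epsilon>\<^sup>2 / 2 * (?r * q \<xi> * q \<eta>)" by (meson not_less)
  have r: "0 < ?r" by (rule weight_pos)
  have qpos: "\<And>\<xi>. \<xi> \<in> J \<Longrightarrow> 0 < q \<xi>" using q by (meson less_le_trans)
  \<comment> \<open>With this \<open>m\<close> the diagonal contributes less than half of m^2
    \<epsilon>^2. The off-diagonal terms, assumed small, contribute at most the other half, which
    contradicts the lower bound m^2 \<epsilon>^2.\<close>
  obtain m :: nat where m: "2 / (\<epsilon>\<^sup>2 * q0) < real m" using reals_Archimedean2 by blast
  have "0 < 2 / (\<epsilon>\<^sup>2 * q0)" using \<epsilon> q(1) by simp
  then have mpos: "0 < real m" using m by linarith
  obtain F where F: "finite F" "card F = m" "F \<subseteq> J" using infinite_arbitrarily_large[OF J] by metis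
  have FJ: "\<And>\<xi>. \<xi> \<in> F \<Longrightarrow> \<xi> \<in> J" using F(3) by blast
  have XR: "X \<xi> \<inter> cyl R v = X \<xi>" if "\<xi> \<in> F" for \<xi> using X(2)[OF FJ[OF that]] by blast
  have "(\<Sum>\<xi>\<in>F. (1 / q \<xi>) * prob (X \<xi>))\<^sup>2 \<le>
      ?r * (\<Sum>\<xi>\<in>F. \<Sum>\<eta>\<in>F. (1 / q \<xi>) * (1 / q \<eta>) * prob (X \<xi> \<inter> X \<eta>))"
    using Cauchy_Schwarz_events[OF F(1), of X "cyl R v" 0 "\<lambda>\<xi>. 1 / q \<xi>"] X(1)[OF FJ] cyl_events[OF R] XR
    by (simp add: prob_cyl[OF R] cong: sum.cong)
  also have "\<dots> \<le> ?r * (\<Sum>\<xi>\<in>F. ?r / q0 + real m * (\<epsilon>\<^sup>2 / 2 * ?r))"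
  proof (intro mult_left_mono sum_mono)
    fix \<xi> assume x: "\<xi> \<in> F"
    have "(\<Sum>\<eta>\<in>F. (1 / q \<xi>) * (1 / q \<eta>) * prob (X \<xi> \<inter> X \<eta>)) \<le>
        (\<Sum>\<eta>\<in>F. (if \<eta> = \<xi> then ?r / q0 else 0) + \<epsilon>\<^sup>2 / 2 * ?r)"
    proof (rule sum_mono)
      fix \<eta> assume y: "\<eta> \<in> F"
      show "(1 / q \<xi>) * (1 / q \<eta>) * prob (X \<xi> \<inter> X \<eta>) \<le> (if \<eta> = \<xi> then ?r / q0 else 0) + \<epsilon>\<^sup>2 / 2 * ?r"
      proof (cases "\<eta> = \<xi>")
        case True
        have "(1 / q \<xi>) * (1 / q \<xi>) * prob (X \<xi>) \<le> (1 / q \<xi>) * (1 / q \<xi>) * (?r * q \<xi>)"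
          using upper[OF FJ[OF x]] by (intro mult_left_mono) auto
        also have "\<dots> = ?r / q \<xi>" using qpos[OF FJ[OF x]] by simp
        also have "\<dots> \<le> ?r / q0" using q(1) q(2)[OF FJ[OF x]] r by (intro divide_left_mono) auto
        also have "\<dots> \<le> ?r / q0 + \<epsilon>\<^sup>2 / 2 * ?r" using r by simp
        finally show ?thesis using True by simp
      next
        case False
        then have "prob (X \<xi> \<inter> X \<eta>) \<le> \<epsilon>\<^sup>2 / 2 * (?r * q \<xi> * q \<eta>)"
          using FJ[OF x] FJ[OF y] by (intro small) auto
        then have "(1 / q \<xi>) * (1 / q \<eta>) * prob (X \<xi> \<inter> X \<eta>) \<le> (1 / q \<xi>) * (1 / q \<eta>) * (\<epsilon>\<^sup>2 / 2 * (?r * q \<xi> * q \<eta>))"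
          using qpos[OF FJ[OF x]] qpos[OF FJ[OF y]] by (intro mult_left_mono) auto
        also have "\<dots> = \<epsilon>\<^sup>2 / 2 * ?r" using qpos[OF FJ[OF x]] qpos[OF FJ[OF y]] by simp
        finally show ?thesis using False by simp
      qed
    qed
    also have "\<dots> = ?r / q0 + real m * (\<epsilon>\<^sup>2 / 2 * ?r)"
      using x F by (simp add: sum.distrib)
    finally show "(\<Sum>\<eta>\<in>F. (1 / q \<xi>) * (1 / q \<eta>) * prob (X \<xi> \<inter> X \<eta>)) \<le> ?r / q0 + real m * (\<epsilon>\<^sup>2 / 2 * ?r)" .
  qed (use r in simp)
  also have "\<dots> = ?r\<^sup>2 * (real m / q0 + (real m)\<^sup>2 * \<epsilon>\<^sup>2 / 2)"
    using F by (simp add: power2_eq_square algebra_simps)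
  finally have 1: "(\<Sum>\<xi>\<in>F. (1 / q \<xi>) * prob (X \<xi>))\<^sup>2 \<le> ?r\<^sup>2 * (real m / q0 + (real m)\<^sup>2 * \<epsilon>\<^sup>2 / 2)" .
  have "(\<Sum>\<xi>\<in>F. \<epsilon> * ?r) \<le> (\<Sum>\<xi>\<in>F. (1 / q \<xi>) * prob (X \<xi>))"
  proof (rule sum_mono)
    fix \<xi> assume x: "\<xi> \<in> F"
    have "\<epsilon> * ?r = (1 / q \<xi>) * (\<epsilon> * (?r * q \<xi>))" using qpos[OF FJ[OF x]] by simp
    also have "\<dots> \<le> (1 / q \<xi>) * prob (X \<xi>)"
      using qpos[OF FJ[OF x]] lower[OF FJ[OF x]] by (intro mult_left_mono) auto
    finally show "\<epsilon> * ?r \<le> (1 / q \<xi>) * prob (X \<xi>)" .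
  qed
  then have "real m * (\<epsilon> * ?r) \<le> (\<Sum>\<xi>\<in>F. (1 / q \<xi>) * prob (X \<xi>))" using F by simp
  then have "(real m * (\<epsilon> * ?r))\<^sup>2 \<le> (\<Sum>\<xi>\<in>F. (1 / q \<xi>) * prob (X \<xi>))\<^sup>2"
    using \<epsilon> r by (intro power_mono) auto
  then have "?r\<^sup>2 * ((real m)\<^sup>2 * \<epsilon>\<^sup>2) \<le> ?r\<^sup>2 * (real m / q0 + (real m)\<^sup>2 * \<epsilon>\<^sup>2 / 2)"
    using 1 by (simp add: power_mult_distrib algebra_simps)
  then have "(real m)\<^sup>2 * \<epsilon>\<^sup>2 \<le> real m / q0 + (real m)\<^sup>2 * \<epsilon>\<^sup>2 / 2"
    using r by (simp add: mult_le_cancel_left_pos)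
  then have "real m * (real m * \<epsilon>\<^sup>2 / 2) \<le> real m * (1 / q0)" by (simp add: power2_eq_square field_simps)
  then have "real m * \<epsilon>\<^sup>2 / 2 \<le> 1 / q0" using mpos by (simp only: mult_le_cancel_left_pos)
  then have "real m \<le> 2 / (\<epsilon>\<^sup>2 * q0)" using \<epsilon> q(1) by (simp add: field_simps)
  then show False using m by simp
qed

text \<open>Flips from \<open>N\<close> on are independent of a cylinder over earlier flips, so the
  bounds of \<open>prob_cyl_heads_Int\<close> can be summed relative to its probability, however
  small that is.\<close>

lemma prob_cyl_late_heads_Int:
  fixes u :: "('i \<times> bool \<times> nat) set"
  assumes Z: "finite Z" "Z \<subseteq> D \<times> UNIV" "\<And>i. i \<in> Z \<Longrightarrow> snd (snd i) < N"
    and T: "T \<subseteq> D \<times> UNIV" "T' \<subseteq> D \<times> UNIV"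
    and fin: "\<And>n. finite {\<zeta>. (\<zeta>, n) \<in> T}" "\<And>n. finite {\<zeta>. (\<zeta>, n) \<in> T'}"
    and card: "\<And>n. real (card {\<zeta>. (\<zeta>, n) \<in> T}) \<le> g n" "\<And>n. real (card {\<zeta>. (\<zeta>, n) \<in> T'}) \<le> g n"
    and sum: "summable (\<lambda>n. (g n)\<^sup>2 * (t n)\<^sup>2)"
  defines "B \<equiv> cyl Z u \<inter> {x \<in> space M. \<exists>n\<ge>N. n \<in> heads True T x \<inter> heads False T' x}"
  shows "B \<in> events" "prob B \<le> prob (cyl Z u) * (\<Sum>n. (g (n + N))\<^sup>2 * (t (n + N))\<^sup>2)"
proof -
  let ?A = "\<lambda>n. cyl Z u \<inter> {x \<in> space M. n + N \<in> heads True T x \<inter> heads False T' x}"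
  have B: "B = (\<Union>n. ?A n)"
    unfolding B_def by (auto simp: le_iff_add add.commute)
  have "{x \<in> space M. n \<in> heads True T x \<inter> heads False T' x} =
      {x \<in> space M. n \<in> heads True T x} \<inter> {x \<in> space M. n \<in> heads False T' x}" for n by auto
  then have ev: "?A n \<in> events" for n
    using heads_events[OF T(1) fin(1)] heads_events[OF T(2) fin(2)] cyl_events[OF Z(1,2)] by auto
  then have "range ?A \<subseteq> events" by (rule image_subsetI)
  then show "B \<in> events" unfolding B by (rule sets.countable_UN)
  have le: "prob (?A n) \<le> prob (cyl Z u) * ((g (n + N))\<^sup>2 * (t (n + N))\<^sup>2)" for n
    using Z(3) by (intro prob_cyl_heads_Int Z(1,2) T fin card) force+
  have sum': "summable (\<lambda>n. (g (n + N))\<^sup>2 * (t (n + N))\<^sup>2)"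
    using sum by (rule summable_ignore_initial_segment)
  have sA: "summable (\<lambda>n. prob (?A n))"
    using le by (intro summable_comparison_test'[OF summable_mult[OF sum', of "prob (cyl Z u)"]]) auto
  have "prob B \<le> (\<Sum>n. prob (?A n))"
    unfolding B using ev sA by (intro finite_measure_subadditive_countably) auto
  also have "\<dots> \<le> (\<Sum>n. prob (cyl Z u) * ((g (n + N))\<^sup>2 * (t (n + N))\<^sup>2))"
    using le sA summable_mult[OF sum', of "prob (cyl Z u)"] by (rule suminf_le)
  also have "\<dots> = prob (cyl Z u) * (\<Sum>n. (g (n + N))\<^sup>2 * (t (n + N))\<^sup>2)"
    using sum' by (rule suminf_mult)
  finally show "prob B \<le> prob (cyl Z u) * (\<Sum>n. (g (n + N))\<^sup>2 * (t (n + N))\<^sup>2)" .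
qed

lemma exists_positive_compatible_pair:
  fixes T :: "'x \<Rightarrow> ('i \<times> nat) set"
  assumes inf: "infinite \<Xi>" and \<epsilon>: "0 < \<epsilon>"
    and E: "\<And>\<xi>. \<xi> \<in> \<Xi> \<Longrightarrow> E \<xi> \<in> events" "\<And>\<xi>. \<xi> \<in> \<Xi> \<Longrightarrow> \<epsilon> \<le> prob (E \<xi>)"
    and T: "\<And>\<xi>. \<xi> \<in> \<Xi> \<Longrightarrow> T \<xi> \<subseteq> D \<times> UNIV" "\<And>\<xi> n. \<xi> \<in> \<Xi> \<Longrightarrow> finite {\<zeta>. (\<zeta>, n) \<in> T \<xi>}"
      "\<And>\<xi> n. \<xi> \<in> \<Xi> \<Longrightarrow> real (card {\<zeta>. (\<zeta>, n) \<in> T \<xi>}) \<le> g n"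
    and sum: "summable (\<lambda>n. (g n)\<^sup>2 * (t n)\<^sup>2)"
    and disj: "\<And>\<xi>. \<xi> \<in> \<Xi> \<Longrightarrow> AE x in M. x \<in> E \<xi> \<longrightarrow> heads True (T \<xi>) x \<inter> heads False (T \<xi>) x \<subseteq> {..<k}"
  shows "\<exists>\<xi>\<in>\<Xi>. \<exists>\<eta>\<in>\<Xi>. \<xi> \<noteq> \<eta> \<and> 0 < prob {x \<in> E \<xi> \<inter> E \<eta>.
    heads True (T \<xi>) x \<inter> heads False (T \<eta>) x \<subseteq> {..<k} \<and> heads True (T \<eta>) x \<inter> heads False (T \<xi>) x \<subseteq> {..<k}}"
proof -
  have e2: "0 < \<epsilon>\<^sup>2 / 4" using \<epsilon> by simp
  \<comment> \<open>The constant 1/4 allows for two kinds of collision, of \<xi> with \<eta> and of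
    \<eta> with \<xi>. Together they stay below the factor \<epsilon>^2 / 2 that
    \<open>exists_pair_large_Int\<close> guarantees.\<close>
  obtain N where N: "norm (\<Sum>n. (g (n + N))\<^sup>2 * (t (n + N))\<^sup>2) < \<epsilon>\<^sup>2 / 4"
    using suminf_exist_split[OF e2 sum] by blast
  define s where "s = (\<Sum>n. (g (n + N))\<^sup>2 * (t (n + N))\<^sup>2)"
  have s: "s < \<epsilon>\<^sup>2 / 4" using N by (simp add: s_def)
  show ?thesis
  proof (rule exists_uniform_heads_cyl[where N=N and \<epsilon>=\<epsilon> and \<Xi>=\<Xi> and E=E and T=T and g=g, OF inf E T])
  fix J R u K H assume J: "infinite J" "J \<subseteq> \<Xi>" and Rf: "finite R"
    and Zf: "\<And>\<xi>. \<xi> \<in> J \<Longrightarrow> finite (flips_before N (T \<xi>))"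
    and ZK: "\<And>\<xi>. \<xi> \<in> J \<Longrightarrow> card (flips_before N (T \<xi>)) \<le> K"
    and RZ: "\<And>\<xi>. \<xi> \<in> J \<Longrightarrow> R \<subseteq> flips_before N (T \<xi>)"
    and ZZ: "\<And>\<xi> \<eta>. \<xi> \<in> J \<Longrightarrow> \<eta> \<in> J \<Longrightarrow> \<xi> \<noteq> \<eta> \<Longrightarrow> flips_before N (T \<xi>) \<inter> flips_before N (T \<eta>) = R"
    and uZ: "\<And>\<xi>. \<xi> \<in> J \<Longrightarrow> u \<xi> \<subseteq> flips_before N (T \<xi>)"
    and dense: "\<And>\<xi>. \<xi> \<in> J \<Longrightarrow> \<epsilon> * prob (cyl (flips_before N (T \<xi>)) (u \<xi>))
      \<le> prob (E \<xi> \<inter> cyl (flips_before N (T \<xi>)) (u \<xi>))"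
    and uR: "\<And>\<xi> \<eta>. \<xi> \<in> J \<Longrightarrow> \<eta> \<in> J \<Longrightarrow> u \<xi> \<inter> R = u \<eta> \<inter> R"
    and H: "\<And>\<xi> b. \<xi> \<in> J \<Longrightarrow> {n. \<exists>\<zeta>. (\<zeta>, b, n) \<in> u \<xi>} = H b"
  define Z where "Z = (\<lambda>\<xi>. flips_before N (T \<xi>))"
  have J\<Xi>: "\<And>\<xi>. \<xi> \<in> J \<Longrightarrow> \<xi> \<in> \<Xi>" using J(2) by (rule subsetD)
  have Zf: "\<And>\<xi>. \<xi> \<in> J \<Longrightarrow> finite (Z \<xi>)" using Zf by (simp add: Z_def)
  have ZD: "Z \<xi> \<subseteq> D \<times> UNIV" if "\<xi> \<in> J" for \<xi>
    using T(1)[OF J\<Xi>[OF that]] by (auto simp: Z_def flips_before_def)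
  have Zn: "snd (snd i) < N" if "i \<in> Z \<xi>" for i \<xi>
    using that by (auto simp: Z_def flips_before_def)
  have Zi: "(\<zeta>, b, n) \<in> Z \<xi> \<longleftrightarrow> n < N \<and> (\<zeta>, n) \<in> T \<xi>" for \<zeta> b n \<xi> by (simp add: Z_def flips_before_def)
  have RZ: "R \<subseteq> Z \<xi>" if "\<xi> \<in> J" for \<xi> using RZ[of \<xi>] that by (simp add: Z_def)
  have ZZ: "Z \<xi> \<inter> Z \<eta> = R" if "\<xi> \<in> J" "\<eta> \<in> J" "\<xi> \<noteq> \<eta>" for \<xi> \<eta> using ZZ[of \<xi> \<eta>] that by (simp add: Z_def)
  have uZ: "u \<xi> \<subseteq> Z \<xi>" if "\<xi> \<in> J" for \<xi> using uZ[of \<xi>] that by (simp add: Z_def)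
  have dense: "\<epsilon> * prob (cyl (Z \<xi>) (u \<xi>)) \<le> prob (E \<xi> \<inter> cyl (Z \<xi>) (u \<xi>))" if "\<xi> \<in> J" for \<xi>
    using dense[of \<xi>] that by (simp add: Z_def)
  have ZK: "card (Z \<xi>) \<le> K" if "\<xi> \<in> J" for \<xi> using ZK[of \<xi>] that by (simp add: Z_def)
  obtain \<xi>0 where x0: "\<xi>0 \<in> J" using J(1) infinite_imp_nonempty by (metis ex_in_conv)
  define r where "r = weight R (u \<xi>0)"
  define q where "q = (\<lambda>\<xi>. weight (Z \<xi> - R) (u \<xi>))"
  have RD: "R \<subseteq> D \<times> UNIV" using RZ[OF x0] ZD[OF x0] by (rule subset_trans)
  have wR: "weight R (u \<xi>) = r" if "\<xi> \<in> J" for \<xi>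
    unfolding r_def using uR[OF that x0] by (intro weight_cong) simp
  have wZ: "prob (cyl (Z \<xi>) (u \<xi>)) = r * q \<xi>" if x: "\<xi> \<in> J" for \<xi>
  proof -
    have "Z \<xi> = R \<union> (Z \<xi> - R)" using RZ[OF x] by auto
    then have "weight (Z \<xi>) (u \<xi>) = weight R (u \<xi>) * weight (Z \<xi> - R) (u \<xi>)"
      using weight_Un[of R "Z \<xi> - R" "u \<xi>"] Rf Zf[OF x] by simp
    then show ?thesis using prob_cyl[OF Zf[OF x] ZD[OF x]] wR[OF x] by (simp add: q_def)
  qed
  \<comment> \<open>A lower bound for the probability of every single outcome before
    \<open>N\<close>, so that \<open>p ^ K\<close> bounds all \<open>q \<xi>\<close> from below; the
    inserted 1 covers \<open>N = 0\<close>.\<close>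
  define p where "p = Min (insert 1 ((\<lambda>n. min (t n) (1 - t n)) ` {..<N}))"
  have p: "0 < p" "p \<le> 1" using t_pos t_less_1 by (auto simp: p_def)
  have p_le: "p \<le> min (t n) (1 - t n)" if "n < N" for n
    unfolding p_def using that by (intro Min_le) auto
  have q0: "p ^ K \<le> q \<xi>" if x: "\<xi> \<in> J" for \<xi>
    unfolding q_def
  proof (rule finite_weight_lower_bound)
    show "card (Z \<xi> - R) \<le> K" using ZK[OF x] Zf[OF x] card_mono[of "Z \<xi>" "Z \<xi> - R"] by auto
    show "p \<le> t (snd (snd i)) \<and> p \<le> 1 - t (snd (snd i))" if "i \<in> Z \<xi> - R" for i
      using p_le[of "snd (snd i)"] Zn[of i \<xi>] that by simp
  qed (use p in auto)
  define X where "X = (\<lambda>\<xi>. E \<xi> \<inter> cyl (Z \<xi>) (u \<xi>))"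
  have cylZ: "cyl (Z \<xi>) (u \<xi>) \<in> events" if "\<xi> \<in> J" for \<xi> using cyl_events[OF Zf[OF that] ZD[OF that]] .
  have Xe: "X \<xi> \<in> events" if "\<xi> \<in> J" for \<xi> using E(1)[OF J\<Xi>[OF that]] cylZ[OF that] by (auto simp: X_def)
  have "\<exists>\<xi>\<in>J. \<exists>\<eta>\<in>J. \<xi> \<noteq> \<eta> \<and> \<epsilon>\<^sup>2 / 2 * (weight R (u \<xi>0) * q \<xi> * q \<eta>) < prob (X \<xi> \<inter> X \<eta>)"
  proof (rule exists_pair_large_Int[OF J(1) Rf RD Xe _ _ q0 _ _ \<epsilon>])
    show "X \<xi> \<subseteq> cyl R (u \<xi>0)" if "\<xi> \<in> J" for \<xi>
    proof
      fix x assume "x \<in> X \<xi>"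
      then have x: "x \<in> space M" "\<And>i. i \<in> Z \<xi> \<Longrightarrow> x \<in> W i \<longleftrightarrow> i \<in> u \<xi>" by (auto simp: X_def cyl_def)
      have "x \<in> W i \<longleftrightarrow> i \<in> u \<xi>0" if "i \<in> R" for i
        using x(2)[of i] uR[OF \<open>\<xi> \<in> J\<close> x0] RZ[OF \<open>\<xi> \<in> J\<close>] that by blast
      then show "x \<in> cyl R (u \<xi>0)" using x(1) by (simp add: cyl_def)
    qed
    show "0 < p ^ K" using p(1) by simp
    show "\<epsilon> * (weight R (u \<xi>0) * q \<xi>) \<le> prob (X \<xi>)" if "\<xi> \<in> J" for \<xi>
      using dense[OF that] wZ[OF that] by (simp add: X_def r_def)
    show "prob (X \<xi>) \<le> weight R (u \<xi>0) * q \<xi>" if "\<xi> \<in> J" for \<xi>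
    proof -
      have "prob (X \<xi>) \<le> prob (cyl (Z \<xi>) (u \<xi>))"
        using cylZ[OF that] by (intro finite_measure_mono) (auto simp: X_def)
      then show ?thesis using wZ[OF that] by (simp add: r_def)
    qed
  qed
  then obtain \<xi> \<eta> where xy: "\<xi> \<in> J" "\<eta> \<in> J" "\<xi> \<noteq> \<eta>"
    and large: "\<epsilon>\<^sup>2 / 2 * (r * q \<xi> * q \<eta>) < prob (X \<xi> \<inter> X \<eta>)" unfolding r_def by blast
  define v where "v = u \<xi> \<union> u \<eta>"
  have ZUf: "finite (Z \<xi> \<union> Z \<eta>)" using Zf xy by simp
  have ZUD: "Z \<xi> \<union> Z \<eta> \<subseteq> D \<times> UNIV" using ZD xy by simp
  have C: "cyl (Z \<xi>) (u \<xi>) \<inter> cyl (Z \<eta>) (u \<eta>) = cyl (Z \<xi> \<union> Z \<eta>) v"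
  proof -
    have "u \<xi> \<inter> (Z \<xi> \<inter> Z \<eta>) = u \<eta> \<inter> (Z \<xi> \<inter> Z \<eta>)" unfolding ZZ[OF xy] by (rule uR[OF xy(1,2)])
    moreover have "u \<xi> \<inter> Z \<xi> \<union> u \<eta> \<inter> Z \<eta> = v" using uZ xy by (auto simp: v_def)
    ultimately show ?thesis using cyl_Int by metis
  qed
  \<comment> \<open>The kernel is counted once: given its outcome, the remaining flips of \<xi> and
    of \<eta> are different and hence independent.\<close>
  have pC: "prob (cyl (Z \<xi> \<union> Z \<eta>) v) = r * q \<xi> * q \<eta>"
  proof -
    have eq: "Z \<xi> \<union> Z \<eta> = Z \<xi> \<union> (Z \<eta> - R)" using RZ[OF xy(1)] by auto
    have "prob (cyl (Z \<xi> \<union> Z \<eta>) v) = weight (Z \<xi> \<union> Z \<eta>) v" by (rule prob_cyl[OF ZUf ZUD])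
    also have "\<dots> = weight (Z \<xi>) v * weight (Z \<eta> - R) v"
      unfolding eq using Zf xy ZZ[OF xy] by (intro weight_Un) auto
    also have "weight (Z \<xi>) v = weight (Z \<xi>) (u \<xi>)"
      using uZ[OF xy(1)] uZ[OF xy(2)] ZZ[OF xy] uR[OF xy(1,2)]
      by (intro weight_cong) (auto simp: v_def)
    also have "\<dots> = r * q \<xi>" using wZ[OF xy(1)] prob_cyl[OF Zf[OF xy(1)] ZD[OF xy(1)]] by simp
    also have "weight (Z \<eta> - R) v = q \<eta>"
      unfolding q_def using uZ[OF xy(1)] ZZ[OF xy]
      by (intro weight_cong) (auto simp: v_def)
    finally show ?thesis .
  qed
  define B where "B = (\<lambda>T T'. cyl (Z \<xi> \<union> Z \<eta>) v \<inter> {x \<in> space M. \<exists>n\<ge>N. n \<in> heads True T x \<inter> heads False T' x})"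
  have Tx: "T \<xi> \<subseteq> D \<times> UNIV" "\<And>n. finite {\<zeta>. (\<zeta>, n) \<in> T \<xi>}" "\<And>n. real (card {\<zeta>. (\<zeta>, n) \<in> T \<xi>}) \<le> g n"
    using T J\<Xi>[OF xy(1)] by auto
  have Ty: "T \<eta> \<subseteq> D \<times> UNIV" "\<And>n. finite {\<zeta>. (\<zeta>, n) \<in> T \<eta>}" "\<And>n. real (card {\<zeta>. (\<zeta>, n) \<in> T \<eta>}) \<le> g n"
    using T J\<Xi>[OF xy(2)] by auto
  have ZUn: "snd (snd i) < N" if "i \<in> Z \<xi> \<union> Z \<eta>" for i using that Zn by blast
  have Bxy: "B (T \<xi>) (T \<eta>) \<in> events" "prob (B (T \<xi>) (T \<eta>)) \<le> r * q \<xi> * q \<eta> * s"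
    unfolding B_def s_def pC[symmetric]
    by (rule prob_cyl_late_heads_Int[where u=v and g=g, OF ZUf ZUD ZUn Tx(1) Ty(1) Tx(2) Ty(2) Tx(3) Ty(3) sum], assumption)+
  have Byx: "B (T \<eta>) (T \<xi>) \<in> events" "prob (B (T \<eta>) (T \<xi>)) \<le> r * q \<xi> * q \<eta> * s"
    unfolding B_def s_def pC[symmetric]
    by (rule prob_cyl_late_heads_Int[where u=v and g=g, OF ZUf ZUD ZUn Ty(1) Tx(1) Ty(2) Tx(2) Ty(3) Tx(3) sum], assumption)+
  define G where "G = (X \<xi> \<inter> X \<eta>) - (B (T \<xi>) (T \<eta>) \<union> B (T \<eta>) (T \<xi>))"
  have rq: "0 < r * q \<xi> * q \<eta>" by (simp add: r_def q_def weight_pos)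
  have "r * q \<xi> * q \<eta> * s < r * q \<xi> * q \<eta> * (\<epsilon>\<^sup>2 / 4)" using rq s by (rule mult_strict_left_mono[rotated])
  then have small: "prob (B (T \<xi>) (T \<eta>)) + prob (B (T \<eta>) (T \<xi>)) < \<epsilon>\<^sup>2 / 2 * (r * q \<xi> * q \<eta>)"
    using Bxy(2) Byx(2) by (simp add: algebra_simps)
  have Gev: "G \<in> events" using Xe xy Bxy(1) Byx(1) by (auto simp: G_def)
  have "prob (X \<xi> \<inter> X \<eta>) \<le> prob (G \<union> (B (T \<xi>) (T \<eta>) \<union> B (T \<eta>) (T \<xi>)))"
    using Xe xy Bxy(1) Byx(1) by (intro finite_measure_mono) (auto simp: G_def)
  also have "\<dots> \<le> prob G + prob (B (T \<xi>) (T \<eta>) \<union> B (T \<eta>) (T \<xi>))"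
    using Gev Bxy(1) Byx(1) by (intro measure_Un_le) auto
  also have "prob (B (T \<xi>) (T \<eta>) \<union> B (T \<eta>) (T \<xi>)) \<le> prob (B (T \<xi>) (T \<eta>)) + prob (B (T \<eta>) (T \<xi>))"
    using Bxy(1) Byx(1) by (rule measure_Un_le)
  finally have Gpos: "0 < prob G" using large small by linarith
  let ?A = "{x \<in> E \<xi> \<inter> E \<eta>. heads True (T \<xi>) x \<inter> heads False (T \<eta>) x \<subseteq> {..<k} \<and> heads True (T \<eta>) x \<inter> heads False (T \<xi>) x \<subseteq> {..<k}}"
  \<comment> \<open>If the collision is at \<open>n < N\<close>, then \<open>n\<close> belongs to
    \<open>H False\<close>, which is common to both conditions, so some coin of \<open>T a\<close>
    also shows heads for False at \<open>n\<close>. Hence \<open>T a\<close> collides with itself at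
    \<open>n\<close>, and \<open>x(4)\<close> puts \<open>n\<close> below \<open>k\<close>.\<close>
  have compat: "heads True (T a) x \<inter> heads False (T b) x \<subseteq> {..<k}"
    if ab: "a \<in> J" "b \<in> J" and x: "x \<in> cyl (Z a) (u a)" "x \<in> cyl (Z b) (u b)"
      "\<not> (\<exists>n\<ge>N. n \<in> heads True (T a) x \<inter> heads False (T b) x)"
      "heads True (T a) x \<inter> heads False (T a) x \<subseteq> {..<k}" for a b x
  proof
    fix n assume n: "n \<in> heads True (T a) x \<inter> heads False (T b) x"
    then have nN: "n < N" using x(3) by (meson not_le)
    from n obtain \<zeta>' where z': "(\<zeta>', n) \<in> T b" "x \<in> W (\<zeta>', False, n)" by (auto simp: heads_def)
    have "(\<zeta>', False, n) \<in> Z b" using z' nN by (simp add: Zi)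
    then have "(\<zeta>', False, n) \<in> u b" using x(2) z' by (simp add: cyl_def)
    then have "n \<in> {n. \<exists>\<zeta>. (\<zeta>, False, n) \<in> u b}" by auto
    then have "n \<in> {n. \<exists>\<zeta>. (\<zeta>, False, n) \<in> u a}" by (simp only: H[OF ab(1)] H[OF ab(2)])
    then obtain \<zeta> where z: "(\<zeta>, False, n) \<in> u a" by auto
    then have "(\<zeta>, False, n) \<in> Z a" using uZ[OF ab(1)] by auto
    then have "(\<zeta>, n) \<in> T a" "x \<in> W (\<zeta>, False, n)" using x(1) z by (auto simp: cyl_def Zi)
    then have "n \<in> heads False (T a) x" by (auto simp: heads_def)
    then show "n \<in> {..<k}" using n x(4) by auto
  qed
  have "AE x in M. x \<in> G \<longrightarrow> x \<in> ?A"
    using disj[OF J\<Xi>[OF xy(1)]] disj[OF J\<Xi>[OF xy(2)]]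
  proof eventually_elim
    case (elim x)
    show ?case
    proof
      assume "x \<in> G"
      then have x: "x \<in> E \<xi>" "x \<in> E \<eta>" "x \<in> cyl (Z \<xi>) (u \<xi>)" "x \<in> cyl (Z \<eta>) (u \<eta>)"
        "x \<notin> B (T \<xi>) (T \<eta>)" "x \<notin> B (T \<eta>) (T \<xi>)" by (auto simp: G_def X_def)
      have xC: "x \<in> cyl (Z \<xi> \<union> Z \<eta>) v" using x(3,4) C by blast
      then have xs: "x \<in> space M" by (simp add: cyl_def)
      have "\<not> (\<exists>n\<ge>N. n \<in> heads True (T \<xi>) x \<inter> heads False (T \<eta>) x)"
        "\<not> (\<exists>n\<ge>N. n \<in> heads True (T \<eta>) x \<inter> heads False (T \<xi>) x)"
        using x(5,6) xC xs by (simp_all add: B_def)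
      then show "x \<in> ?A"
        using compat[OF xy(1,2) x(3,4)] compat[OF xy(2,1) x(4,3)] elim x(1,2) by blast
    qed
  qed
  moreover have "?A \<in> events"
  proof -
    have ev: "{x \<in> space M. n \<in> heads b (T \<xi>) x} \<in> events" "{x \<in> space M. n \<in> heads b (T \<eta>) x} \<in> events" for n b
      using heads_events[OF Tx(1,2)] heads_events[OF Ty(1,2)] by auto
    have "?A = (E \<xi> \<inter> E \<eta>) - (\<Union>n\<in>{k..}. ({x \<in> space M. n \<in> heads True (T \<xi>) x} \<inter> {x \<in> space M. n \<in> heads False (T \<eta>) x})
        \<union> ({x \<in> space M. n \<in> heads True (T \<eta>) x} \<inter> {x \<in> space M. n \<in> heads False (T \<xi>) x}))"
      using sets.sets_into_space[OF E(1)[OF J\<Xi>[OF xy(1)]]] by (auto simp: subset_iff not_le[symmetric])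
    also have "\<dots> \<in> events"
      using ev E(1)[OF J\<Xi>[OF xy(1)]] E(1)[OF J\<Xi>[OF xy(2)]]
      by (intro sets.Diff sets.Int sets.countable_UN' sets.Un) auto
    finally show ?thesis .
  qed
  ultimately have "prob G \<le> prob ?A" by (rule finite_measure_mono_AE)
  then have "0 < prob ?A" using Gpos by linarith
  then show ?thesis using xy J\<Xi> by blast
  qed
qed

subsection \<open>Non-separation\<close>

lemma prod_less_if_not_summable:
  assumes "\<not> summable t" "0 < e"
  shows "\<exists>N. (\<Prod>n=k..<N. 1 - t n) < e"
proof -
  define c where "c = (\<Sum>n<k. t n) + ln (2 / e)"
  have "\<exists>N. c < sum t {..<N}"
  proof (rule ccontr)
    assume "\<not> ?thesis"
    then have "\<And>N. sum t {..<N} \<le> c" by (meson not_le)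
    then have "summable t" using t_pos by (intro summableI_nonneg_bounded) (auto simp: less_imp_le)
    then show False using assms by simp
  qed
  then obtain N where N: "c < sum t {..<N}" by blast
  have "sum t {..<N} \<le> sum t {..<k} + sum t {k..<N}"
  proof -
    have "sum t {..<N} \<le> sum t ({..<k} \<union> {k..<N})"
      using t_pos by (intro sum_mono2) (auto simp: less_imp_le)
    also have "\<dots> = sum t {..<k} + sum t {k..<N}" by (intro sum.union_disjoint) auto
    finally show ?thesis .
  qed
  then have ge: "ln (2 / e) \<le> sum t {k..<N}" using N by (simp add: c_def)
  have "(\<Prod>n=k..<N. 1 - t n) \<le> (\<Prod>n=k..<N. exp (- t n))"
    using t_less_1 exp_ge_add_one_self[of "- t _"] by (intro prod_mono) (auto simp: less_imp_le)
  also have "\<dots> = exp (- sum t {k..<N})" by (simp add: exp_sum sum_negf[symmetric])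
  also have "\<dots> \<le> exp (- ln (2 / e))" using ge by simp
  also have "\<dots> = e / 2" using assms(2) by (simp add: exp_minus)
  also have "\<dots> < e" using assms(2) by simp
  finally show ?thesis by blast
qed

lemma weight_tails:
  "weight ((\<lambda>n. (\<xi>, f n, n)) ` {k..<N}) {} = (\<Prod>n=k..<N. 1 - t n)"
  unfolding weight_def by (subst prod.reindex) (auto intro: inj_onI)

text \<open>The second Borel--Cantelli lemma: showing only tails from \<open>k\<close> on implies
  showing tails at all times in \<open>{k..<N}\<close>, and the probability of this becomes
  arbitrarily small because \<Sum> t n diverges.\<close>

lemma not_AE_finite_heads:
  assumes t: "\<not> summable t" and \<xi>: "\<xi> \<in> D"
  shows "\<not> (AE x in M. finite {n. x \<in> W (\<xi>, b, n)})"
proof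
  assume fin: "AE x in M. finite {n. x \<in> W (\<xi>, b, n)}"
  have ev: "W (\<xi>, b, n) \<in> events" for n using \<xi> by (intro W_events) auto
  let ?A = "\<lambda>k. {x \<in> space M. \<forall>n\<in>{k..}. x \<notin> W (\<xi>, b, n)}"
  have A: "?A k \<in> events" for k
  proof -
    have "?A k = space M - (\<Union>n\<in>{k..}. W (\<xi>, b, n))" by auto
    then show ?thesis using ev by auto
  qed
  have "prob (?A k) = 0" for k
  proof (rule ccontr)
    assume "prob (?A k) \<noteq> 0"
    then have "0 < prob (?A k)" by (simp add: less_le)
    then obtain N where N: "(\<Prod>n=k..<N. 1 - t n) < prob (?A k)" using prod_less_if_not_summable[OF t] by blast
    let ?Z = "(\<lambda>n. (\<xi>, b, n)) ` {k..<N}"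
    have Z: "finite ?Z" "?Z \<subseteq> D \<times> UNIV" using \<xi> by auto
    have "prob (?A k) \<le> prob (cyl ?Z {})"
      by (rule finite_measure_mono[OF _ cyl_events[OF Z]]) (auto simp: cyl_def)
    also have "\<dots> = (\<Prod>n=k..<N. 1 - t n)" using prob_cyl[OF Z] weight_tails[of \<xi> "\<lambda>_. b"] by simp
    finally show False using N by simp
  qed
  then have "?A k \<in> null_sets M" for k using A by (auto simp: null_sets_def emeasure_eq_measure)
  then have "(\<Union>k. ?A k) \<in> null_sets M" by (rule null_sets_UN)
  then have "AE x in M. x \<notin> (\<Union>k. ?A k)" by (rule AE_not_in)
  with fin have "AE x in M. False"
    using AE_space
  proof eventually_elim
    case (elim x)
    then obtain k where "\<forall>n\<in>{n. x \<in> W (\<xi>, b, n)}. n < k"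
      unfolding finite_nat_set_iff_bounded by (elim exE conjE)
    then have "x \<in> ?A k" using elim by (auto simp: not_le[symmetric])
    then show ?case using elim by blast
  qed
  then show False by simp
qed

text \<open>For distinct \<xi> the cylinders are pairwise independent and have the same probability
  p, so the number of them that occur has variance at most \<open>card F\<close>. Cauchy--Schwarz,
  centred at the mean p times \<open>card F\<close>, shows that no event \<open>R\<close> favours
  them by more than the square root of \<open>card F\<close> in total.\<close>

lemma sum_prob_Int_tails_le:
  assumes F: "finite F" "F \<subseteq> D" and R: "R \<in> events"
  shows "(\<Sum>\<xi>\<in>F. prob (cyl ((\<lambda>n. (\<xi>, f n, n)) ` {k..<N}) {} \<inter> R)) \<le>
    real (card F) * (\<Prod>n=k..<N. 1 - t n) * prob R + sqrt (real (card F))"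
proof -
  define p where "p = (\<Prod>n=k..<N. 1 - t n)"
  define Z where "Z = (\<lambda>\<xi>::'i. (\<lambda>n. (\<xi>, f n, n)) ` {k..<N})"
  define X where "X = (\<lambda>\<xi>. cyl (Z \<xi>) {})"
  let ?m = "real (card F)"
  have Z: "finite (Z \<xi>)" "Z \<xi> \<subseteq> D \<times> UNIV" if "\<xi> \<in> F" for \<xi> using F(2) that by (auto simp: Z_def)
  have X: "X \<xi> \<in> events" "prob (X \<xi>) = p" if "\<xi> \<in> F" for \<xi>
    using cyl_events[OF Z[OF that]] prob_cyl[OF Z[OF that]] by (simp_all add: X_def p_def Z_def weight_tails)
  have p: "0 \<le> p" "p \<le> 1" unfolding p_def using t_pos t_less_1 by (auto intro!: prod_nonneg prod_le_1 simp: less_imp_le)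
  have XX: "prob (X \<xi> \<inter> X \<eta>) = p\<^sup>2" if "\<xi> \<in> F" "\<eta> \<in> F" "\<xi> \<noteq> \<eta>" for \<xi> \<eta>
  proof -
    have "X \<xi> \<inter> X \<eta> = cyl (Z \<xi> \<union> Z \<eta>) {}" unfolding X_def by (subst cyl_Int) auto
    also have "prob \<dots> = weight (Z \<xi> \<union> Z \<eta>) {}" using Z that by (intro prob_cyl) auto
    also have "\<dots> = weight (Z \<xi>) {} * weight (Z \<eta>) {}" using Z that by (intro weight_Un) (auto simp: Z_def)
    also have "\<dots> = p\<^sup>2" by (simp add: Z_def weight_tails p_def power2_eq_square)
    finally show ?thesis .
  qed
  have "(\<Sum>\<xi>\<in>F. \<Sum>\<eta>\<in>F. prob (X \<xi> \<inter> X \<eta>)) \<le> (\<Sum>\<xi>\<in>F. 1 + ?m * p\<^sup>2)"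
  proof (rule sum_mono)
    fix \<xi> assume x: "\<xi> \<in> F"
    have "(\<Sum>\<eta>\<in>F. prob (X \<xi> \<inter> X \<eta>)) \<le> (\<Sum>\<eta>\<in>F. (if \<eta> = \<xi> then 1 else 0) + p\<^sup>2)"
    proof (rule sum_mono)
      fix \<eta> assume y: "\<eta> \<in> F"
      show "prob (X \<xi> \<inter> X \<eta>) \<le> (if \<eta> = \<xi> then 1 else 0) + p\<^sup>2"
      proof (cases "\<eta> = \<xi>")
        case True
        have "prob (X \<xi> \<inter> X \<eta>) \<le> 1" by (rule prob_le_1)
        then show ?thesis using True by (simp add: add_increasing2)
      qed (use XX[OF x y] in auto)
    qed
    also have "\<dots> = 1 + ?m * p\<^sup>2" using x F(1) by (simp add: sum.distrib)
    finally show "(\<Sum>\<eta>\<in>F. prob (X \<xi> \<inter> X \<eta>)) \<le> 1 + ?m * p\<^sup>2" .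
  qed
  then have double: "(\<Sum>\<xi>\<in>F. \<Sum>\<eta>\<in>F. prob (X \<xi> \<inter> X \<eta>)) \<le> ?m + ?m\<^sup>2 * p\<^sup>2"
    by (simp add: power2_eq_square algebra_simps)
  have single: "(\<Sum>\<xi>\<in>F. prob (X \<xi>)) = ?m * p" using X(2) by simp
  have "(- (?m * p) * prob R + (\<Sum>\<xi>\<in>F. 1 * prob (X \<xi> \<inter> R)))\<^sup>2 \<le>
      prob R * ((- (?m * p))\<^sup>2 + 2 * (- (?m * p)) * (\<Sum>\<xi>\<in>F. 1 * prob (X \<xi>)) + (\<Sum>\<xi>\<in>F. \<Sum>\<eta>\<in>F. 1 * 1 * prob (X \<xi> \<inter> X \<eta>)))"
    using F(1) X(1) R by (rule Cauchy_Schwarz_events)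
  also have "\<dots> \<le> prob R * ?m"
  proof (rule mult_left_mono)
    show "(- (?m * p))\<^sup>2 + 2 * (- (?m * p)) * (\<Sum>\<xi>\<in>F. 1 * prob (X \<xi>)) + (\<Sum>\<xi>\<in>F. \<Sum>\<eta>\<in>F. 1 * 1 * prob (X \<xi> \<inter> X \<eta>)) \<le> ?m"
      using double by (simp add: single power2_eq_square algebra_simps)
  qed simp
  also have "\<dots> \<le> 1 * ?m" by (intro mult_right_mono) auto
  finally have "(- (?m * p) * prob R + (\<Sum>\<xi>\<in>F. prob (X \<xi> \<inter> R)))\<^sup>2 \<le> ?m" by simp
  then have "- (?m * p) * prob R + (\<Sum>\<xi>\<in>F. prob (X \<xi> \<inter> R)) \<le> sqrt ?m" by (rule real_le_rsqrt)
  then show ?thesis by (simp add: X_def Z_def p_def)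
qed

text \<open>On a block \<open>{k..<N}\<close> the set \<open>c\<close> has only 2 ^ (N - k) traces,
  whatever coins it depends on. Given the trace, separation from \<open>k\<close> on prescribes one
  flip of \<xi> per time that must show tails. Uncountability gives infinitely many \<xi> with one
  common \<open>k\<close>; for \<open>m\<close> of them the errors sqrt m of
  \<open>sum_prob_Int_tails_le\<close>, one for each trace, become small against
  \<open>m\<close>.\<close>

lemma no_separation:
  assumes t: "\<not> summable t" and D': "uncountable D'" "D' \<subseteq> D"
    and c: "\<And>n. {x \<in> space M. n \<in> c x} \<in> events"
    and sep: "\<And>\<xi>. \<xi> \<in> D' \<Longrightarrow> AE x in M. finite ({n. x \<in> W (\<xi>, True, n)} - c x)"
      "\<And>\<xi>. \<xi> \<in> D' \<Longrightarrow> AE x in M. finite ({n. x \<in> W (\<xi>, False, n)} \<inter> c x)"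
  shows False
proof -
  define Y where "Y = (\<lambda>\<xi> k. {x \<in> space M. \<forall>n\<in>{k..}. (x \<in> W (\<xi>, True, n) \<longrightarrow> n \<in> c x) \<and> (x \<in> W (\<xi>, False, n) \<longrightarrow> n \<notin> c x)})"
  have Wev: "W (\<xi>, b, n) \<in> events" if "\<xi> \<in> D'" for \<xi> b n using that D'(2) by (intro W_events) auto
  have Yev: "Y \<xi> k \<in> events" if "\<xi> \<in> D'" for \<xi> k
  proof -
    have "Y \<xi> k = space M - (\<Union>n\<in>{k..}. (W (\<xi>, True, n) - {x \<in> space M. n \<in> c x}) \<union> (W (\<xi>, False, n) \<inter> {x \<in> space M. n \<in> c x}))"
      by (auto simp: Y_def)
    also have "\<dots> \<in> events" using Wev[OF that] c by (intro sets.Diff sets.countable_UN' sets.Un sets.Int) auto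
    finally show ?thesis .
  qed
  have "\<exists>k. 1/2 < prob (Y \<xi> k)" if x: "\<xi> \<in> D'" for \<xi>
  proof -
    have "(\<lambda>k. prob (Y \<xi> k)) \<longlonglongrightarrow> prob (\<Union>k. Y \<xi> k)"
    proof (rule finite_Lim_measure_incseq)
      show "range (Y \<xi>) \<subseteq> events" using Yev[OF x] by auto
      show "incseq (Y \<xi>)" by (auto simp: incseq_def Y_def)
    qed
    moreover have "AE x in M. x \<in> (\<Union>k. Y \<xi> k)"
      using sep(1)[OF x] sep(2)[OF x] AE_space
    proof eventually_elim
      case (elim x)
      then have "finite (({n. x \<in> W (\<xi>, True, n)} - c x) \<union> ({n. x \<in> W (\<xi>, False, n)} \<inter> c x))" by simp
      then obtain k where k: "\<forall>n\<in>({n. x \<in> W (\<xi>, True, n)} - c x) \<union> ({n. x \<in> W (\<xi>, False, n)} \<inter> c x). n < k"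
        unfolding finite_nat_set_iff_bounded by (elim exE)
      have "x \<in> Y \<xi> k"
        unfolding Y_def
      proof (intro CollectI conjI ballI impI)
        fix n assume n: "n \<in> {k..}"
        show "n \<in> c x" if "x \<in> W (\<xi>, True, n)"
        proof (rule ccontr)
          assume "n \<notin> c x"
          then have "n < k" using that by (intro bspec[OF k]) simp
          then show False using n by simp
        qed
        show "n \<notin> c x" if "x \<in> W (\<xi>, False, n)"
        proof
          assume "n \<in> c x"
          then have "n < k" using that by (intro bspec[OF k]) simp
          then show False using n by simp
        qed
      qed (use elim in simp)
      then show ?case by auto
    qed
    then have "prob (\<Union>k. Y \<xi> k) = 1"
      using Yev[OF x] by (subst prob_eq_1) auto
    ultimately have "(\<lambda>k. prob (Y \<xi> k)) \<longlonglongrightarrow> 1" by simp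
    from order_tendstoD(1)[OF this, of "1/2"] show ?thesis by (auto simp: eventually_sequentially)
  qed
  then have D'_eq: "D' = (\<Union>k. {\<xi> \<in> D'. 1/2 < prob (Y \<xi> k)})" by auto
  have "\<exists>k. infinite {\<xi> \<in> D'. 1/2 < prob (Y \<xi> k)}"
  proof (rule ccontr)
    assume "\<not> ?thesis"
    then have "countable (\<Union>k. {\<xi> \<in> D'. 1/2 < prob (Y \<xi> k)})"
      by (intro countable_UN) (auto intro: countable_finite)
    then show False using D'(1) unfolding D'_eq[symmetric] by contradiction
  qed
  then obtain k where k: "infinite {\<xi> \<in> D'. 1/2 < prob (Y \<xi> k)}" by blast
  obtain N where N: "(\<Prod>n=k..<N. 1 - t n) < 1/4" using prod_less_if_not_summable[OF t, of "1/4" k] by auto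
  define \<pi> where "\<pi> = (\<Prod>n=k..<N. 1 - t n)"
  \<comment> \<open>For this \<open>m\<close> the errors 2 ^ (N - k) * sqrt m amount to exactly m /
    4. The main term is at most m / 4 by the choice of \<open>N\<close>, while separation gives a
    sum above m / 2.\<close>
  define m :: nat where "m = (4 * 2 ^ (N - k)) ^ 2"
  obtain F where F: "finite F" "card F = m" "F \<subseteq> {\<xi> \<in> D'. 1/2 < prob (Y \<xi> k)}"
    using infinite_arbitrarily_large[OF k] by metis
  have FD: "F \<subseteq> D" and FD': "\<And>\<xi>. \<xi> \<in> F \<Longrightarrow> \<xi> \<in> D'" and FY: "\<And>\<xi>. \<xi> \<in> F \<Longrightarrow> 1/2 < prob (Y \<xi> k)"
    using F(3) D'(2) by auto
  define R where "R = (\<lambda>u. {x \<in> space M. \<forall>n\<in>{k..<N}. n \<in> c x \<longleftrightarrow> n \<in> u})"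
  have Rev: "R u \<in> events" for u
  proof -
    have "R u = space M - (\<Union>n\<in>{k..<N}. if n \<in> u then space M - {x \<in> space M. n \<in> c x} else {x \<in> space M. n \<in> c x})"
      by (auto simp: R_def split: if_splits)
    also have "\<dots> \<in> events" using c by (intro sets.Diff sets.finite_UN) auto
    finally show ?thesis .
  qed
  have R_UN: "(\<Union>u\<in>Pow {k..<N}. R u) = space M"
  proof (intro equalityI subsetI)
    fix x assume "x \<in> space M"
    then have "x \<in> R (c x \<inter> {k..<N})" by (auto simp: R_def)
    then show "x \<in> (\<Union>u\<in>Pow {k..<N}. R u)" by (intro UN_I[of "c x \<inter> {k..<N}"]) auto
  qed (auto simp: R_def)
  have R_disj: "disjoint_family_on R (Pow {k..<N})"
    unfolding disjoint_family_on_def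
  proof (intro ballI impI)
    fix u v assume uv: "u \<in> Pow {k..<N}" "v \<in> Pow {k..<N}" "u \<noteq> v"
    then obtain n where n: "n \<in> u \<longleftrightarrow> n \<notin> v" by blast
    then have "n \<in> {k..<N}" using uv by blast
    with n show "R u \<inter> R v = {}" unfolding R_def by auto
  qed
  have R_sum: "(\<Sum>u\<in>Pow {k..<N}. prob (R u)) = 1"
    using finite_measure_finite_Union[of "Pow {k..<N}" R] Rev R_disj R_UN by (simp add: image_subset_iff prob_space)
  \<comment> \<open>\<open>n \<notin> u\<close> is the truth value of the coin that has to show
    tails: the coin for True if \<open>n\<close> is outside the trace \<open>u\<close>, the coin for
    False if it is inside.\<close>
  define C where "C = (\<lambda>u \<xi>. cyl ((\<lambda>n. (\<xi>, n \<notin> u, n)) ` {k..<N}) {})"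
  have Cev: "C u \<xi> \<in> events" if "\<xi> \<in> F" for u \<xi> unfolding C_def using that FD by (intro cyl_events) auto
  have Y_le: "prob (Y \<xi> k) \<le> (\<Sum>u\<in>Pow {k..<N}. prob (C u \<xi> \<inter> R u))" if x: "\<xi> \<in> F" for \<xi>
  proof -
    have "Y \<xi> k \<subseteq> (\<Union>u\<in>Pow {k..<N}. C u \<xi> \<inter> R u)"
    proof
      fix x assume y: "x \<in> Y \<xi> k"
      then have xs: "x \<in> space M" by (simp add: Y_def)
      then obtain u where u: "u \<in> Pow {k..<N}" "x \<in> R u" using R_UN by blast
      have "x \<in> C u \<xi>" using y u(2) by (auto simp: C_def cyl_def Y_def R_def)
      then show "x \<in> (\<Union>u\<in>Pow {k..<N}. C u \<xi> \<inter> R u)" using u by (intro UN_I[of u]) auto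
    qed
    then have "prob (Y \<xi> k) \<le> prob (\<Union>u\<in>Pow {k..<N}. C u \<xi> \<inter> R u)"
      using Cev[OF x] Rev by (intro finite_measure_mono) auto
    also have "\<dots> \<le> (\<Sum>u\<in>Pow {k..<N}. prob (C u \<xi> \<inter> R u))"
      using Cev[OF x] Rev by (intro finite_measure_subadditive_finite) auto
    finally show ?thesis .
  qed
  have mpos: "0 < m" by (simp add: m_def)
  then have "F \<noteq> {}" using F(2) by auto
  then have "(\<Sum>\<xi>\<in>F. 1/2) < (\<Sum>\<xi>\<in>F. prob (Y \<xi> k))" using F(1) FY by (intro sum_strict_mono) auto
  then have "real m / 2 < (\<Sum>\<xi>\<in>F. prob (Y \<xi> k))" using F(2) by simp
  also have "\<dots> \<le> (\<Sum>\<xi>\<in>F. \<Sum>u\<in>Pow {k..<N}. prob (C u \<xi> \<inter> R u))" using Y_le by (rule sum_mono)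
  also have "\<dots> = (\<Sum>u\<in>Pow {k..<N}. \<Sum>\<xi>\<in>F. prob (C u \<xi> \<inter> R u))" by (rule sum.swap)
  also have "\<dots> \<le> (\<Sum>u\<in>Pow {k..<N}. real m * \<pi> * prob (R u) + sqrt (real m))"
    using sum_prob_Int_tails_le[OF F(1) FD Rev] F(2) unfolding C_def \<pi>_def by (intro sum_mono) simp
  also have "\<dots> = real m * \<pi> + 2 ^ (N - k) * sqrt (real m)"
    by (simp add: sum.distrib sum_distrib_left[symmetric] R_sum card_Pow)
  also have "\<dots> \<le> real m * (1/4) + 2 ^ (N - k) * sqrt (real m)"
    using N by (intro add_right_mono mult_left_mono) (auto simp: \<pi>_def)
  also have "sqrt (real m) = 4 * 2 ^ (N - k)" by (simp only: m_def of_nat_power real_sqrt_abs) simp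
  also have "real m * (1/4) + 2 ^ (N - k) * (4 * 2 ^ (N - k)) = real m / 2"
    by (simp add: m_def power2_eq_square)
  finally show False by simp
qed

end

section \<open>Independent families indexed by a well-founded relation\<close>

text \<open>By well-founded recursion \<open>W x\<close> is chosen independent of the algebra
  generated by its predecessors, which are countably many as \<open>independent_set\<close>
  requires. The product formula for a finite set follows by splitting off its last element.\<close>

lemma (in nowhere_countably_generated) exists_independent_family:
  fixes R :: "('i \<times> 'i) set" and I :: "'i set"
  assumes M: "prob_space M" and R: "wf R" "\<And>x y. x \<in> I \<Longrightarrow> y \<in> I \<Longrightarrow> x \<noteq> y \<Longrightarrow> (x, y) \<in> R \<or> (y, x) \<in> R"
    and pred: "\<And>x. countable {y. (y, x) \<in> R}" and p: "\<And>x. 0 \<le> p x" "\<And>x. p x \<le> 1"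
  shows "\<exists>W. prob_space.indep_events M W I \<and> (\<forall>x\<in>I. measure M (W x) = p x)"
proof -
  interpret prob_space M by (rule M)
  have "\<exists>W. \<forall>x. W x \<in> sets M \<and> (\<forall>C\<in>sigma_sets (space M) (W ` {y. (y, x) \<in> R}). measure M (W x \<inter> C) = p x * measure M C)"
  proof (rule dependent_wf_choice[OF R(1)])
    fix f g :: "'i \<Rightarrow> 'a set" and x r assume "\<And>z. (z, x) \<in> R \<Longrightarrow> f z = g z"
    then have "f ` {y. (y, x) \<in> R} = g ` {y. (y, x) \<in> R}" by (intro image_cong) auto
    then show "(r \<in> sets M \<and> (\<forall>C\<in>sigma_sets (space M) (f ` {y. (y, x) \<in> R}). measure M (r \<inter> C) = p x * measure M C)) =
        (r \<in> sets M \<and> (\<forall>C\<in>sigma_sets (space M) (g ` {y. (y, x) \<in> R}). measure M (r \<inter> C) = p x * measure M C))" by simp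
  next
    fix x and f :: "'i \<Rightarrow> 'a set"
    assume IH: "\<And>y. (y, x) \<in> R \<Longrightarrow> f y \<in> sets M \<and> (\<forall>C\<in>sigma_sets (space M) (f ` {z. (z, y) \<in> R}). measure M (f y \<inter> C) = p y * measure M C)"
    have "countable (f ` {y. (y, x) \<in> R})" using pred by (rule countable_image)
    moreover have "f ` {y. (y, x) \<in> R} \<subseteq> sets M" using IH by auto
    ultimately have "\<exists>r\<in>sets M. \<forall>C\<in>sigma_sets (space M) (f ` {y. (y, x) \<in> R}). measure M (r \<inter> C) = p x * measure M C"
      using p by (rule independent_set)
    then show "\<exists>r. r \<in> sets M \<and> (\<forall>C\<in>sigma_sets (space M) (f ` {y. (y, x) \<in> R}). measure M (r \<inter> C) = p x * measure M C)"
      unfolding Bex_def .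
  qed
  then obtain W where W: "\<And>x. W x \<in> sets M"
    and WC: "\<And>x C. C \<in> sigma_sets (space M) (W ` {y. (y, x) \<in> R}) \<Longrightarrow> prob (W x \<inter> C) = p x * prob C" by metis
  have prod: "prob (space M \<inter> (\<Inter>j\<in>J. W j)) = (\<Prod>j\<in>J. p j)" if "finite J" "J \<subseteq> I" for J
    using that
  proof (induction "card J" arbitrary: J)
    case 0
    then show ?case by (simp add: prob_space)
  next
    case (Suc n)
    \<comment> \<open>Restricted to the finite set \<open>J\<close> the converse relation is
      well-founded too, so \<open>J\<close> has a last element; totality on \<open>I\<close> makes
      all the others its predecessors.\<close>
    let ?r = "R \<inter> J \<times> J"
    have "wf (?r\<inverse>)"
      using Suc.prems(1) acyclic_subset[OF wf_acyclic[OF R(1)]] by (intro finite_acyclic_wf_converse) auto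
    moreover have "J \<noteq> {}" using Suc.hyps(2) by auto
    ultimately obtain x where x: "x \<in> J" "\<And>y. (y, x) \<in> ?r\<inverse> \<Longrightarrow> y \<notin> J" by (metis wfE_min ex_in_conv)
    let ?K = "J - {x}"
    have Kx: "(y, x) \<in> R" if "y \<in> ?K" for y
    proof -
      have "y \<in> J" "x \<noteq> y" using that by auto
      have "(x, y) \<notin> R"
      proof
        assume "(x, y) \<in> R"
        then have "(y, x) \<in> ?r\<inverse>" using x(1) \<open>y \<in> J\<close> by simp
        then show False using x(2) \<open>y \<in> J\<close> by blast
      qed
      then show ?thesis using R(2)[of x y] \<open>y \<in> J\<close> \<open>x \<noteq> y\<close> x(1) Suc.prems(2) by (meson subsetD)
    qed
    have Kf: "finite ?K" using Suc.prems by simp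
    have "sigma_algebra (space M) (sigma_sets (space M) (W ` {y. (y, x) \<in> R}))"
      using W sets.space_closed by (intro sigma_algebra_sigma_sets) blast
    then interpret S: sigma_algebra "space M" "sigma_sets (space M) (W ` {y. (y, x) \<in> R})" .
    have mem: "space M \<inter> (\<Inter>j\<in>L. W j) \<in> sigma_sets (space M) (W ` {y. (y, x) \<in> R})"
      if "finite L" "L \<subseteq> ?K" for L
      using that
    proof (induction L)
      case empty
      then show ?case using S.top by simp
    next
      case (insert a L)
      have "space M \<inter> (\<Inter>j\<in>insert a L. W j) = W a \<inter> (space M \<inter> (\<Inter>j\<in>L. W j))" by auto
      moreover have "W a \<in> sigma_sets (space M) (W ` {y. (y, x) \<in> R})"
        using insert.prems Kx by (intro sigma_sets.Basic) auto
      ultimately show ?case using insert by auto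
    qed
    have "space M \<inter> (\<Inter>j\<in>J. W j) = W x \<inter> (space M \<inter> (\<Inter>j\<in>?K. W j))" using x(1) by auto
    then have "prob (space M \<inter> (\<Inter>j\<in>J. W j)) = p x * prob (space M \<inter> (\<Inter>j\<in>?K. W j))"
      using WC[OF mem[OF Kf subset_refl]] by simp
    also have "prob (space M \<inter> (\<Inter>j\<in>?K. W j)) = (\<Prod>j\<in>?K. p j)"
      using Suc.hyps(2) Suc.prems x(1) by (intro Suc.hyps(1)) auto
    also have "p x * \<dots> = (\<Prod>j\<in>J. p j)"
      using prod.remove[OF Suc.prems(1) x(1), of p] by simp
    finally show ?case .
  qed
  have space: "space M \<inter> (\<Inter>j\<in>J. W j) = (\<Inter>j\<in>J. W j)" if "J \<noteq> {}" for J
    using that sets.sets_into_space[OF W] by blast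
  have single: "prob (W x) = p x" if "x \<in> I" for x
    using prod[of "{x}"] that sets.sets_into_space[OF W[of x]] by (simp add: Int_absorb1)
  have "indep_events W I"
    unfolding indep_events_def
  proof (intro conjI allI impI)
    show "W ` I \<subseteq> events" using W by auto
    fix J assume J: "J \<subseteq> I" "J \<noteq> {}" "finite J"
    have "prob (\<Inter> (W ` J)) = (\<Prod>j\<in>J. p j)" using prod[OF J(3,1)] space[OF J(2)] by simp
    also have "\<dots> = (\<Prod>j\<in>J. prob (W j))" using J(1) single by (intro prod.cong) auto
    finally show "prob (\<Inter> (W ` J)) = (\<Prod>j\<in>J. prob (W j))" .
  qed
  then show ?thesis using single by blast
qed

section \<open>The first uncountable ordinal\<close>

lemma Card_order_omega1: "Card_order omega1"
  by (rule cardSuc_Card_order[OF natLeq_Card_order])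

lemma Well_order_omega1: "Well_order omega1"
  using Card_order_omega1 by (rule card_order_on_well_order_on)

lemma countable_underS_omega1: "countable (underS omega1 a)"
proof (cases "a \<in> Field omega1")
  case True
  then have "(card_of (underS omega1 a), omega1) \<in> ordLess" by (rule card_of_underS[OF Card_order_omega1])
  then have "(card_of (underS omega1 a), natLeq) \<in> ordLeq"
    using cardSuc_ordLeq_ordLess[OF natLeq_Card_order card_of_Card_order] by blast
  then show ?thesis by (simp add: countable_card_le_natLeq)
next
  case False
  then have "underS omega1 a = {}" by (auto simp: underS_def Field_def)
  then show ?thesis by simp
qed

lemma uncountable_Field_omega1: "uncountable (Field omega1)"
proof
  assume "countable (Field omega1)"
  then have "(card_of (Field omega1), natLeq) \<in> ordLeq" by (simp add: countable_card_le_natLeq)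
  moreover have "(natLeq, card_of (Field omega1)) \<in> ordLess"
    using cardSuc_greater[OF natLeq_Card_order] card_of_Field_ordIso[OF Card_order_omega1]
    by (meson ordIso_symmetric ordLess_ordIso_trans)
  ultimately show False by (simp add: not_ordLess_ordLeq)
qed

lemma omega1_limit:
  assumes "a \<in> Field omega1"
  shows "\<exists>b\<in>Field omega1. a \<in> underS omega1 b"
proof -
  have "infinite (Field omega1)" using uncountable_Field_omega1 countable_finite by blast
  then show ?thesis
    using infinite_Card_order_limit[OF Card_order_omega1 _ assms] by (auto simp: underS_def)
qed

lemma wf_omega1: "wf (omega1 - Id)"
  using Well_order_omega1 by (simp add: well_order_on_def)

lemma omega1_cases:
  assumes "a \<in> Field omega1" "b \<in> Field omega1"
  shows "a = b \<or> a \<in> underS omega1 b \<or> b \<in> underS omega1 a"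
  using assms Well_order_omega1
  by (auto simp: underS_def well_order_on_def linear_order_on_def total_on_def)

lemma underS_omega1_trans: "a \<in> underS omega1 b \<Longrightarrow> b \<in> underS omega1 c \<Longrightarrow> a \<in> underS omega1 c"
proof -
  assume ab: "a \<in> underS omega1 b" and bc: "b \<in> underS omega1 c"
  have "trans omega1" "antisym omega1" using Well_order_omega1
    by (auto simp: well_order_on_def linear_order_on_def partial_order_on_def preorder_on_def)
  then show ?thesis using ab bc by (auto simp: underS_def dest: transD antisymD)
qed

section \<open>A tower in an ideal of slowly growing sets\<close>

text \<open>The sections have size o(h), written without division. Unlike a bound by
  \<open>h\<close> itself, this passes to finite unions and, by diagonalisation, to almost upper
  bounds of countably many sets.\<close>

definition slow :: "(nat \<Rightarrow> real) \<Rightarrow> ('i \<times> nat) set \<Rightarrow> bool"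
  where "slow h S \<longleftrightarrow> (\<forall>n. finite {\<zeta>. (\<zeta>, n) \<in> S}) \<and>
    (\<forall>c::nat. \<forall>\<^sub>F n in sequentially. real c * real (card {\<zeta>. (\<zeta>, n) \<in> S}) \<le> h n)"

lemma slow_almost_upper_bound:
  fixes S :: "nat \<Rightarrow> ('i \<times> nat) set"
  assumes S: "\<And>i. slow h (S i)" and h: "\<And>n. 0 \<le> h n"
  shows "\<exists>T. slow h T \<and> (\<forall>n. real (card {\<zeta>. (\<zeta>, n) \<in> T}) \<le> h n) \<and> T \<subseteq> (\<Union>i. S i) \<and> (\<forall>i. finite (S i - T))"
proof -
  define sec where "sec = (\<lambda>(T :: ('i \<times> nat) set) n. {\<zeta>. (\<zeta>, n) \<in> T})"
  have sec_eq: "{\<zeta>. (\<zeta>, n) \<in> T} = sec T n" for T n by (simp add: sec_def)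
  have fin: "finite (sec (S i) n)" for i n using S[of i] by (simp add: slow_def sec_def)
  \<comment> \<open>Of the factor \<open>Suc i * Suc i\<close> asked of each single set, one
    \<open>Suc i\<close> pays for the sum over \<open>Suc i\<close> sets and the other
    remains.\<close>
  have ev: "\<forall>\<^sub>F n in sequentially. real (Suc i) * (\<Sum>j\<le>i. real (card (sec (S j) n))) \<le> h n" for i
  proof -
    have "\<forall>\<^sub>F n in sequentially. \<forall>j\<in>{..i}. real (Suc i * Suc i) * real (card (sec (S j) n)) \<le> h n"
    proof (intro eventually_ball_finite ballI)
      fix j
      show "\<forall>\<^sub>F n in sequentially. real (Suc i * Suc i) * real (card (sec (S j) n)) \<le> h n"
        using conjunct2[OF S[of j, unfolded slow_def], THEN spec, of "Suc i * Suc i"] unfolding sec_def .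
    qed simp
    then show ?thesis
    proof eventually_elim
      case (elim n)
      have "real (Suc i) * (real (Suc i) * (\<Sum>j\<le>i. real (card (sec (S j) n)))) =
          (\<Sum>j\<le>i. real (Suc i * Suc i) * real (card (sec (S j) n)))"
        by (simp only: sum_distrib_left of_nat_mult mult.assoc)
      also have "\<dots> \<le> (\<Sum>j\<le>i. h n)" using elim by (intro sum_mono) auto
      also have "\<dots> = real (Suc i) * h n" by simp
      finally show ?case by (simp only: mult_le_cancel_left_pos of_nat_0_less_iff zero_less_Suc)
    qed
  qed
  have "\<exists>k. \<forall>i. (\<forall>n\<ge>k i. real (Suc i) * (\<Sum>j\<le>i. real (card (sec (S j) n))) \<le> h n) \<and> (k i :: nat) < k (Suc i)"
  proof (rule dependent_nat_choice)
    show "\<exists>x. \<forall>n\<ge>x. real (Suc 0) * (\<Sum>j\<le>0. real (card (sec (S j) n))) \<le> h n"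
      using ev[of 0] unfolding eventually_sequentially .
    fix x :: nat and i
    obtain N where "\<forall>n\<ge>N. real (Suc (Suc i)) * (\<Sum>j\<le>Suc i. real (card (sec (S j) n))) \<le> h n"
      using ev[of "Suc i"] unfolding eventually_sequentially by (elim exE)
    then show "\<exists>y. (\<forall>n\<ge>y. real (Suc (Suc i)) * (\<Sum>j\<le>Suc i. real (card (sec (S j) n))) \<le> h n) \<and> x < y"
      by (intro exI[of _ "max N (Suc x)"]) simp
  qed
  then obtain k :: "nat \<Rightarrow> nat" where k: "\<forall>i. (\<forall>n\<ge>k i. real (Suc i) * (\<Sum>j\<le>i. real (card (sec (S j) n))) \<le> h n) \<and> k i < k (Suc i)"
    by (elim exE)
  have mono: "strict_mono k" using k by (simp add: strict_mono_Suc_iff)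
  have kle: "i \<le> k i" for i using mono by (rule strict_mono_imp_increasing)
  define T where "T = {(\<zeta>, n). \<exists>i. (\<zeta>, n) \<in> S i \<and> k i \<le> n}"
  have sec_le: "finite (sec T n) \<and> real (Suc c) * real (card (sec T n)) \<le> h n" if "k c \<le> n" for c n
  proof -
    define i where "i = Max {j. k j \<le> n}"
    have fin_j: "finite {j. k j \<le> n}" using kle by (auto intro: finite_subset[of _ "{..n}"] le_trans)
    have i: "k i \<le> n" "c \<le> i" and max: "\<And>j. k j \<le> n \<Longrightarrow> j \<le> i"
      using Max_in[OF fin_j] Max_ge[OF fin_j] that by (auto simp: i_def)
    have sub: "sec T n \<subseteq> (\<Union>j\<le>i. sec (S j) n)" using max by (auto simp: sec_def T_def)
    have fU: "finite (\<Union>j\<le>i. sec (S j) n)" using fin by simp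
    have "card (sec T n) \<le> card (\<Union>j\<le>i. sec (S j) n)" using fU sub by (rule card_mono)
    also have "\<dots> \<le> (\<Sum>j\<le>i. card (sec (S j) n))" by (intro card_UN_le) simp
    finally have "real (card (sec T n)) \<le> (\<Sum>j\<le>i. real (card (sec (S j) n)))"
      unfolding of_nat_sum[symmetric] of_nat_le_iff .
    then have "real (Suc c) * real (card (sec T n)) \<le> real (Suc i) * (\<Sum>j\<le>i. real (card (sec (S j) n)))"
      using i(2) by (intro mult_mono) auto
    also have "\<dots> \<le> h n" using k i(1) by simp
    finally show ?thesis using finite_subset[OF sub fU] by simp
  qed
  have empty: "sec T n = {}" if "n < k 0" for n
  proof -
    have "n < k j" for j using that mono strict_mono_less_eq[OF mono, of 0 j] by simp
    then show ?thesis by (auto simp: sec_def T_def not_le[symmetric])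
  qed
  have all: "finite (sec T n) \<and> real (card (sec T n)) \<le> h n" for n
    using sec_le[of 0 n] empty[of n] h[of n] by (cases "k 0 \<le> n") auto
  have "slow h T"
    unfolding slow_def sec_eq eventually_sequentially
  proof (intro conjI allI exI impI)
    fix n show "finite (sec T n)" using all by simp
  next
    fix c n assume "k c \<le> n"
    then have "real (Suc c) * real (card (sec T n)) \<le> h n" using sec_le by simp
    moreover have "real c * real (card (sec T n)) \<le> real (Suc c) * real (card (sec T n))"
      by (intro mult_right_mono) auto
    ultimately show "real c * real (card (sec T n)) \<le> h n" by linarith
  qed
  moreover have "finite (S i - T)" for i
  proof -
    have "S i - T \<subseteq> (\<Union>n<k i. sec (S i) n \<times> {n})" by (auto simp: T_def sec_def not_le)
    moreover have "finite (\<Union>n<k i. sec (S i) n \<times> {n})" using fin by simp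
    ultimately show ?thesis by (rule finite_subset)
  qed
  moreover have "T \<subseteq> (\<Union>i. S i)" by (auto simp: T_def)
  ultimately show ?thesis using all unfolding sec_def by (intro exI[of _ T]) simp
qed

text \<open>At \<alpha> only countably many sets have to be almost contained: the earlier
  \<open>S \<beta>\<close> and the lines of earlier ordinals, which are slow because
  \<open>h\<close> tends to infinity. Staying below \<alpha> in the first coordinate keeps out the
  line of \<alpha> itself, which later makes the inclusions between towers strict.\<close>

lemma exists_slow_tower:
  assumes h: "\<And>n. 0 \<le> h n" "filterlim h at_top sequentially"
  shows "\<exists>S. \<forall>\<alpha>. slow h (S \<alpha>) \<and> (\<forall>n. real (card {\<zeta>. (\<zeta>, n) \<in> S \<alpha>}) \<le> h n) \<and> S \<alpha> \<subseteq> underS omega1 \<alpha> \<times> UNIV \<and>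
    (\<forall>\<beta>\<in>underS omega1 \<alpha>. finite (S \<beta> - S \<alpha>) \<and> finite ({\<beta>} \<times> UNIV - S \<alpha>))"
proof (rule dependent_wf_choice[OF wf_omega1])
  fix f g :: "nat set \<Rightarrow> (nat set \<times> nat) set" and \<alpha> r
  assume fg: "\<And>z. (z, \<alpha>) \<in> omega1 - Id \<Longrightarrow> f z = g z"
  have "f \<beta> = g \<beta>" if "\<beta> \<in> underS omega1 \<alpha>" for \<beta> using that by (intro fg) (auto simp: underS_def)
  then show "(slow h r \<and> (\<forall>n. real (card {\<zeta>. (\<zeta>, n) \<in> r}) \<le> h n) \<and> r \<subseteq> underS omega1 \<alpha> \<times> UNIV \<and>
    (\<forall>\<beta>\<in>underS omega1 \<alpha>. finite (f \<beta> - r) \<and> finite ({\<beta>} \<times> UNIV - r))) =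
    (slow h r \<and> (\<forall>n. real (card {\<zeta>. (\<zeta>, n) \<in> r}) \<le> h n) \<and> r \<subseteq> underS omega1 \<alpha> \<times> UNIV \<and>
    (\<forall>\<beta>\<in>underS omega1 \<alpha>. finite (g \<beta> - r) \<and> finite ({\<beta>} \<times> UNIV - r)))" by (simp cong: ball_cong)
next
  fix \<alpha> and f :: "nat set \<Rightarrow> (nat set \<times> nat) set"
  assume IH: "\<And>\<beta>. (\<beta>, \<alpha>) \<in> omega1 - Id \<Longrightarrow> slow h (f \<beta>) \<and> (\<forall>n. real (card {\<zeta>. (\<zeta>, n) \<in> f \<beta>}) \<le> h n) \<and>
    f \<beta> \<subseteq> underS omega1 \<beta> \<times> UNIV \<and> (\<forall>\<gamma>\<in>underS omega1 \<beta>. finite (f \<gamma> - f \<beta>) \<and> finite ({\<gamma>} \<times> UNIV - f \<beta>))"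
  have IH': "slow h (f \<beta>)" "f \<beta> \<subseteq> underS omega1 \<beta> \<times> UNIV" if "\<beta> \<in> underS omega1 \<alpha>" for \<beta>
    using IH[of \<beta>] that by (auto simp: underS_def)
  \<comment> \<open>The empty set is there for the least ordinal, which has no predecessors to
    enumerate.\<close>
  define U where "U = insert {} (f ` underS omega1 \<alpha> \<union> (\<lambda>\<beta>. {\<beta>} \<times> UNIV) ` underS omega1 \<alpha>)"
  have slow_line: "slow h ({\<beta>} \<times> UNIV)" for \<beta> :: "nat set"
    using h(2) by (auto simp: slow_def filterlim_at_top)
  have slow_empty: "slow h ({} :: (nat set \<times> nat) set)"
    using h(1) by (auto simp: slow_def)
  have slow_U: "slow h X" if "X \<in> U" for X
    using that IH'(1) slow_line slow_empty by (auto simp: U_def)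
  have U: "countable U" "U \<noteq> {}" using countable_underS_omega1[of \<alpha>] by (auto simp: U_def)
  define e where "e = from_nat_into U"
  have re: "range e = U" unfolding e_def using U(2,1) by (rule range_from_nat_into)
  have "e i \<in> U" for i unfolding e_def using U(2) by (rule from_nat_into)
  then have "slow h (e i)" for i by (rule slow_U)
  then have "\<exists>T. slow h T \<and> (\<forall>n. real (card {\<zeta>. (\<zeta>, n) \<in> T}) \<le> h n) \<and> T \<subseteq> (\<Union>i. e i) \<and> (\<forall>i. finite (e i - T))"
    using h(1) by (rule slow_almost_upper_bound)
  then obtain T where T: "slow h T" "\<forall>n. real (card {\<zeta>. (\<zeta>, n) \<in> T}) \<le> h n"
    "T \<subseteq> (\<Union>i. e i)" and fin: "\<forall>i. finite (e i - T)"
    by (elim exE conjE)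
  have finU: "finite (X - T)" if "X \<in> U" for X
  proof -
    have "X \<in> range e" using that re by simp
    then obtain i where "X = e i" by (rule rangeE)
    then show ?thesis using fin by simp
  qed
  have "\<Union>U \<subseteq> underS omega1 \<alpha> \<times> UNIV"
  proof
    fix y assume "y \<in> \<Union>U"
    then consider \<beta> where "\<beta> \<in> underS omega1 \<alpha>" "y \<in> f \<beta>" | \<beta> where "\<beta> \<in> underS omega1 \<alpha>" "y \<in> {\<beta>} \<times> UNIV" by (auto simp: U_def)
    then show "y \<in> underS omega1 \<alpha> \<times> UNIV"
    proof cases
      case 1
      then have "y \<in> underS omega1 \<beta> \<times> UNIV" using IH'(2) by (rule_tac subsetD)
      then have "fst y \<in> underS omega1 \<beta>" by auto
      then show ?thesis using underS_omega1_trans[OF _ 1(1)] by (cases y) auto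
    qed auto
  qed
  then have "T \<subseteq> underS omega1 \<alpha> \<times> UNIV" using T(3) unfolding re by (rule subset_trans[rotated])
  then show "\<exists>r. slow h r \<and> (\<forall>n. real (card {\<zeta>. (\<zeta>, n) \<in> r}) \<le> h n) \<and> r \<subseteq> underS omega1 \<alpha> \<times> UNIV \<and>
    (\<forall>\<beta>\<in>underS omega1 \<alpha>. finite (f \<beta> - r) \<and> finite ({\<beta>} \<times> UNIV - r))"
    using T(1,2) finU by (intro exI[of _ T] conjI ballI) (auto simp: U_def)
qed

section \<open>The random gap\<close>

text \<open>If all intersections were null, Cauchy--Schwarz on the whole space would give (m e)^2
  \<le> m for \<open>m\<close> of the events, which fails for large \<open>m\<close>.\<close>

lemma (in prob_space) exists_pair_positive_Int:
  assumes J: "infinite J" and A: "\<And>\<xi>. \<xi> \<in> J \<Longrightarrow> A \<xi> \<in> events" and e: "0 < e" "\<And>\<xi>. \<xi> \<in> J \<Longrightarrow> e \<le> prob (A \<xi>)"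
  shows "\<exists>\<xi>\<in>J. \<exists>\<eta>\<in>J. \<xi> \<noteq> \<eta> \<and> 0 < prob (A \<xi> \<inter> A \<eta>)"
proof (rule ccontr)
  assume "\<not> ?thesis"
  then have zero: "\<And>\<xi> \<eta>. \<xi> \<in> J \<Longrightarrow> \<eta> \<in> J \<Longrightarrow> \<xi> \<noteq> \<eta> \<Longrightarrow> prob (A \<xi> \<inter> A \<eta>) \<le> 0" by (meson not_less)
  obtain m :: nat where m: "1 / e\<^sup>2 < real m" using reals_Archimedean2 by blast
  obtain F where F: "finite F" "card F = m" "F \<subseteq> J" using infinite_arbitrarily_large[OF J] by metis
  have FJ: "\<And>\<xi>. \<xi> \<in> F \<Longrightarrow> \<xi> \<in> J" using F(3) by blast
  have Asp: "A \<xi> \<inter> space M = A \<xi>" if "\<xi> \<in> F" for \<xi>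
    using sets.sets_into_space[OF A[OF FJ[OF that]]] by blast
  have "(\<Sum>\<xi>\<in>F. prob (A \<xi>))\<^sup>2 \<le> (\<Sum>\<xi>\<in>F. \<Sum>\<eta>\<in>F. prob (A \<xi> \<inter> A \<eta>))"
    using Cauchy_Schwarz_events[of F A "space M" 0 "\<lambda>_. 1"] F(1) A[OF FJ] Asp
    by (simp add: prob_space cong: sum.cong)
  also have "\<dots> \<le> (\<Sum>\<xi>\<in>F. \<Sum>\<eta>\<in>F. if \<eta> = \<xi> then 1 else 0)"
    using zero FJ by (intro sum_mono) (auto simp: prob_le_1)
  also have "\<dots> = real m" using F by simp
  finally have 1: "(\<Sum>\<xi>\<in>F. prob (A \<xi>))\<^sup>2 \<le> real m" .
  have "(\<Sum>\<xi>\<in>F. e) \<le> (\<Sum>\<xi>\<in>F. prob (A \<xi>))" using e(2) FJ by (intro sum_mono) auto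
  then have "(real m * e)\<^sup>2 \<le> (\<Sum>\<xi>\<in>F. prob (A \<xi>))\<^sup>2" using F e(1) by (intro power_mono) auto
  then have 2: "real m * (real m * e\<^sup>2) \<le> real m * 1" using 1 by (simp add: power2_eq_square algebra_simps)
  have "0 < 1 / e\<^sup>2" using e(1) by simp
  then have "0 < real m" using m by linarith
  then have "real m * e\<^sup>2 \<le> 1" using 2 by (simp only: mult_le_cancel_left_pos)
  then show False using m e(1) by (simp add: field_simps)
qed

text \<open>Countably many pairs of thresholds cover an uncountable set. The bound on
  \<open>c\<close> is used for the size of \<Gamma> and for the index of a set of finite
  measure.\<close>

lemma exists_infinite_ge:
  fixes f :: "'x \<Rightarrow> real" and c :: "'x \<Rightarrow> nat"
  assumes J: "uncountable J" and f: "\<forall>\<xi>\<in>J. 0 < f \<xi>"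
  shows "\<exists>e m. 0 < e \<and> infinite {\<xi> \<in> J. e \<le> f \<xi> \<and> c \<xi> \<le> m}"
proof (rule ccontr)
  assume "\<not> ?thesis"
  then have fin: "finite {\<xi> \<in> J. e \<le> f \<xi> \<and> c \<xi> \<le> m}" if "0 < e" for e m using that by blast
  have "J = (\<Union>(m, i)\<in>UNIV. {\<xi> \<in> J. inverse (real (Suc i)) \<le> f \<xi> \<and> c \<xi> \<le> m})"
  proof (intro equalityI subsetI)
    fix \<xi> assume x: "\<xi> \<in> J"
    obtain i where "inverse (real (Suc i)) < f \<xi>" using reals_Archimedean[OF bspec[OF f x]] by blast
    then show "\<xi> \<in> (\<Union>(m, i)\<in>UNIV. {\<xi> \<in> J. inverse (real (Suc i)) \<le> f \<xi> \<and> c \<xi> \<le> m})"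
      using x by (intro UN_I[of "(c \<xi>, i)"]) auto
  qed auto
  moreover have "countable (\<Union>(m, i)\<in>UNIV. {\<xi> \<in> J. inverse (real (Suc i)) \<le> f \<xi> \<and> c \<xi> \<le> m})"
    using fin by (intro countable_UN) (auto intro: countable_finite)
  ultimately show False using J by (metis (no_types))
qed

text \<open>\<open>W i \<subseteq> E\<close> makes the towers empty off \<open>E\<close>, so that
  properties holding almost everywhere on \<open>E\<close> extend to \<open>M\<close>. By
  \<open>1 \<le> h n\<close> a line, which reads one coin at each time, obeys the same bound as
  \<open>S \<alpha>\<close>.\<close>

locale random_tower = sigma_finite_measure M for M :: "'a measure" +
  fixes E :: "'a set" and W :: "nat set \<times> bool \<times> nat \<Rightarrow> 'a set" and t h :: "nat \<Rightarrow> real"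
    and S :: "nat set \<Rightarrow> (nat set \<times> nat) set"
  assumes E: "E \<in> fmeasurable M" "0 < measure M E"
    and flips: "coin_flips (uniform_measure M E) W (Field omega1) t"
    and W_subset: "\<And>i. W i \<subseteq> E"
    and not_summable: "\<not> summable t" and summable: "summable (\<lambda>n. (h n)\<^sup>2 * (t n)\<^sup>2)"
    and h: "\<And>n. 1 \<le> h n"
    and S_finite: "\<And>\<alpha> n. finite {\<zeta>. (\<zeta>, n) \<in> S \<alpha>}"
    and S_card: "\<And>\<alpha> n. real (card {\<zeta>. (\<zeta>, n) \<in> S \<alpha>}) \<le> h n"
    and S_subset: "\<And>\<alpha>. S \<alpha> \<subseteq> underS omega1 \<alpha> \<times> UNIV"
    and S_mono: "\<And>\<alpha> \<beta>. \<beta> \<in> underS omega1 \<alpha> \<Longrightarrow> finite (S \<beta> - S \<alpha>)"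
    and S_line: "\<And>\<alpha> \<beta>. \<beta> \<in> underS omega1 \<alpha> \<Longrightarrow> finite ({\<beta>} \<times> UNIV - S \<alpha>)"
begin

sublocale P: coin_flips "uniform_measure M E" W "Field omega1" t by (rule flips)

abbreviation "P \<equiv> uniform_measure M E"

definition tower :: "bool \<Rightarrow> nat set \<Rightarrow> 'a \<Rightarrow> nat set"
  where "tower b \<alpha> = P.heads b (S \<alpha>)"

section \<open>Measurability and order of the towers\<close>

lemma emeasure_E: "emeasure M E \<noteq> 0" "emeasure M E < \<infinity>"
  using E by (auto simp: fmeasurable_def measure_def)

lemma AE_P_iff: "(AE x in P. Q x) \<longleftrightarrow> (AE x in M. x \<in> E \<longrightarrow> Q x)"
  using emeasure_E by (rule AE_uniform_measure)

lemma S_Field: "S \<alpha> \<subseteq> Field omega1 \<times> UNIV"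
proof -
  have "underS omega1 \<alpha> \<subseteq> Field omega1" by (auto simp: underS_def Field_def)
  then show ?thesis using S_subset[of \<alpha>] by blast
qed

lemma tower_empty: "x \<notin> E \<Longrightarrow> tower b \<alpha> x = {}"
  using W_subset by (auto simp: tower_def P.heads_def)

lemma tower_sets: "{x \<in> space M. n \<in> tower b \<alpha> x} \<in> sets M"
  using P.heads_events[OF S_Field S_finite, of n b] by (simp add: tower_def)

lemma tower_random_set: "tower b \<alpha> \<in> random_sets M"
  unfolding random_sets_iff using tower_sets by (auto intro: sets_completionI_sets)

lemma tower_Diff_finite:
  assumes "\<beta> \<in> underS omega1 \<alpha>"
  shows "finite (tower b \<beta> x - tower b \<alpha> x)"
proof -
  have "tower b \<beta> x - tower b \<alpha> x \<subseteq> snd ` (S \<beta> - S \<alpha>)"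
    by (force simp: tower_def P.heads_def image_iff)
  then show ?thesis using S_mono[OF assms] by (meson finite_imageI finite_subset)
qed

lemma heads_Diff_tower_finite:
  assumes "\<beta> \<in> underS omega1 \<alpha>"
  shows "finite ({n. x \<in> W (\<beta>, b, n)} - tower b \<alpha> x)"
proof -
  have "{n. x \<in> W (\<beta>, b, n)} - tower b \<alpha> x \<subseteq> snd ` ({\<beta>} \<times> UNIV - S \<alpha>)"
    by (force simp: tower_def P.heads_def image_iff)
  then show ?thesis using S_line[OF assms] by (meson finite_imageI finite_subset)
qed

lemma AE_tower_Int_finite: "AE x in M. finite (tower True \<alpha> x \<inter> tower False \<beta> x)"
proof -
  have "AE x in P. finite (tower True \<alpha> x \<inter> tower False \<beta> x)"
    unfolding tower_def
    by (rule P.AE_finite_heads_Int[OF S_Field S_Field S_finite S_finite S_card S_card _ summable]) simp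
  then have "AE x in M. x \<in> E \<longrightarrow> finite (tower True \<alpha> x \<inter> tower False \<beta> x)" by (simp only: AE_P_iff)
  then show ?thesis
  proof eventually_elim
    case (elim x)
    then show ?case using tower_empty by (cases "x \<in> E") auto
  qed
qed

text \<open>The heads of the coin \<alpha> are almost contained in the tower at \<beta>, but almost
  disjoint from the tower at \<alpha>, which does not read that coin. An almost inclusion the other
  way would leave the coin only finitely many heads.\<close>

lemma tower_strict:
  assumes \<alpha>: "\<alpha> \<in> underS omega1 \<beta>"
  shows "\<not> (AE x in M. finite (tower b \<beta> x - tower b \<alpha> x))"
proof
  assume "AE x in M. finite (tower b \<beta> x - tower b \<alpha> x)"
  then have 1: "AE x in P. finite (tower b \<beta> x - tower b \<alpha> x)"
    unfolding AE_P_iff by eventually_elim simp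
  have \<alpha>F: "\<alpha> \<in> Field omega1" using \<alpha> by (auto simp: underS_def Field_def)
  have line: "P.heads b ({\<alpha>} \<times> UNIV) x = {n. x \<in> W (\<alpha>, b, n)}" for x by (auto simp: P.heads_def)
  have disj: "{\<alpha>} \<times> UNIV \<inter> S \<alpha> = {}" using S_subset[of \<alpha>] by (auto simp: underS_def)
  have sec: "{\<zeta>. (\<zeta>, n) \<in> {\<alpha>} \<times> UNIV} = {\<alpha>}" for n :: nat by auto
  have "AE x in P. finite (P.heads b ({\<alpha>} \<times> UNIV) x \<inter> P.heads b (S \<alpha>) x)"
  proof (rule P.AE_finite_heads_Int[OF _ S_Field _ S_finite _ S_card _ summable])
    show "{\<alpha>} \<times> UNIV \<subseteq> Field omega1 \<times> UNIV" using \<alpha>F by auto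
    show "finite {\<zeta>. (\<zeta>, n) \<in> {\<alpha>} \<times> UNIV}" for n :: nat unfolding sec by simp
    show "real (card {\<zeta>. (\<zeta>, n) \<in> {\<alpha>} \<times> UNIV}) \<le> h n" for n :: nat unfolding sec using h by simp
    show "b \<noteq> b \<or> {\<alpha>} \<times> UNIV \<inter> S \<alpha> = {}" using disj by simp
  qed
  with 1 have "AE x in P. finite {n. x \<in> W (\<alpha>, b, n)}"
  proof eventually_elim
    case (elim x)
    let ?J = "{n. x \<in> W (\<alpha>, b, n)}"
    have "?J \<subseteq> (?J - tower b \<beta> x) \<union> (tower b \<beta> x - tower b \<alpha> x) \<union> (P.heads b ({\<alpha>} \<times> UNIV) x \<inter> P.heads b (S \<alpha>) x)"
      unfolding line tower_def by blast
    moreover have "finite \<dots>" using elim heads_Diff_tower_finite[OF \<alpha>] by simp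
    ultimately show ?case by (rule finite_subset)
  qed
  then show False using P.not_AE_finite_heads[OF not_summable \<alpha>F] by simp
qed

lemma tower_le_iff:
  assumes "\<alpha> \<in> Field omega1" "\<beta> \<in> Field omega1"
  shows "fin_class M (tower b \<alpha>) \<sqsubseteq>\<^bsub>L0_Fin M\<^esub> fin_class M (tower b \<beta>) \<longleftrightarrow> (\<alpha>, \<beta>) \<in> omega1"
proof -
  have refl: "(\<alpha>, \<alpha>) \<in> omega1"
    using assms(1) Well_order_omega1
    by (auto simp: well_order_on_def linear_order_on_def partial_order_on_def preorder_on_def refl_on_def)
  have antisym: "antisym omega1" using Well_order_omega1
    by (auto simp: well_order_on_def linear_order_on_def partial_order_on_def)
  have le: "fin_class M (tower b \<alpha>) \<sqsubseteq>\<^bsub>L0_Fin M\<^esub> fin_class M (tower b \<beta>) \<longleftrightarrow> (AE x in M. finite (tower b \<alpha> x - tower b \<beta> x))"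
    by (rule le_L0_Fin[OF tower_random_set tower_random_set])
  consider "\<alpha> = \<beta>" | "\<alpha> \<in> underS omega1 \<beta>" | "\<beta> \<in> underS omega1 \<alpha>" using omega1_cases[OF assms] by blast
  then show ?thesis
  proof cases
    case 1
    then show ?thesis using refl le by simp
  next
    case 2
    then show ?thesis using le tower_Diff_finite[OF 2] by (simp add: underS_def)
  next
    case 3
    then have "(\<alpha>, \<beta>) \<notin> omega1" using antisym by (auto simp: underS_def dest: antisymD)
    then show ?thesis using le tower_strict[OF 3] by simp
  qed
qed

lemma order_type_tower:
  "order_type_omega1 (L0_Fin M) ((\<lambda>\<alpha>. fin_class M (tower b \<alpha>)) ` Field omega1)"
proof -
  let ?f = "\<lambda>\<alpha>. fin_class M (tower b \<alpha>)"
  have inj: "inj_on ?f (Field omega1)"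
  proof (rule inj_onI)
    fix \<alpha> \<beta> assume ab: "\<alpha> \<in> Field omega1" "\<beta> \<in> Field omega1" "?f \<alpha> = ?f \<beta>"
    have "(\<alpha>, \<alpha>) \<in> omega1" "antisym omega1"
      using ab(1) Well_order_omega1
      by (auto simp: well_order_on_def linear_order_on_def partial_order_on_def preorder_on_def refl_on_def)
    moreover have "(\<alpha>, \<beta>) \<in> omega1" "(\<beta>, \<alpha>) \<in> omega1"
      using tower_le_iff[OF ab(1,2), of b] tower_le_iff[OF ab(2,1), of b] tower_le_iff[OF ab(1,1), of b] ab(3) calculation(1)
      by simp_all
    ultimately show "\<alpha> = \<beta>" by (auto dest: antisymD)
  qed
  have "{(a, b). a \<in> ?f ` Field omega1 \<and> b \<in> ?f ` Field omega1 \<and> a \<sqsubseteq>\<^bsub>L0_Fin M\<^esub> b} = dir_image omega1 ?f"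
  proof (intro equalityI subsetI)
    fix p assume "p \<in> {(a, b). a \<in> ?f ` Field omega1 \<and> b \<in> ?f ` Field omega1 \<and> a \<sqsubseteq>\<^bsub>L0_Fin M\<^esub> b}"
    then obtain \<alpha> \<beta> where p: "p = (?f \<alpha>, ?f \<beta>)" "\<alpha> \<in> Field omega1" "\<beta> \<in> Field omega1" "?f \<alpha> \<sqsubseteq>\<^bsub>L0_Fin M\<^esub> ?f \<beta>" by auto
    then have "(\<alpha>, \<beta>) \<in> omega1" using tower_le_iff[OF p(2,3)] by simp
    then show "p \<in> dir_image omega1 ?f" using p(1) unfolding dir_image_def by blast
  next
    fix p assume "p \<in> dir_image omega1 ?f"
    then obtain \<alpha> \<beta> where p: "p = (?f \<alpha>, ?f \<beta>)" "(\<alpha>, \<beta>) \<in> omega1" unfolding dir_image_def by blast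
    then have F: "\<alpha> \<in> Field omega1" "\<beta> \<in> Field omega1" by (auto simp: Field_def)
    then show "p \<in> {(a, b). a \<in> ?f ` Field omega1 \<and> b \<in> ?f ` Field omega1 \<and> a \<sqsubseteq>\<^bsub>L0_Fin M\<^esub> b}"
      using p tower_le_iff[OF F] by simp
  qed
  then show ?thesis
    unfolding order_type_omega1_def using ordIso_symmetric[OF dir_image_ordIso[OF Well_order_omega1 inj]] by simp
qed

section \<open>The towers form a gap\<close>

lemma pregap_tower:
  "pregap (L0_Fin M) ((\<lambda>\<alpha>. fin_class M (tower True \<alpha>)) ` Field omega1) ((\<lambda>\<alpha>. fin_class M (tower False \<alpha>)) ` Field omega1)"
proof -
  have "fin_class M (tower True \<alpha>) \<sqinter>\<^bsub>L0_Fin M\<^esub> fin_class M (tower False \<beta>) = \<bottom>\<^bsub>L0_Fin M\<^esub>" for \<alpha> \<beta>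
  proof -
    note ops = random_sets_ops[OF tower_random_set[of True \<alpha>] tower_random_set[of False \<beta>]]
    have "fin_class M (\<lambda>x. tower True \<alpha> x \<inter> tower False \<beta> x) = fin_class M (\<lambda>x. {})"
      unfolding fin_class_eq_iff[OF ops(1,4)] using AE_tower_Int_finite[of \<alpha> \<beta>] by simp
    then show ?thesis by (simp only: L0_Fin_ops[OF tower_random_set tower_random_set])
  qed
  then show ?thesis
    unfolding pregap_def carrier_L0_Fin using tower_random_set by auto
qed

lemma gap_tower:
  "gap (L0_Fin M) ((\<lambda>\<alpha>. fin_class M (tower True \<alpha>)) ` Field omega1) ((\<lambda>\<alpha>. fin_class M (tower False \<alpha>)) ` Field omega1)"
proof -
  have no_c: False if c: "c \<in> carrier (L0_Fin M)"
    "\<And>\<alpha>. \<alpha> \<in> Field omega1 \<Longrightarrow> fin_class M (tower True \<alpha>) \<sqsubset>\<^bsub>L0_Fin M\<^esub> c"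
    "\<And>\<alpha>. \<alpha> \<in> Field omega1 \<Longrightarrow> fin_class M (tower False \<alpha>) \<sqsubset>\<^bsub>L0_Fin M\<^esub> compl (L0_Fin M) c" for c
  proof -
    from c(1) obtain g where g: "g \<in> random_sets M" "c = fin_class M g" unfolding carrier_L0_Fin by blast
    have gc: "(\<lambda>x. - g x) \<in> random_sets M" using random_sets_ops[OF g(1) g(1)] by simp
    have up: "AE x in M. finite (tower True \<alpha> x - g x)" if "\<alpha> \<in> Field omega1" for \<alpha>
      using c(2)[OF that] le_L0_Fin[OF tower_random_set g(1)] unfolding lless_def g(2) by blast
    have dn: "AE x in M. finite (tower False \<alpha> x \<inter> g x)" if "\<alpha> \<in> Field omega1" for \<alpha>
    proof -
      have "fin_class M (tower False \<alpha>) \<sqsubseteq>\<^bsub>L0_Fin M\<^esub> fin_class M (\<lambda>x. - g x)"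
        using c(3)[OF that] unfolding lless_def g(2) compl_L0_Fin[OF g(1)] by blast
      then show ?thesis unfolding le_L0_Fin[OF tower_random_set gc] by (simp add: Diff_eq)
    qed
    \<comment> \<open>\<open>g\<close> is measurable only for the completion, whereas
      \<open>no_separation\<close> works with events of \<open>P\<close>. \<open>main_part\<close>
      supplies measurable sets that agree with those of \<open>g\<close> almost everywhere, for all
      \<open>n\<close> at once.\<close>
    define g' where "g' = (\<lambda>x. {n. x \<in> main_part M {y \<in> space M. n \<in> g y}})"
    have gs: "{y \<in> space M. n \<in> g y} \<in> sets (completion M)" for n using g(1) by (simp add: random_sets_iff)
    have "AE x in M. \<forall>n. x \<in> main_part M {y \<in> space M. n \<in> g y} \<longleftrightarrow> x \<in> {y \<in> space M. n \<in> g y}"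
      unfolding AE_all_countable using AE_in_main_part[OF gs] by simp
    then have eq: "AE x in M. g' x = g x"
      using AE_space by eventually_elim (auto simp: g'_def)
    have "{x \<in> space M. n \<in> g' x} = main_part M {y \<in> space M. n \<in> g y}" for n
      using sets.sets_into_space[OF main_part_sets[OF gs[of n]]] by (auto simp: g'_def)
    then have g's: "{x \<in> space P. n \<in> g' x} \<in> sets P" for n using main_part_sets[OF gs[of n]] by simp
    show False
    proof (rule P.no_separation[OF not_summable uncountable_Field_omega1 subset_refl g's])
      fix \<xi> assume "\<xi> \<in> Field omega1"
      \<comment> \<open>Only towers with index above \<xi> are known to almost contain the heads of
        the coin \<xi>.\<close>
      then obtain \<alpha> where \<alpha>: "\<alpha> \<in> Field omega1" "\<xi> \<in> underS omega1 \<alpha>" using omega1_limit by blast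
      show "AE x in P. finite ({n. x \<in> W (\<xi>, True, n)} - g' x)"
        unfolding AE_P_iff using up[OF \<alpha>(1)] eq
      proof eventually_elim
        case (elim x)
        have "{n. x \<in> W (\<xi>, True, n)} - g' x \<subseteq> ({n. x \<in> W (\<xi>, True, n)} - tower True \<alpha> x) \<union> (tower True \<alpha> x - g x)"
          using elim(2) by blast
        moreover have "finite \<dots>" using elim(1) heads_Diff_tower_finite[OF \<alpha>(2)] by simp
        ultimately show ?case by (meson finite_subset)
      qed
      show "AE x in P. finite ({n. x \<in> W (\<xi>, False, n)} \<inter> g' x)"
        unfolding AE_P_iff using dn[OF \<alpha>(1)] eq
      proof eventually_elim
        case (elim x)
        have "{n. x \<in> W (\<xi>, False, n)} \<inter> g' x \<subseteq> ({n. x \<in> W (\<xi>, False, n)} - tower False \<alpha> x) \<union> (tower False \<alpha> x \<inter> g x)"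
          using elim(2) by blast
        moreover have "finite \<dots>" using elim(1) heads_Diff_tower_finite[OF \<alpha>(2)] by simp
        ultimately show ?case by (meson finite_subset)
      qed
    qed
  qed
  show ?thesis
    unfolding gap_def
  proof (intro conjI notI pregap_tower)
    assume "\<exists>c\<in>carrier (L0_Fin M). (\<forall>a\<in>(\<lambda>\<alpha>. fin_class M (tower True \<alpha>)) ` Field omega1. a \<sqsubset>\<^bsub>L0_Fin M\<^esub> c) \<and>
      (\<forall>b\<in>(\<lambda>\<alpha>. fin_class M (tower False \<alpha>)) ` Field omega1. b \<sqsubset>\<^bsub>L0_Fin M\<^esub> compl (L0_Fin M) c)"
    then obtain c where "c \<in> carrier (L0_Fin M)"
      "\<forall>a\<in>(\<lambda>\<alpha>. fin_class M (tower True \<alpha>)) ` Field omega1. a \<sqsubset>\<^bsub>L0_Fin M\<^esub> c"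
      "\<forall>b\<in>(\<lambda>\<alpha>. fin_class M (tower False \<alpha>)) ` Field omega1. b \<sqsubset>\<^bsub>L0_Fin M\<^esub> compl (L0_Fin M) c"
      by (elim bexE conjE)
    then show False by (intro no_c[of c]) simp_all
  qed
qed


section \<open>The Souslin property\<close>

text \<open>The finitely many towers of a condition merge into the heads along
  \<open>T \<xi>\<close>, the union of their \<open>S \<alpha>\<close>. On an infinite subfamily
  with \<open>card (\<Gamma> \<xi>) \<le> m\<close> the sections of \<open>T \<xi>\<close> are
  bounded by m * h n, and the constant factor does not affect summability.\<close>

lemma souslin_pair_in_E:
  assumes J: "uncountable J" "J \<subseteq> Field omega1"
    and F: "\<And>\<xi>. \<xi> \<in> J \<Longrightarrow> F \<xi> \<in> sets M" "\<And>\<xi>. \<xi> \<in> J \<Longrightarrow> 0 < measure P (F \<xi>)"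
    and \<Gamma>: "\<And>\<xi>. \<xi> \<in> J \<Longrightarrow> finite (\<Gamma> \<xi>)"
    and disj: "\<And>\<xi>. \<xi> \<in> J \<Longrightarrow> AE x in M. x \<in> F \<xi> \<longrightarrow>
      (\<Union>\<alpha>\<in>\<Gamma> \<xi>. \<Union>\<beta>\<in>\<Gamma> \<xi>. (tower True \<alpha> x \<inter> tower False \<beta> x) - {..<k}) = {}"
  shows "\<exists>\<xi>\<in>J. \<exists>\<eta>\<in>J. \<xi> \<noteq> \<eta> \<and> 0 < measure P {x \<in> F \<xi> \<inter> F \<eta>. (\<Union>\<alpha>\<in>\<Gamma> \<xi>. \<Union>\<beta>\<in>\<Gamma> \<eta>.
    ((tower True \<alpha> x \<inter> tower False \<beta> x) - {..<k}) \<union> ((tower True \<beta> x \<inter> tower False \<alpha> x) - {..<k})) = {}}"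
proof -
  obtain e m where e: "0 < e" and inf: "infinite {\<xi> \<in> J. e \<le> measure P (F \<xi>) \<and> card (\<Gamma> \<xi>) \<le> m}"
    using exists_infinite_ge[of J "\<lambda>\<xi>. measure P (F \<xi>)" "\<lambda>\<xi>. card (\<Gamma> \<xi>)", OF J(1)] F(2) by auto
  define \<Xi> where "\<Xi> = {\<xi> \<in> J. e \<le> measure P (F \<xi>) \<and> card (\<Gamma> \<xi>) \<le> m}"
  have \<Xi>: "\<xi> \<in> J" "e \<le> measure P (F \<xi>)" "card (\<Gamma> \<xi>) \<le> m" if "\<xi> \<in> \<Xi>" for \<xi> using that by (auto simp: \<Xi>_def)
  define T where "T = (\<lambda>\<xi>. \<Union>\<alpha>\<in>\<Gamma> \<xi>. S \<alpha>)"
  have heads_T: "P.heads b (T \<xi>) x = (\<Union>\<alpha>\<in>\<Gamma> \<xi>. tower b \<alpha> x)" for b \<xi> x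
    by (auto simp: T_def tower_def P.heads_def)
  have sec: "{\<zeta>. (\<zeta>, n) \<in> T \<xi>} = (\<Union>\<alpha>\<in>\<Gamma> \<xi>. {\<zeta>. (\<zeta>, n) \<in> S \<alpha>})" for n \<xi> by (auto simp: T_def)
  have "\<exists>\<xi>\<in>\<Xi>. \<exists>\<eta>\<in>\<Xi>. \<xi> \<noteq> \<eta> \<and> 0 < measure P {x \<in> F \<xi> \<inter> F \<eta>.
    P.heads True (T \<xi>) x \<inter> P.heads False (T \<eta>) x \<subseteq> {..<k} \<and> P.heads True (T \<eta>) x \<inter> P.heads False (T \<xi>) x \<subseteq> {..<k}}"
  proof (rule P.exists_positive_compatible_pair[where \<epsilon>=e and g="\<lambda>n. real m * h n"])
    show "infinite \<Xi>" using inf by (simp add: \<Xi>_def)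
    show "0 < e" by (rule e)
    show "summable (\<lambda>n. (real m * h n)\<^sup>2 * (t n)\<^sup>2)"
      using summable_mult[OF summable, of "(real m)\<^sup>2"] by (simp add: power_mult_distrib mult.assoc)
    fix \<xi> assume x: "\<xi> \<in> \<Xi>"
    show "F \<xi> \<in> sets P" using F(1)[OF \<Xi>(1)[OF x]] by simp
    show "e \<le> measure P (F \<xi>)" by (rule \<Xi>(2)[OF x])
    show "T \<xi> \<subseteq> Field omega1 \<times> UNIV" using S_Field by (simp add: T_def UN_least)
    show "finite {\<zeta>. (\<zeta>, n) \<in> T \<xi>}" for n
      unfolding sec using \<Gamma>[OF \<Xi>(1)[OF x]] S_finite by simp
    show "real (card {\<zeta>. (\<zeta>, n) \<in> T \<xi>}) \<le> real m * h n" for n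
    proof -
      have "card {\<zeta>. (\<zeta>, n) \<in> T \<xi>} \<le> (\<Sum>\<alpha>\<in>\<Gamma> \<xi>. card {\<zeta>. (\<zeta>, n) \<in> S \<alpha>})"
        unfolding sec using \<Gamma>[OF \<Xi>(1)[OF x]] by (rule card_UN_le)
      then have "real (card {\<zeta>. (\<zeta>, n) \<in> T \<xi>}) \<le> (\<Sum>\<alpha>\<in>\<Gamma> \<xi>. real (card {\<zeta>. (\<zeta>, n) \<in> S \<alpha>}))"
        unfolding of_nat_sum[symmetric] of_nat_le_iff .
      also have "\<dots> \<le> (\<Sum>\<alpha>\<in>\<Gamma> \<xi>. h n)" using S_card by (intro sum_mono)
      also have "\<dots> = real (card (\<Gamma> \<xi>)) * h n" by simp
      also have "\<dots> \<le> real m * h n" using \<Xi>(3)[OF x] h[of n] by (intro mult_right_mono) auto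
      finally show ?thesis .
    qed
    show "AE x in P. x \<in> F \<xi> \<longrightarrow> P.heads True (T \<xi>) x \<inter> P.heads False (T \<xi>) x \<subseteq> {..<k}"
      unfolding AE_P_iff heads_T using disj[OF \<Xi>(1)[OF x]] by eventually_elim blast
  qed
  then obtain \<xi> \<eta> where xy: "\<xi> \<in> \<Xi>" "\<eta> \<in> \<Xi>" "\<xi> \<noteq> \<eta>" and pos: "0 < measure P {x \<in> F \<xi> \<inter> F \<eta>.
    P.heads True (T \<xi>) x \<inter> P.heads False (T \<eta>) x \<subseteq> {..<k} \<and> P.heads True (T \<eta>) x \<inter> P.heads False (T \<xi>) x \<subseteq> {..<k}}"
    by (elim bexE conjE)
  have iff: "P.heads True (T \<xi>) x \<inter> P.heads False (T \<eta>) x \<subseteq> {..<k} \<and> P.heads True (T \<eta>) x \<inter> P.heads False (T \<xi>) x \<subseteq> {..<k} \<longleftrightarrow>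
    (\<Union>\<alpha>\<in>\<Gamma> \<xi>. \<Union>\<beta>\<in>\<Gamma> \<eta>. ((tower True \<alpha> x \<inter> tower False \<beta> x) - {..<k}) \<union> ((tower True \<beta> x \<inter> tower False \<alpha> x) - {..<k})) = {}" for x
    unfolding heads_T by blast
  show ?thesis using pos xy \<Xi>(1) unfolding iff by (intro bexI[of _ \<xi>] bexI[of _ \<eta>] conjI) simp_all
qed

lemma measure_P: "A \<in> sets M \<Longrightarrow> measure P A = measure M (E \<inter> A) / measure M E"
  by (rule measure_uniform_measure_eq[OF E(1)])

lemma measure_P_pos_imp:
  assumes "A \<in> sets M" "0 < measure P A"
  shows "0 < emeasure M A"
proof -
  have "0 < measure M (E \<inter> A)" using assms E(2) by (simp add: measure_P zero_less_divide_iff)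
  then have "0 < emeasure M (E \<inter> A)" by (simp add: measure_def enn2real_positive_iff)
  also have "\<dots> \<le> emeasure M A" using assms(1) by (intro emeasure_mono) auto
  finally show ?thesis .
qed

text \<open>By \<sigma>-finiteness and a pigeonhole argument, infinitely many of the sets meet one
  \<open>X m\<close> in measure at least \<open>e\<close>; the \<open>X i\<close> increase, so
  bounding the index is enough. \<open>exists_pair_positive_Int\<close> then applies to the
  normalised measure on \<open>X m\<close>.\<close>

lemma exists_pair_positive_emeasure_Int:
  assumes J: "uncountable J" and F: "\<And>\<xi>. \<xi> \<in> J \<Longrightarrow> F \<xi> \<in> sets M" "\<And>\<xi>. \<xi> \<in> J \<Longrightarrow> 0 < emeasure M (F \<xi>)"
  shows "\<exists>\<xi>\<in>J. \<exists>\<eta>\<in>J. \<xi> \<noteq> \<eta> \<and> 0 < emeasure M (F \<xi> \<inter> F \<eta>)"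
proof -
  obtain X :: "nat \<Rightarrow> 'a set" where X: "range X \<subseteq> sets M" "\<Union>(range X) = space M"
    "\<And>i. emeasure M (X i) \<noteq> \<infinity>" "incseq X" using sigma_finite_incseq by blast
  have Xf: "X i \<in> fmeasurable M" for i using X by (auto simp: fmeasurable_def top.not_eq_extremum)
  have "\<exists>i. 0 < measure M (X i \<inter> F \<xi>)" if x: "\<xi> \<in> J" for \<xi>
  proof (rule ccontr)
    assume neg: "\<not> ?thesis"
    have "X i \<inter> F \<xi> \<in> null_sets M" for i
    proof -
      have "X i \<inter> F \<xi> \<in> fmeasurable M" using Xf[of i] F(1)[OF x] by (intro fmeasurable_Int_fmeasurable)
      moreover have "measure M (X i \<inter> F \<xi>) = 0" using neg by (metis less_le measure_nonneg)
      ultimately show ?thesis by (intro null_setsI) (auto simp: fmeasurable_def emeasure_eq_ennreal_measure)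
    qed
    then have "(\<Union>i. X i \<inter> F \<xi>) \<in> null_sets M" by (rule null_sets_UN)
    moreover have "(\<Union>i. X i \<inter> F \<xi>) = F \<xi>" using X(2) sets.sets_into_space[OF F(1)[OF x]] by blast
    ultimately show False using F(2)[OF x] by (simp add: null_sets_def)
  qed
  then obtain c where c: "\<And>\<xi>. \<xi> \<in> J \<Longrightarrow> 0 < measure M (X (c \<xi>) \<inter> F \<xi>)" by metis
  obtain e m where e: "0 < e" and inf: "infinite {\<xi> \<in> J. e \<le> measure M (X (c \<xi>) \<inter> F \<xi>) \<and> c \<xi> \<le> m}"
    using exists_infinite_ge[of J "\<lambda>\<xi>. measure M (X (c \<xi>) \<inter> F \<xi>)" c, OF J] c by auto
  define \<Xi> where "\<Xi> = {\<xi> \<in> J. e \<le> measure M (X (c \<xi>) \<inter> F \<xi>) \<and> c \<xi> \<le> m}"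
  have \<Xi>: "\<xi> \<in> J" "e \<le> measure M (X m \<inter> F \<xi>)" if "\<xi> \<in> \<Xi>" for \<xi>
  proof -
    show x: "\<xi> \<in> J" using that by (simp add: \<Xi>_def)
    have "X (c \<xi>) \<subseteq> X m" using that X(4) by (auto simp: \<Xi>_def incseq_def)
    then have "measure M (X (c \<xi>) \<inter> F \<xi>) \<le> measure M (X m \<inter> F \<xi>)"
      using Xf F(1)[OF x] by (intro measure_mono_fmeasurable fmeasurable_Int_fmeasurable) (auto intro: fmeasurableD)
    then show "e \<le> measure M (X m \<inter> F \<xi>)" using that by (simp add: \<Xi>_def)
  qed
  have infX: "infinite \<Xi>" using inf by (simp add: \<Xi>_def)
  then obtain \<xi>0 where "\<xi>0 \<in> \<Xi>" using infinite_imp_nonempty by (metis ex_in_conv)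
  then have "e \<le> measure M (X m \<inter> F \<xi>0)" "F \<xi>0 \<in> sets M" using \<Xi> F by auto
  then have "e \<le> measure M (X m)"
    using measure_mono_fmeasurable[of "X m \<inter> F \<xi>0" "X m" M] Xf[of m] fmeasurableD[OF Xf[of m]] by auto
  then have Xm: "0 < measure M (X m)" using e by linarith
  let ?Q = "uniform_measure M (X m)"
  have "emeasure M (X m) \<noteq> 0" using Xm by (auto simp: measure_def)
  then interpret Q: prob_space ?Q using X(3)[of m] by (intro prob_space_uniform_measure)
  have "\<exists>\<xi>\<in>\<Xi>. \<exists>\<eta>\<in>\<Xi>. \<xi> \<noteq> \<eta> \<and> 0 < measure ?Q (F \<xi> \<inter> F \<eta>)"
  proof (rule Q.exists_pair_positive_Int[OF infX])
    show "0 < e / measure M (X m)" using e Xm by simp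
    show "F \<xi> \<in> sets ?Q" if "\<xi> \<in> \<Xi>" for \<xi> using F(1)[OF \<Xi>(1)[OF that]] by simp
    show "e / measure M (X m) \<le> measure ?Q (F \<xi>)" if "\<xi> \<in> \<Xi>" for \<xi>
      using \<Xi>(2)[OF that] Xm measure_uniform_measure_eq[OF Xf F(1)[OF \<Xi>(1)[OF that]], of m]
      by (simp add: divide_right_mono)
  qed
  then obtain \<xi> \<eta> where xy: "\<xi> \<in> \<Xi>" "\<eta> \<in> \<Xi>" "\<xi> \<noteq> \<eta>" "0 < measure ?Q (F \<xi> \<inter> F \<eta>)" by (elim bexE conjE)
  have FF: "F \<xi> \<inter> F \<eta> \<in> sets M" using F(1)[OF \<Xi>(1)[OF xy(1)]] F(1)[OF \<Xi>(1)[OF xy(2)]] by simp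
  have "0 < measure M (X m \<inter> (F \<xi> \<inter> F \<eta>))"
    using xy(4) Xm measure_uniform_measure_eq[OF Xf FF, of m] by (simp add: zero_less_divide_iff)
  then have "0 < emeasure M (X m \<inter> (F \<xi> \<inter> F \<eta>))" by (simp add: measure_def enn2real_positive_iff)
  also have "\<dots> \<le> emeasure M (F \<xi> \<inter> F \<eta>)" using FF by (intro emeasure_mono) auto
  finally show ?thesis using xy \<Xi>(1) by blast
qed

lemma compatible_sets:
  assumes "A \<in> sets M" "finite \<Gamma>" "finite \<Delta>"
  shows "{x \<in> A. (\<Union>\<alpha>\<in>\<Gamma>. \<Union>\<beta>\<in>\<Delta>. ((tower True \<alpha> x \<inter> tower False \<beta> x) - {..<k}) \<union>
    ((tower True \<beta> x \<inter> tower False \<alpha> x) - {..<k})) = {}} \<in> sets M"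
proof -
  let ?H = "\<lambda>b \<alpha> n. {x \<in> space M. n \<in> tower b \<alpha> x}"
  have "{x \<in> A. (\<Union>\<alpha>\<in>\<Gamma>. \<Union>\<beta>\<in>\<Delta>. ((tower True \<alpha> x \<inter> tower False \<beta> x) - {..<k}) \<union>
      ((tower True \<beta> x \<inter> tower False \<alpha> x) - {..<k})) = {}} =
    A - (\<Union>\<alpha>\<in>\<Gamma>. \<Union>\<beta>\<in>\<Delta>. \<Union>n\<in>{k..}. (?H True \<alpha> n \<inter> ?H False \<beta> n) \<union> (?H True \<beta> n \<inter> ?H False \<alpha> n))"
    using sets.sets_into_space[OF assms(1)] by (auto simp: subset_iff not_le[symmetric])
  also have "\<dots> \<in> sets M"
    using assms tower_sets by (intro sets.Diff sets.finite_UN sets.countable_UN' sets.Un sets.Int) auto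
  finally show ?thesis .
qed

text \<open>Conditions may lie anywhere in the space, while the coins live on \<open>E\<close>.
  Either uncountably many \<open>F \<xi>\<close> have positive measure within \<open>E\<close>, and
  the coin flips decide, or uncountably many miss \<open>E\<close> up to a null set; all towers are
  empty off \<open>E\<close>, so any two of the latter with nonnull intersection are compatible
  there.\<close>

lemma souslin_tower: "souslin_enum M (tower True) (tower False)"
  unfolding souslin_enum_def
proof (intro allI impI)
  fix k :: nat and F :: "nat set \<Rightarrow> 'a set" and \<Gamma> :: "nat set \<Rightarrow> nat set set"
  assume hyp: "\<forall>\<xi>\<in>Field omega1. F \<xi> \<in> sets M \<and> 0 < emeasure M (F \<xi>) \<and> emeasure M (F \<xi>) < \<infinity> \<and>
         finite (\<Gamma> \<xi>) \<and> \<Gamma> \<xi> \<subseteq> Field omega1 \<and>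
         (AE x in M. x \<in> F \<xi> \<longrightarrow> (\<Union>\<alpha>\<in>\<Gamma> \<xi>. \<Union>\<beta>\<in>\<Gamma> \<xi>. (tower True \<alpha> x \<inter> tower False \<beta> x) - {..<k}) = {})"
  let ?G = "\<lambda>\<xi> \<eta>. {x \<in> F \<xi> \<inter> F \<eta>. (\<Union>\<alpha>\<in>\<Gamma> \<xi>. \<Union>\<beta>\<in>\<Gamma> \<eta>.
      ((tower True \<alpha> x \<inter> tower False \<beta> x) - {..<k}) \<union> ((tower True \<beta> x \<inter> tower False \<alpha> x) - {..<k})) = {}}"
  let ?goal = "\<exists>\<xi>\<in>Field omega1. \<exists>\<eta>\<in>Field omega1. \<xi> \<noteq> \<eta> \<and> emeasure M (F \<xi> \<inter> F \<eta>) \<noteq> 0 \<and>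
         0 < emeasure (completion M) (?G \<xi> \<eta>)"
  have F\<Gamma>: "F \<xi> \<in> sets M" "finite (\<Gamma> \<xi>)" if "\<xi> \<in> Field omega1" for \<xi>
    using bspec[OF hyp that] by simp_all
  have G: "?G \<xi> \<eta> \<in> sets M" "F \<xi> \<inter> F \<eta> \<in> sets M" if "\<xi> \<in> Field omega1" "\<eta> \<in> Field omega1" for \<xi> \<eta>
  proof -
    show FF: "F \<xi> \<inter> F \<eta> \<in> sets M" using F\<Gamma>(1)[OF that(1)] F\<Gamma>(1)[OF that(2)] by simp
    show "?G \<xi> \<eta> \<in> sets M" using FF F\<Gamma>(2)[OF that(1)] F\<Gamma>(2)[OF that(2)] by (rule compatible_sets)
  qed
  have fin: ?goal if xy: "\<xi> \<in> Field omega1" "\<eta> \<in> Field omega1" "\<xi> \<noteq> \<eta>" and pos: "0 < emeasure M (?G \<xi> \<eta>)" for \<xi> \<eta>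
  proof -
    have "emeasure M (?G \<xi> \<eta>) \<le> emeasure M (F \<xi> \<inter> F \<eta>)" using G[OF xy(1,2)] by (intro emeasure_mono) auto
    with pos have "0 < emeasure M (F \<xi> \<inter> F \<eta>)" by (rule less_le_trans)
    then have "emeasure M (F \<xi> \<inter> F \<eta>) \<noteq> 0" by simp
    moreover have "0 < emeasure (completion M) (?G \<xi> \<eta>)" using pos G(1)[OF xy(1,2)] by simp
    ultimately show ?thesis using xy by (intro bexI[of _ \<xi>] bexI[of _ \<eta>] conjI)
  qed
  define J where "J = {\<xi> \<in> Field omega1. 0 < measure P (F \<xi>)}"
  define K where "K = {\<xi> \<in> Field omega1. measure P (F \<xi>) = 0}"
  have "Field omega1 = J \<union> K" by (auto simp: J_def K_def less_le)
  then consider "uncountable J" | "uncountable K"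
    using uncountable_Field_omega1 by (metis countable_Un)
  then show ?goal
  proof cases
    case 1
    have JF: "J \<subseteq> Field omega1" by (auto simp: J_def)
    have "\<exists>\<xi>\<in>J. \<exists>\<eta>\<in>J. \<xi> \<noteq> \<eta> \<and> 0 < measure P (?G \<xi> \<eta>)"
    proof (rule souslin_pair_in_E[OF 1 JF])
      fix \<xi> assume x: "\<xi> \<in> J"
      then have xF: "\<xi> \<in> Field omega1" by (simp add: J_def)
      show "F \<xi> \<in> sets M" "finite (\<Gamma> \<xi>)" using hyp xF by simp_all
      show "AE x in M. x \<in> F \<xi> \<longrightarrow> (\<Union>\<alpha>\<in>\<Gamma> \<xi>. \<Union>\<beta>\<in>\<Gamma> \<xi>. (tower True \<alpha> x \<inter> tower False \<beta> x) - {..<k}) = {}"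
        using bspec[OF hyp xF] by (elim conjE)
      show "0 < measure P (F \<xi>)" using x by (simp add: J_def)
    qed
    then obtain \<xi> \<eta> where xy: "\<xi> \<in> J" "\<eta> \<in> J" "\<xi> \<noteq> \<eta>" "0 < measure P (?G \<xi> \<eta>)" by (elim bexE conjE)
    then have F: "\<xi> \<in> Field omega1" "\<eta> \<in> Field omega1" using JF by auto
    show ?thesis using F xy(3) measure_P_pos_imp[OF G(1)[OF F] xy(4)] by (rule fin)
  next
    case 2
    have KF: "\<xi> \<in> Field omega1" if "\<xi> \<in> K" for \<xi> using that by (simp add: K_def)
    have "\<exists>\<xi>\<in>K. \<exists>\<eta>\<in>K. \<xi> \<noteq> \<eta> \<and> 0 < emeasure M (F \<xi> \<inter> F \<eta>)"
      using bspec[OF hyp KF] by (intro exists_pair_positive_emeasure_Int[OF 2]) simp_all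
    then obtain \<xi> \<eta> where xy: "\<xi> \<in> K" "\<eta> \<in> K" "\<xi> \<noteq> \<eta>" and pos: "0 < emeasure M (F \<xi> \<inter> F \<eta>)" by (elim bexE conjE)
    note F = KF[OF xy(1)] KF[OF xy(2)]
    have Fs: "F \<xi> \<in> sets M" using hyp F by simp
    have "measure M (E \<inter> F \<xi>) = 0" using xy(1) E(2) Fs by (simp add: K_def measure_P)
    then have null: "E \<inter> F \<xi> \<in> null_sets M"
      using fmeasurable_Int_fmeasurable[OF E(1) Fs] by (intro null_setsI) (auto simp: fmeasurable_def emeasure_eq_ennreal_measure)
    have "F \<xi> \<inter> F \<eta> \<subseteq> ?G \<xi> \<eta> \<union> (E \<inter> F \<xi>)"
    proof
      fix x assume "x \<in> F \<xi> \<inter> F \<eta>"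
      then show "x \<in> ?G \<xi> \<eta> \<union> (E \<inter> F \<xi>)" using tower_empty[of x] by (cases "x \<in> E") simp_all
    qed
    then have "emeasure M (F \<xi> \<inter> F \<eta>) \<le> emeasure M (?G \<xi> \<eta> \<union> (E \<inter> F \<xi>))"
      using G(1)[OF F] null by (intro emeasure_mono sets.Un) auto
    also have "\<dots> = emeasure M (?G \<xi> \<eta>)" using G(1)[OF F] null by (rule emeasure_Un_null_set)
    finally have "0 < emeasure M (?G \<xi> \<eta>)" using pos by (rule less_le_trans[rotated])
    with F xy(3) show ?thesis by (rule fin)
  qed
qed

lemma souslin_gap:
  "\<exists>A B. omega1_gap (L0_Fin M) A B \<and> souslin_pregap M A B"
proof (intro exI conjI)
  let ?A = "\<lambda>b. (\<lambda>\<alpha>. fin_class M (tower b \<alpha>)) ` Field omega1"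
  show "omega1_gap (L0_Fin M) (?A True) (?A False)"
    unfolding omega1_gap_def using gap_tower order_type_tower by simp
  show "souslin_pregap M (?A True) (?A False)"
    unfolding souslin_pregap_def using pregap_tower tower_random_set souslin_tower
    by (intro conjI exI[of _ "tower True"] exI[of _ "tower False"]) simp_all
qed

end

section \<open>Choice of the parameters and of the coins\<close>

theorem theoremB:
  fixes M :: "'a measure"
  assumes "sigma_finite_measure M" and "nonseparable M"
  shows "\<exists>A B. omega1_gap (L0_Fin M) A B \<and> souslin_pregap M A B"
proof -
  interpret sigma_finite_measure M by fact
  obtain E where E: "E \<in> fmeasurable M" "0 < measure M E"
    and gen: "\<And>F. F \<in> sets M \<Longrightarrow> F \<subseteq> E \<Longrightarrow> 0 < measure M F \<Longrightarrow> \<not> countably_generated_on M F"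
    using nonseparable_imp_nowhere_countably_generated[OF assms] by blast
  let ?P = "uniform_measure M E"
  have em: "emeasure M E \<noteq> 0" "emeasure M E \<noteq> \<infinity>" using E by (auto simp: fmeasurable_def measure_def)
  interpret P: prob_space ?P using em by (rule prob_space_uniform_measure)
  interpret N: nowhere_countably_generated ?P using E gen by (rule nowhere_countably_generated_uniform_measure)
  \<comment> \<open>With \<open>n + 2\<close> even \<open>t 0\<close> is below 1. For
    \<open>h\<close> any exponent strictly between 0 and 1/2 would do: \<open>h\<close> must tend to
    infinity while h^2 t^2, here of order n^(-3/2), stays summable.\<close>
  define t :: "nat \<Rightarrow> real" where "t = (\<lambda>n. 1 / (real n + 2))"
  define h :: "nat \<Rightarrow> real" where "h = (\<lambda>n. (real n + 2) powr (1/4))"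
  have t: "0 < t n" "t n < 1" for n by (simp_all add: t_def)
  have "\<not> summable (\<lambda>n. real (n + 2) powr (- 1))"
    unfolding summable_iff_shift[of "\<lambda>n. real n powr (- 1)" 2] summable_real_powr_iff by simp
  then have not_summable: "\<not> summable t" by (simp add: t_def powr_minus_divide add.commute)
  have "summable (\<lambda>n. real (n + 2) powr (- 3/2))"
    unfolding summable_iff_shift[of "\<lambda>n. real n powr (- 3/2)" 2] summable_real_powr_iff by simp
  moreover have "real (n + 2) powr (- 3/2) = (h n)\<^sup>2 * (t n)\<^sup>2" for n
  proof -
    have "(h n)\<^sup>2 = (real n + 2) powr (1/2)"
      unfolding h_def power2_eq_square powr_add[symmetric] by simp
    moreover have "(t n)\<^sup>2 = (real n + 2) powr (- 2)"
      by (simp add: t_def power_divide powr_minus_divide)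
    ultimately have "(h n)\<^sup>2 * (t n)\<^sup>2 = (real n + 2) powr (1/2 + - 2)" by (simp only: powr_add)
    also have "1/2 + - 2 = (- 3/2 :: real)" by simp
    finally show ?thesis by (simp add: add.commute)
  qed
  ultimately have summable: "summable (\<lambda>n. (h n)\<^sup>2 * (t n)\<^sup>2)" by simp
  have h1: "1 \<le> h n" for n by (simp add: h_def ge_one_powr_ge_zero)
  have h_top: "filterlim h at_top sequentially" unfolding h_def by real_asymp
  have h0: "0 \<le> h n" for n by (simp add: h_def)
  obtain S where S: "\<forall>\<alpha>. slow h (S \<alpha>) \<and> (\<forall>n. real (card {\<zeta>. (\<zeta>, n) \<in> S \<alpha>}) \<le> h n) \<and> S \<alpha> \<subseteq> underS omega1 \<alpha> \<times> UNIV \<and>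
    (\<forall>\<beta>\<in>underS omega1 \<alpha>. finite (S \<beta> - S \<alpha>) \<and> finite ({\<beta>} \<times> UNIV - S \<alpha>))"
    using exists_slow_tower[OF h0 h_top] by (elim exE)
  \<comment> \<open>Each ordinal carries only countably many flips, so the initial segments of this
    lexicographic well-order are countable.\<close>
  define R where "R = (omega1 - Id) <*lex*> ({(False, True)} <*lex*> less_than)"
  let ?I = "Field omega1 \<times> (UNIV :: (bool \<times> nat) set)"
  have "wf {(False, True)}" by (rule wfI_min) auto
  then have wfR: "wf R" unfolding R_def by (intro wf_lex_prod wf_omega1 wf_less_than)
  have total: "(x, y) \<in> R \<or> (y, x) \<in> R" if "x \<in> ?I" "y \<in> ?I" "x \<noteq> y" for x y
  proof -
    obtain \<xi> b n \<eta> c m where xy: "x = (\<xi>, b, n)" "y = (\<eta>, c, m)" by (metis prod_cases3)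
    then have F: "\<xi> \<in> Field omega1" "\<eta> \<in> Field omega1" using that by auto
    show ?thesis using omega1_cases[OF F] that(3) by (cases b; cases c) (auto simp: R_def xy underS_def)
  qed
  have pred: "countable {y. (y, x) \<in> R}" for x
  proof -
    obtain \<xi> b n where x: "x = (\<xi>, b, n)" by (metis prod_cases3)
    have "{y. (y, x) \<in> R} \<subseteq> insert \<xi> (underS omega1 \<xi>) \<times> UNIV" by (auto simp: R_def x underS_def)
    moreover have "countable (insert \<xi> (underS omega1 \<xi>) \<times> (UNIV :: (bool \<times> nat) set))"
      using countable_underS_omega1 by (intro countable_SIGMA countable_insert) auto
    ultimately show ?thesis by (rule countable_subset)
  qed
  have t_le: "0 \<le> t (snd (snd x))" "t (snd (snd x)) \<le> 1" for x :: "nat set \<times> bool \<times> nat"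
    using t[of "snd (snd x)"] by simp_all
  have "\<exists>W. P.indep_events W ?I \<and> (\<forall>x\<in>?I. measure ?P (W x) = t (snd (snd x)))"
    by (rule N.exists_independent_family[OF P.prob_space_axioms wfR total pred t_le])
  then obtain W where W: "P.indep_events W ?I" and pW: "\<forall>x\<in>?I. measure ?P (W x) = t (snd (snd x))"
    by (elim exE conjE)
  have Es: "E \<in> sets M" using E(1) by auto
  have PE: "measure ?P (A \<inter> E) = measure ?P A" if "A \<in> sets M" for A
    using measure_uniform_measure_eq[OF E(1), of "A \<inter> E"] measure_uniform_measure_eq[OF E(1) that] Es that
    by (simp add: Int_ac)
  have We: "W i \<in> sets M" if "i \<in> ?I" for i using W that unfolding P.indep_events_def by auto
  \<comment> \<open>The events obtained so far need not lie inside \<open>E\<close>. Cutting them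
    down to \<open>E\<close> changes no probability under \<open>?P\<close> and makes the towers
    vanish off \<open>E\<close>.\<close>
  have flips: "coin_flips ?P (\<lambda>i. W i \<inter> E) (Field omega1) t"
  proof
    show "P.indep_events (\<lambda>i. W i \<inter> E) ?I"
      unfolding P.indep_events_def
    proof (intro conjI allI impI)
      show "(\<lambda>i. W i \<inter> E) ` ?I \<subseteq> P.events" using We Es by auto
      fix J assume J: "J \<subseteq> ?I" "J \<noteq> {}" "finite J"
      have WJ: "W j \<in> sets M" if "j \<in> J" for j using We J(1) that by (meson subsetD)
      have "(\<Inter>j\<in>J. W j \<inter> E) = (\<Inter>j\<in>J. W j) \<inter> E" using J(2) by auto
      moreover have "(\<Inter>j\<in>J. W j) \<in> sets M" using J WJ by (intro sets.finite_INT) auto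
      ultimately have "P.prob (\<Inter>j\<in>J. W j \<inter> E) = P.prob (\<Inter>j\<in>J. W j)" using PE by simp
      also have "\<dots> = (\<Prod>j\<in>J. P.prob (W j))" using W J unfolding P.indep_events_def by simp
      also have "\<dots> = (\<Prod>j\<in>J. P.prob (W j \<inter> E))" using WJ PE by simp
      finally show "P.prob (\<Inter>j\<in>J. W j \<inter> E) = (\<Prod>j\<in>J. P.prob (W j \<inter> E))" .
    qed
    show "P.prob (W (\<xi>, b, n) \<inter> E) = t n" if "\<xi> \<in> Field omega1" for \<xi> b n
      using PE[OF We[of "(\<xi>, b, n)"]] bspec[OF pW, of "(\<xi>, b, n)"] that by simp
  qed (rule t)+
  have "random_tower M E (\<lambda>i. W i \<inter> E) t h S"
  proof (intro random_tower.intro random_tower_axioms.intro)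
    show "finite {\<zeta>. (\<zeta>, n) \<in> S \<alpha>}" for \<alpha> n using S by (simp add: slow_def)
    show "real (card {\<zeta>. (\<zeta>, n) \<in> S \<alpha>}) \<le> h n" for \<alpha> n using S by simp
    show "S \<alpha> \<subseteq> underS omega1 \<alpha> \<times> UNIV" for \<alpha> using S by simp
    show "finite (S \<beta> - S \<alpha>)" if "\<beta> \<in> underS omega1 \<alpha>" for \<alpha> \<beta> using S that by simp
    show "finite ({\<beta>} \<times> UNIV - S \<alpha>)" if "\<beta> \<in> underS omega1 \<alpha>" for \<alpha> \<beta> using S that by simp
  qed (rule assms E flips not_summable summable h1 Int_lower2)+
  then interpret random_tower M E "\<lambda>i. W i \<inter> E" t h S .
  show ?thesis by (rule souslin_gap)
qed

end
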